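(* Let $(M,\omega)$ be a four-dimensional symplectic manifold, let $\rho\colon M\to M$ be an antisymplectic involution, and let $H\colon M\to\mathbb{R}$ be a smooth function with $H\circ\rho=H$. Let $v\colon\mathbb{R}/\tau\mathbb{Z}\to M$ be a nonconstant periodic orbit of the Hamiltonian vector field $X_H$ of period $\tau>0$ which is symmetric, i.e. $\rho(v(-t))=v(t)$ for all $t$, and suppose that its reduced monodromy has trace different from $\pm2$. Then $v$ is negative hyperbolic if and only if its two B-signs (at the symmetric points $v(0)$ and $v(\tau/2)$) are different.
   Context: A diffeomorphism $\rho$ of $M$ is an antisymplectic involution if $\rho^2=\mathrm{id}$ and $\rho^*\omega=-\omega$. The Hamiltonian vector field $X_H$ is defined by $dH=\omega(\cdot,X_H)$, and $\phi^t_H$ denotes its flow; the orbit $v$ satisfies $\dot v=X_H(v)$. For a symmetric orbit, $v(0)$ and $v(\tau/2)$ lie in $\mathrm{Fix}(\rho)$; these are its symmetric points. Reduced monodromy. Let $\Sigma=H^{-1}(H(v(0)))$, which is a hypersurface near $v$. For each $t$ the linear map $d\phi^\tau_H(v(t))$ preserves $T_{v(t)}\Sigma$ and fixes $X_H(v(t))$, and hence induces a linear symplectic map $M_v^t$ of the two-dimensional symplectic vector space $T_{v(t)}\Sigma/\langle X_H(v(t))\rangle$, the reduced monodromy at $v(t)$. For different $t$ these are symplectically conjugate, so the trace does not depend on $t$. The orbit is positive hyperbolic if this trace is $>2$, negative hyperbolic if it is $<-2$, and elliptic if it lies in $[-2,2]$. B-signs. Let $t\in\{0,\tau/2\}$.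 The differential $d\rho(v(t))$ induces an antisymplectic linear involution $R$ on $T_{v(t)}\Sigma/\langle X_H(v(t))\rangle$, and $RM_v^tR=(M_v^t)^{-1}$. Choose a symplectic basis (i.e. $(e_1,e_2)$ with induced symplectic form $\omega(e_1,e_2)=1$) in which $R=\begin{pmatrix}1&0\\0&-1\end{pmatrix}$. In this basis $M_v^t=\begin{pmatrix}a&b\\c&a\end{pmatrix}$ with $a^2-bc=1$. The B-sign of $v$ at $v(t)$ is $\mathrm{sign}(b)$. It is independent of the choice of such a basis, and $b\neq0$ whenever $\mathrm{tr}(M_v^t)\neq\pm2$. *)

theory Defs
  imports "HOL-Analysis.Analysis"
begin

section \<open>Smooth manifolds\<close>

text \<open>\<open>Ck_on n S f\<close> is meant for open \<open>S\<close> and finite-dimensional domains, where it says that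
  \<open>f\<close> is of class \<open>C\<^sup>n\<close> on \<open>S\<close>: all iterated directional derivatives up to order \<open>n\<close> exist
  and are continuous.\<close>

primrec Ck_on :: "nat \<Rightarrow> 'a::real_normed_vector set \<Rightarrow> ('a \<Rightarrow> 'b::real_normed_vector) \<Rightarrow> bool" where
  "Ck_on 0 S f \<longleftrightarrow> continuous_on S f"
| "Ck_on (Suc n) S f \<longleftrightarrow> (\<forall>x\<in>S. f differentiable (at x)) \<and>
     (\<forall>u. Ck_on n S (\<lambda>x. frechet_derivative f (at x) u))"

definition smooth_on :: "'a::real_normed_vector set \<Rightarrow> ('a \<Rightarrow> 'b::real_normed_vector) \<Rightarrow> bool" where
  "smooth_on S f \<longleftrightarrow> (\<forall>n. Ck_on n S f)"

text \<open>A manifold is a whole Hausdorff, second countable type \<open>'m\<close> together with an atlas.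
  A chart is a pair of its domain and its coordinate map; values of the coordinate map outside
  the domain carry no meaning.\<close>

type_synonym ('m, 'e) chart = "'m set \<times> ('m \<Rightarrow> 'e)"

abbreviation cdom :: "('m, 'e) chart \<Rightarrow> 'm set" where "cdom c \<equiv> fst c"
abbreviation coord :: "('m, 'e) chart \<Rightarrow> 'm \<Rightarrow> 'e" where "coord c \<equiv> snd c"
abbreviation cimage :: "('m, 'e) chart \<Rightarrow> 'e set" where "cimage c \<equiv> coord c ` cdom c"
abbreviation cinv :: "('m, 'e) chart \<Rightarrow> 'e \<Rightarrow> 'm" where "cinv c \<equiv> inv_into (cdom c) (coord c)"

definition is_chart :: "('m::topological_space, 'e::euclidean_space) chart \<Rightarrow> bool" where
  "is_chart c \<longleftrightarrow> open (cdom c) \<and> open (cimage c) \<and>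
     homeomorphism (cdom c) (cimage c) (coord c) (cinv c)"

definition smooth_atlas ::
  "('m::{t2_space,second_countable_topology}, 'e::euclidean_space) chart set \<Rightarrow> bool" where
  "smooth_atlas A \<longleftrightarrow> (\<forall>c\<in>A. is_chart c) \<and> (\<Union>c\<in>A. cdom c) = UNIV \<and>
     (\<forall>c\<in>A. \<forall>d\<in>A. smooth_on (coord c ` (cdom c \<inter> cdom d)) (coord d \<circ> cinv c))"

definition smooth_function ::
  "('m::topological_space, 'e::euclidean_space) chart set \<Rightarrow> ('m \<Rightarrow> real) \<Rightarrow> bool" where
  "smooth_function A f \<longleftrightarrow> (\<forall>c\<in>A. smooth_on (cimage c) (f \<circ> cinv c))"

definition smooth_map ::
  "('m::topological_space, 'e::euclidean_space) chart set \<Rightarrow> ('m \<Rightarrow> 'm) \<Rightarrow> bool" where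
  "smooth_map A f \<longleftrightarrow> continuous_on UNIV f \<and>
     (\<forall>c\<in>A. \<forall>d\<in>A. smooth_on (coord c ` (cdom c \<inter> f -` cdom d)) (coord d \<circ> f \<circ> cinv c))"

definition diffeomorphism ::
  "('m::topological_space, 'e::euclidean_space) chart set \<Rightarrow> ('m \<Rightarrow> 'm) \<Rightarrow> bool" where
  "diffeomorphism A f \<longleftrightarrow> bij f \<and> smooth_map A f \<and> smooth_map A (inv f)"

section \<open>Tangent vectors and differentials\<close>

text \<open>Every point gets one preferred chart of the atlas around it, and the tangent space at \<open>p\<close> is
  the model space \<open>'e\<close>, a vector standing for its coordinates in the preferred chart at \<open>p\<close>.
  Hence tensor fields at \<open>p\<close> are expressed in this chart, and passing to
  any other chart goes through the derivative of the transition map.\<close>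

definition chart_at :: "('m, 'e) chart set \<Rightarrow> 'm \<Rightarrow> ('m, 'e) chart" where
  "chart_at A p = (SOME c. c \<in> A \<and> p \<in> cdom c)"

definition diff_function ::
  "('m, 'e::euclidean_space) chart set \<Rightarrow> ('m \<Rightarrow> real) \<Rightarrow> 'm \<Rightarrow> 'e \<Rightarrow> real" where
  "diff_function A f p =
     frechet_derivative (f \<circ> cinv (chart_at A p)) (at (coord (chart_at A p) p))"

definition diff_map ::
  "('m, 'e::euclidean_space) chart set \<Rightarrow> ('m \<Rightarrow> 'm) \<Rightarrow> 'm \<Rightarrow> 'e \<Rightarrow> 'e" where
  "diff_map A f p =
     frechet_derivative (coord (chart_at A (f p)) \<circ> f \<circ> cinv (chart_at A p))
       (at (coord (chart_at A p) p))"

definition has_velocity ::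
  "('m::topological_space, 'e::euclidean_space) chart set \<Rightarrow> (real \<Rightarrow> 'm) \<Rightarrow> real \<Rightarrow> 'e \<Rightarrow> bool" where
  "has_velocity A \<gamma> t u \<longleftrightarrow> isCont \<gamma> t \<and>
     ((\<lambda>s. coord (chart_at A (\<gamma> t)) (\<gamma> s)) has_vector_derivative u) (at t)"

text \<open>The tangent space at \<open>p\<close> of a submanifold \<open>S\<close>: the velocities of curves in \<open>S\<close> through \<open>p\<close>.\<close>

definition tangent_space_of ::
  "('m::topological_space, 'e::euclidean_space) chart set \<Rightarrow> 'm set \<Rightarrow> 'm \<Rightarrow> 'e set" where
  "tangent_space_of A S p = {u. \<exists>\<gamma>. \<gamma> 0 = p \<and> range \<gamma> \<subseteq> S \<and> has_velocity A \<gamma> 0 u}"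

section \<open>Symplectic manifolds and Hamiltonian flows\<close>

definition form_in_chart ::
  "('m, 'e::euclidean_space) chart set \<Rightarrow> ('m \<Rightarrow> 'e \<Rightarrow> 'e \<Rightarrow> real) \<Rightarrow> ('m, 'e) chart
     \<Rightarrow> 'e \<Rightarrow> 'e \<Rightarrow> 'e \<Rightarrow> real" where
  "form_in_chart A \<omega> c x u w =
     (let p = cinv c x; D = frechet_derivative (coord (chart_at A p) \<circ> cinv c) (at x)
      in \<omega> p (D u) (D w))"

definition two_form ::
  "('m::topological_space, 'e::euclidean_space) chart set \<Rightarrow> ('m \<Rightarrow> 'e \<Rightarrow> 'e \<Rightarrow> real) \<Rightarrow> bool" where
  "two_form A \<omega> \<longleftrightarrow> (\<forall>p. bilinear (\<omega> p) \<and> (\<forall>u. \<omega> p u u = 0)) \<and>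
     (\<forall>c\<in>A. \<forall>u w. smooth_on (cimage c) (\<lambda>x. form_in_chart A \<omega> c x u w))"

text \<open>The exterior derivative is evaluated in charts on constant vector fields, so that the
  Lie bracket terms vanish.\<close>

definition closed_two_form ::
  "('m::topological_space, 'e::euclidean_space) chart set \<Rightarrow> ('m \<Rightarrow> 'e \<Rightarrow> 'e \<Rightarrow> real) \<Rightarrow> bool" where
  "closed_two_form A \<omega> \<longleftrightarrow> two_form A \<omega> \<and>
     (\<forall>c\<in>A. \<forall>x\<in>cimage c. \<forall>u1 u2 u3.
        frechet_derivative (\<lambda>y. form_in_chart A \<omega> c y u2 u3) (at x) u1 +
        frechet_derivative (\<lambda>y. form_in_chart A \<omega> c y u3 u1) (at x) u2 +
        frechet_derivative (\<lambda>y. form_in_chart A \<omega> c y u1 u2) (at x) u3 = 0)"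

definition symplectic_manifold ::
  "('m::{t2_space,second_countable_topology}, 'e::euclidean_space) chart set
     \<Rightarrow> ('m \<Rightarrow> 'e \<Rightarrow> 'e \<Rightarrow> real) \<Rightarrow> bool" where
  "symplectic_manifold A \<omega> \<longleftrightarrow> smooth_atlas A \<and> closed_two_form A \<omega> \<and>
     (\<forall>p u. u \<noteq> 0 \<longrightarrow> (\<exists>w. \<omega> p u w \<noteq> 0))"

definition antisymplectic_involution ::
  "('m::topological_space, 'e::euclidean_space) chart set \<Rightarrow> ('m \<Rightarrow> 'e \<Rightarrow> 'e \<Rightarrow> real)
     \<Rightarrow> ('m \<Rightarrow> 'm) \<Rightarrow> bool" where
  "antisymplectic_involution A \<omega> \<rho> \<longleftrightarrow> diffeomorphism A \<rho> \<and> \<rho> \<circ> \<rho> = id \<and>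
     (\<forall>p u w. \<omega> (\<rho> p) (diff_map A \<rho> p u) (diff_map A \<rho> p w) = - \<omega> p u w)"

definition hamiltonian_vf ::
  "('m, 'e::euclidean_space) chart set \<Rightarrow> ('m \<Rightarrow> 'e \<Rightarrow> 'e \<Rightarrow> real) \<Rightarrow> ('m \<Rightarrow> real) \<Rightarrow> 'm \<Rightarrow> 'e" where
  "hamiltonian_vf A \<omega> H p = (THE x. \<forall>u. diff_function A H p u = \<omega> p u x)"

definition integral_curve ::
  "('m::topological_space, 'e::euclidean_space) chart set \<Rightarrow> ('m \<Rightarrow> 'e) \<Rightarrow> real set
     \<Rightarrow> (real \<Rightarrow> 'm) \<Rightarrow> bool" where
  "integral_curve A X J \<gamma> \<longleftrightarrow> (\<forall>t\<in>J. has_velocity A \<gamma> t (X (\<gamma> t)))"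

text \<open>The vector field need not be complete: the value is meaningful only for those \<open>t\<close> and \<open>p\<close> for
  which the integral curve starting at \<open>p\<close> exists up to time \<open>t\<close>. No smoothness is built in.\<close>

definition flow ::
  "('m::topological_space, 'e::euclidean_space) chart set \<Rightarrow> ('m \<Rightarrow> 'e) \<Rightarrow> real \<Rightarrow> 'm \<Rightarrow> 'm" where
  "flow A X t p = (THE q. \<exists>\<gamma> a b. {0, t} \<subseteq> {a<..<b} \<and> integral_curve A X {a<..<b} \<gamma> \<and>
     \<gamma> 0 = p \<and> \<gamma> t = q)"

section \<open>Quotients by a line\<close>

text \<open>\<open>coset x u\<close> is the class of \<open>u\<close> modulo the line spanned by \<open>x\<close>, and the quotient of a
  subspace \<open>V\<close> containing \<open>x\<close> consists of the classes of its elements. The map of the quotient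
  induced by a linear \<open>L\<close> that preserves \<open>V\<close> and the line is taking images of classes, see
  \<open>image_coset\<close> and \<open>coset_minus\<close>.\<close>

definition coset :: "'e::real_vector \<Rightarrow> 'e \<Rightarrow> 'e set" where
  "coset x u = {u + s *\<^sub>R x | s. True}"

lemma image_coset: "linear L \<Longrightarrow> L ` coset x u = coset (L x) (L u)"
  by (force simp: coset_def linear_add linear_scale)

lemma coset_minus: "coset (- x) u = coset x u"
  unfolding coset_def
  by (simp add: set_eq_iff) (metis add.commute add_uminus_conv_diff minus_minus scaleR_minus_left)

definition quotient_basis :: "'e::real_vector set \<Rightarrow> 'e \<Rightarrow> 'e \<Rightarrow> 'e \<Rightarrow> bool" where
  "quotient_basis V x e1 e2 \<longleftrightarrow> e1 \<in> V \<and> e2 \<in> V \<and>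
     (\<forall>u\<in>V. \<exists>!(\<alpha>, \<beta>). coset x u = coset x (\<alpha> *\<^sub>R e1 + \<beta> *\<^sub>R e2))"

text \<open>\<open>F\<close> has the matrix with rows \<open>(a, b)\<close> and \<open>(c, d)\<close> in the basis of the classes of \<open>e1\<close>, \<open>e2\<close>.\<close>

definition quotient_matrix ::
  "('e::real_vector set \<Rightarrow> 'e set) \<Rightarrow> 'e \<Rightarrow> 'e \<Rightarrow> 'e \<Rightarrow> real \<Rightarrow> real \<Rightarrow> real \<Rightarrow> real \<Rightarrow> bool" where
  "quotient_matrix F x e1 e2 a b c d \<longleftrightarrow>
     F (coset x e1) = coset x (a *\<^sub>R e1 + c *\<^sub>R e2) \<and>
     F (coset x e2) = coset x (b *\<^sub>R e1 + d *\<^sub>R e2)"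

definition quotient_trace ::
  "'e::real_vector set \<Rightarrow> 'e \<Rightarrow> ('e set \<Rightarrow> 'e set) \<Rightarrow> real" where
  "quotient_trace V x F = (THE r. \<exists>e1 e2 a b c d. quotient_basis V x e1 e2 \<and>
     quotient_matrix F x e1 e2 a b c d \<and> r = a + d)"

section \<open>Reduced monodromy and B-signs\<close>

definition energy_tangent ::
  "('m::topological_space, 'e::euclidean_space) chart set \<Rightarrow> ('m \<Rightarrow> real) \<Rightarrow> (real \<Rightarrow> 'm)
     \<Rightarrow> real \<Rightarrow> 'e set" where
  "energy_tangent A H v t = tangent_space_of A (H -` {H (v 0)}) (v t)"

definition reduced_monodromy ::
  "('m::topological_space, 'e::euclidean_space) chart set \<Rightarrow> ('m \<Rightarrow> 'e \<Rightarrow> 'e \<Rightarrow> real)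
     \<Rightarrow> ('m \<Rightarrow> real) \<Rightarrow> (real \<Rightarrow> 'm) \<Rightarrow> real \<Rightarrow> real \<Rightarrow> 'e set \<Rightarrow> 'e set" where
  "reduced_monodromy A \<omega> H v \<tau> t = image (diff_map A (flow A (hamiltonian_vf A \<omega> H) \<tau>) (v t))"

text \<open>The trace does not depend on the point of the orbit; it is taken at \<open>v 0\<close>.\<close>

definition monodromy_trace ::
  "('m::topological_space, 'e::euclidean_space) chart set \<Rightarrow> ('m \<Rightarrow> 'e \<Rightarrow> 'e \<Rightarrow> real)
     \<Rightarrow> ('m \<Rightarrow> real) \<Rightarrow> (real \<Rightarrow> 'm) \<Rightarrow> real \<Rightarrow> real" where
  "monodromy_trace A \<omega> H v \<tau> = quotient_trace (energy_tangent A H v 0)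
     (hamiltonian_vf A \<omega> H (v 0)) (reduced_monodromy A \<omega> H v \<tau> 0)"

definition negative_hyperbolic ::
  "('m::topological_space, 'e::euclidean_space) chart set \<Rightarrow> ('m \<Rightarrow> 'e \<Rightarrow> 'e \<Rightarrow> real)
     \<Rightarrow> ('m \<Rightarrow> real) \<Rightarrow> (real \<Rightarrow> 'm) \<Rightarrow> real \<Rightarrow> bool" where
  "negative_hyperbolic A \<omega> H v \<tau> \<longleftrightarrow> monodromy_trace A \<omega> H v \<tau> < - 2"

text \<open>The form induced on the quotient is evaluated on representatives, which is legitimate since
  \<open>\<omega> u X = dH u = 0\<close> for \<open>u\<close> tangent to the energy hypersurface.\<close>

definition B_sign ::
  "('m::topological_space, 'e::euclidean_space) chart set \<Rightarrow> ('m \<Rightarrow> 'e \<Rightarrow> 'e \<Rightarrow> real)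
     \<Rightarrow> ('m \<Rightarrow> 'm) \<Rightarrow> ('m \<Rightarrow> real) \<Rightarrow> (real \<Rightarrow> 'm) \<Rightarrow> real \<Rightarrow> real \<Rightarrow> real" where
  "B_sign A \<omega> \<rho> H v \<tau> t = (THE s. \<exists>e1 e2 a b c d.
     let x = hamiltonian_vf A \<omega> H (v t); R = image (diff_map A \<rho> (v t)) in
       quotient_basis (energy_tangent A H v t) x e1 e2 \<and> \<omega> (v t) e1 e2 = 1 \<and>
       quotient_matrix R x e1 e2 1 0 0 (- 1) \<and>
       quotient_matrix (reduced_monodromy A \<omega> H v \<tau> t) x e1 e2 a b c d \<and> s = sgn b)"

end

theory Submission
  imports Defs
begin

text \<open>By reversibility the flow \<open>\<phi>\<close> satisfies \<open>\<phi>\<^bsup>-t\<^esup> \<circ> \<rho> = \<rho> \<circ> \<phi>\<^bsup>t\<^esup>\<close>. With the half period map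
  \<open>N = d\<phi>\<^bsup>\<tau>/2\<^esup>(v(0))\<close> and the differentials \<open>R\<^sub>0\<close>, \<open>R\<^sub>1\<close> of \<open>\<rho>\<close> at the two symmetric points, the
  monodromies are therefore \<open>R\<^sub>0 N\<^bsup>-1\<^esup> R\<^sub>1 N\<close> and \<open>N R\<^sub>0 N\<^bsup>-1\<^esup> R\<^sub>1\<close>. If the symplectic map \<open>N\<close> has the rows
  \<open>(p, q)\<close> and \<open>(r, s)\<close> in adapted bases of the two reduced planes, then \<open>ps - qr = 1\<close>, the trace is
  \<open>2(ps + qr) = 4ps - 2\<close>, and the upper right entries are \<open>2qs\<close> and \<open>2pq\<close>. So the trace is below
  \<open>-2\<close> iff \<open>ps < 0\<close> iff the B-signs differ.

  The analytic input is that the flow of a \<open>C\<^sup>1\<close> vector field is defined and differentiable near a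
  given orbit, with symplectic differential, and that the tangent space of a regular level set
  is the kernel of the differential.\<close>

section \<open>Ordinary differential equations\<close>

text \<open>Two obstacles shape the proof. \<open>flow\<close> is a bare definite description, with
  neither completeness nor smoothness built in, so even the existence of nearby integral curves up
  to time \<tau> has to be proved. A chart only yields short times; these are concatenated along the
  orbit by a connectedness argument in the time variable. Moreover, tangent vectors are coordinates
  in a preferred chart chosen independently at every point, so derivatives are taken relative to
  explicit pairs of charts (\<open>mderiv\<close>), and equations are solved in one fixed chart and
  translated back.

  The monodromy formulas arise because reversibility expresses the second half of the orbit through
  the first: the flow from \<open>v (\<tau> / 2)\<close> to \<open>v \<tau>\<close> has differential
  \<open>R0 N' R1\<close>, where \<open>N'\<close> is the inverse of \<open>N\<close>. The
  reflections are diagonal in adapted bases, so the four entries of \<open>N\<close> determine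
  everything, and comparing the signs of \<open>2qs\<close> and \<open>2pq\<close> amounts to
  comparing those of \<open>s\<close> and \<open>p\<close>.\<close>

lemma has_vector_derivative_bound:
  fixes z :: "real \<Rightarrow> 'a::real_normed_vector"
  assumes "convex S"
    and "\<And>t. t \<in> S \<Longrightarrow> (z has_vector_derivative z' t) (at t within S)"
    and "\<And>t. t \<in> S \<Longrightarrow> norm (z' t) \<le> B" and "s \<in> S" "t \<in> S"
  shows "norm (z t - z s) \<le> B * \<bar>t - s\<bar>"
proof -
  have "norm (z t - z s) \<le> B * norm (t - s)"
  proof (rule differentiable_bound[OF \<open>convex S\<close>, where f' = "\<lambda>x h. h *\<^sub>R z' x"])
    show "(z has_derivative (\<lambda>h. h *\<^sub>R z' x)) (at x within S)" if "x \<in> S" for x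
      using assms(2)[OF that] by (simp add: has_vector_derivative_def)
    show "onorm (\<lambda>h. h *\<^sub>R z' x) \<le> B" if "x \<in> S" for x
      by (rule onorm_le) (use assms(3)[OF that] in \<open>simp add: mult.commute[of B] mult_left_mono\<close>)
  qed (use assms in auto)
  then show ?thesis by simp
qed

text \<open>At a maximum \<open>M\<close> of the norm the mean value inequality gives
  \<open>M <= norm (z a) + \<delta> * (L * M + \<epsilon>)\<close>, and
  \<open>\<delta> * L <= 1/2\<close> absorbs the term with \<open>M\<close>. Uniqueness, linearity
  in the initial vector and differentiability of the local flow all rest on this estimate.\<close>

lemma small_gronwall:
  fixes z :: "real \<Rightarrow> 'a::real_normed_vector"
  assumes z: "\<And>t. t \<in> {a-\<delta>..a+\<delta>} \<Longrightarrow> (z has_vector_derivative z' t) (at t within {a-\<delta>..a+\<delta>})"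
    and bd: "\<And>t. t \<in> {a-\<delta>..a+\<delta>} \<Longrightarrow> norm (z' t) \<le> L * norm (z t) + \<epsilon>"
    and nn: "0 \<le> \<delta>" "0 \<le> L" "0 \<le> \<epsilon>" and small: "\<delta> * L \<le> 1/2" and t: "t \<in> {a-\<delta>..a+\<delta>}"
  shows "norm (z t) \<le> 2 * (norm (z a) + \<delta> * \<epsilon>)"
proof -
  let ?I = "{a-\<delta>..a+\<delta>}"
  have "continuous_on ?I z"
    using z by (meson continuous_on_eq_continuous_within has_vector_derivative_continuous)
  then have "continuous_on ?I (\<lambda>t. norm (z t))" by (intro continuous_intros)
  then obtain m where m: "m \<in> ?I" "\<And>s. s \<in> ?I \<Longrightarrow> norm (z s) \<le> norm (z m)"
    using continuous_attains_sup[of ?I "\<lambda>t. norm (z t)"] t by auto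
  let ?M = "norm (z m)"
  have "norm (z m - z a) \<le> (L * ?M + \<epsilon>) * \<bar>m - a\<bar>"
  proof (rule has_vector_derivative_bound[OF _ z])
    show "norm (z' s) \<le> L * ?M + \<epsilon>" if "s \<in> ?I" for s
      using bd[OF that] mult_left_mono[OF m(2)[OF that] nn(2)] by linarith
  qed (use m nn in auto)
  also have "\<dots> \<le> (L * ?M + \<epsilon>) * \<delta>"
    using m nn by (intro mult_left_mono) auto
  also have "\<dots> = (\<delta> * L) * ?M + \<delta> * \<epsilon>" by (simp add: algebra_simps)
  also have "\<dots> \<le> 1/2 * ?M + \<delta> * \<epsilon>"
    using mult_right_mono[OF small, of ?M] by simp
  finally have "?M \<le> 2 * (norm (z a) + \<delta> * \<epsilon>)"
    using norm_triangle_ineq2[of "z m" "z a"] by argo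
  with m(2)[OF t] show ?thesis by linarith
qed

text \<open>Continuity of \<open>F\<close> is only required along curves, which is what is available for the
  linearised equation.\<close>

lemma picard:
  fixes F :: "real \<Rightarrow> 'a::euclidean_space \<Rightarrow> 'a"
  assumes cont: "\<And>f. continuous_on {-\<delta>..\<delta>} f \<Longrightarrow> continuous_on {-\<delta>..\<delta>} (\<lambda>t. F t (f t))"
    and lip: "\<And>t x y. t \<in> {-\<delta>..\<delta>} \<Longrightarrow> norm (F t x - F t y) \<le> L * norm (x - y)"
    and \<delta>: "0 < \<delta>" and L: "0 \<le> L" and small: "\<delta> * L \<le> 1/2"
  shows "\<exists>y. y 0 = x \<and> (\<forall>t\<in>{-\<delta>..\<delta>}. (y has_vector_derivative F t (y t)) (at t within {-\<delta>..\<delta>}))"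
proof -
  let ?I = "{-\<delta>..\<delta>}"
  \<comment> \<open>Integrating from the left end and subtracting the value at 0 treats both signs
    of \<open>t\<close> alike.\<close>
  define J where "J f t = integral {-\<delta>..t} (\<lambda>s. F s (f s))" for f :: "real \<Rightarrow> 'a" and t
  define P where "P f t = x + (J f t - J f 0)" for f t
  \<comment> \<open>Clamping to the interval turns the iterates into bounded continuous functions on
    the whole line, so that Banach's theorem applies in the complete space
    \<open>bcontfun\<close>.\<close>
  define cl where "cl t = max (-\<delta>) (min \<delta> t)" for t
  have cl: "cl t \<in> ?I" for t using \<delta> by (auto simp: cl_def)
  have clI: "cl t = t" if "t \<in> ?I" for t using that by (auto simp: cl_def)
  have P: "(P f has_vector_derivative F t (f t)) (at t within ?I)" if "continuous_on ?I f" "t \<in> ?I" for f t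
    unfolding P_def J_def
    by (auto intro!: derivative_eq_intros integral_has_vector_derivative cont that)
  have Pb: "(\<lambda>t. P f (cl t)) \<in> bcontfun" if "continuous_on ?I f" for f
  proof -
    have c: "continuous_on ?I (P f)"
      using P[OF that] by (meson continuous_on_eq_continuous_within has_vector_derivative_continuous)
    have "continuous_on UNIV (\<lambda>t. P f (cl t))"
      by (rule continuous_on_compose2[OF c]) (use cl in \<open>auto simp: cl_def intro!: continuous_intros\<close>)
    moreover have "bounded (P f ` ?I)"
      using compact_continuous_image[OF c] by (simp add: compact_imp_bounded)
    then have "bounded (range (\<lambda>t. P f (cl t)))"
      by (rule bounded_subset) (use cl in auto)
    ultimately show ?thesis by (simp add: bcontfun_def)
  qed
  define T where "T f = Bcontfun (\<lambda>t. P (apply_bcontfun f) (cl t))" for f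
  have T: "apply_bcontfun (T f) t = P (apply_bcontfun f) (cl t)" for f t
    unfolding T_def using Pb[of "apply_bcontfun f"] by (simp add: Bcontfun_inverse)
  have contr: "dist (T f) (T g) \<le> 1/2 * dist f g" for f g
  proof (rule dist_bound)
    fix t
    have "norm ((P f (cl t) - P g (cl t)) - (P f 0 - P g 0)) \<le> L * dist f g * \<bar>cl t - 0\<bar>"
    proof (rule has_vector_derivative_bound[where S = ?I and z = "\<lambda>t. P f t - P g t"
          and z' = "\<lambda>t. F t (f t) - F t (g t)"])
      show "norm (F s (f s) - F s (g s)) \<le> L * dist f g" if "s \<in> ?I" for s
        using lip[OF that, of "f s" "g s"] mult_left_mono[OF dist_bounded[of f s g] L]
        by (simp add: dist_norm)
    qed (use cl \<delta> in \<open>auto intro!: derivative_intros P\<close>)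
    also have "\<dots> \<le> L * dist f g * \<delta>"
      using cl[of t] L by (intro mult_left_mono) auto
    also have "\<dots> = (\<delta> * L) * dist f g" by simp
    also have "\<dots> \<le> 1/2 * dist f g" by (intro mult_right_mono small) auto
    finally show "dist (T f t) (T g t) \<le> 1/2 * dist f g"
      by (simp add: T dist_norm) (simp add: P_def)
  qed
  obtain f where f: "T f = f"
    using banach_fix_type[of "1/2" T] contr by auto
  let ?y = "apply_bcontfun f"
  have yP: "?y t = P ?y t" if "t \<in> ?I" for t using T[of f t] f clI[OF that] by simp
  have "?y 0 = x" using yP[of 0] \<delta> by (simp add: P_def)
  moreover have "(?y has_vector_derivative F t (?y t)) (at t within ?I)" if "t \<in> ?I" for t
    by (rule has_vector_derivative_transform[OF that _ P[of ?y t]]) (use yP that in auto)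
  ultimately show ?thesis by blast
qed

section \<open>Continuously differentiable maps and bounds on compact sets\<close>

definition C1_on :: "'a::real_normed_vector set \<Rightarrow> ('a \<Rightarrow> 'b::real_normed_vector) \<Rightarrow> ('a \<Rightarrow> 'a \<Rightarrow> 'b) \<Rightarrow> bool" where
  "C1_on S f f' \<longleftrightarrow> open S \<and> (\<forall>x\<in>S. (f has_derivative f' x) (at x)) \<and>
     (\<forall>u. continuous_on S (\<lambda>x. f' x u))"

lemma C1_onD:
  assumes "C1_on S f f'"
  shows "open S" "x \<in> S \<Longrightarrow> (f has_derivative f' x) (at x)" "continuous_on S (\<lambda>x. f' x u)"
    "x \<in> S \<Longrightarrow> bounded_linear (f' x)" "continuous_on S f"
  using assms unfolding C1_on_def
  by (auto intro!: has_derivative_bounded_linear has_derivative_continuous continuous_at_imp_continuous_on)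

text \<open>\<open>C1_on\<close> asks for continuity in one direction at a time; the operator norm
  is at most the sum of norms over the basis, which turns this into uniform continuity in operator
  norm. The modulus comes from comparing \<open>(x, y)\<close> with the diagonal point
  \<open>(y, y)\<close>, where the sum vanishes.\<close>

lemma C1_on_uniform:
  fixes f :: "'a::euclidean_space \<Rightarrow> 'b::euclidean_space"
  assumes "C1_on S f f'" "K \<subseteq> S" "compact K" "0 < \<epsilon>"
  shows "\<exists>\<eta>>0. \<forall>x\<in>K. \<forall>y\<in>K. dist x y < \<eta> \<longrightarrow> onorm (f' x - f' y) \<le> \<epsilon>"
proof -
  note C = C1_onD[OF assms(1)]
  define G where "G = (\<lambda>(x, y). \<Sum>i\<in>Basis. norm (f' x i - f' y i))"
  have "continuous_on (K \<times> K) G"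
    unfolding G_def case_prod_unfold
    by (intro continuous_intros continuous_on_compose2[OF C(3)]) (use assms in auto)
  then have "uniformly_continuous_on (K \<times> K) G"
    using assms by (intro compact_uniformly_continuous compact_Times)
  then obtain \<eta> where \<eta>: "\<eta> > 0"
    "\<And>p q. \<lbrakk>p \<in> K \<times> K; q \<in> K \<times> K; dist q p < \<eta>\<rbrakk> \<Longrightarrow> dist (G q) (G p) < \<epsilon>"
    unfolding uniformly_continuous_on_def using \<open>0 < \<epsilon>\<close> by metis
  have "onorm (f' x - f' y) \<le> \<epsilon>" if "x \<in> K" "y \<in> K" "dist x y < \<eta>" for x y
  proof -
    have "dist (G (x, y)) (G (y, y)) < \<epsilon>"
      by (rule \<eta>) (use that in \<open>auto simp: dist_Pair_Pair\<close>)
    then have "G (x, y) < \<epsilon>" by (simp add: G_def dist_real_def)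
    moreover have "bounded_linear (f' x - f' y)"
      unfolding fun_diff_def using C(4) assms that by (intro bounded_linear_sub) auto
    then have "onorm (f' x - f' y) \<le> G (x, y)"
      using onorm_componentwise[of "f' x - f' y"] by (simp add: G_def)
    ultimately show ?thesis by linarith
  qed
  with \<eta>(1) show ?thesis by blast
qed

lemma C1_on_bounded:
  fixes f :: "'a::euclidean_space \<Rightarrow> 'b::euclidean_space"
  assumes "C1_on S f f'" "K \<subseteq> S" "compact K"
  shows "\<exists>L>0. \<forall>x\<in>K. onorm (f' x) \<le> L"
proof -
  note C = C1_onD[OF assms(1)]
  have "compact ((\<lambda>x. \<Sum>i\<in>Basis. norm (f' x i)) ` K)"
    by (intro compact_continuous_image continuous_intros continuous_on_subset[OF C(3)] assms)
  then obtain B where B: "\<And>x. x \<in> K \<Longrightarrow> norm (\<Sum>i\<in>Basis. norm (f' x i)) \<le> B"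
    by (meson bounded_iff compact_imp_bounded imageI)
  have "onorm (f' x) \<le> \<bar>B\<bar> + 1" if "x \<in> K" for x
  proof -
    have "onorm (f' x) \<le> (\<Sum>i\<in>Basis. norm (f' x i))"
      by (intro onorm_componentwise C(4)) (use that assms in auto)
    also have "\<dots> \<le> norm (\<Sum>i\<in>Basis. norm (f' x i))" by (metis abs_ge_self real_norm_def)
    finally show ?thesis using B[OF that] by linarith
  qed
  then show ?thesis by (intro exI[of _ "\<bar>B\<bar> + 1"]) auto
qed

lemma C1_on_lipschitz_cball:
  fixes f :: "'a::euclidean_space \<Rightarrow> 'b::euclidean_space"
  assumes "C1_on S f f'" "cball x0 b \<subseteq> S"
  obtains L where "L > 0" "\<And>x. x \<in> cball x0 b \<Longrightarrow> onorm (f' x) \<le> L"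
    "\<And>x y. x \<in> cball x0 b \<Longrightarrow> y \<in> cball x0 b \<Longrightarrow> norm (f x - f y) \<le> L * norm (x - y)"
proof -
  obtain L where L: "L > 0" "\<And>x. x \<in> cball x0 b \<Longrightarrow> onorm (f' x) \<le> L"
    using C1_on_bounded[OF assms(1,2) compact_cball] by auto
  moreover have "norm (f x - f y) \<le> L * norm (x - y)" if "x \<in> cball x0 b" "y \<in> cball x0 b" for x y
  proof (rule differentiable_bound[OF convex_cball _ L(2)])
    show "(f has_derivative f' p) (at p within cball x0 b)" if "p \<in> cball x0 b" for p
      by (rule has_derivative_at_withinI, rule C1_onD(2)[OF assms(1)]) (use assms(2) that in auto)
  qed (use that in auto)
  ultimately show ?thesis using that by blast
qed

lemma ode_local_unique:
  fixes F :: "'a::euclidean_space \<Rightarrow> 'a"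
  assumes F: "C1_on U F F'" and d: "0 < d"
    and y: "\<And>t. \<bar>t - a\<bar> < d \<Longrightarrow> y t \<in> U \<and> (y has_vector_derivative F (y t)) (at t)"
    and z: "\<And>t. \<bar>t - a\<bar> < d \<Longrightarrow> z t \<in> U \<and> (z has_vector_derivative F (z t)) (at t)"
    and eq: "y a = z a"
  shows "\<exists>e>0. \<forall>t. \<bar>t - a\<bar> < e \<longrightarrow> y t = z t"
proof -
  have ya: "y a \<in> U" using y[of a] d by simp
  then obtain b where b: "b > 0" "cball (y a) b \<subseteq> U"
    using C1_onD(1)[OF F] open_contains_cball by blast
  obtain L where L: "L > 0"
    "\<And>p q. p \<in> cball (y a) b \<Longrightarrow> q \<in> cball (y a) b \<Longrightarrow> norm (F p - F q) \<le> L * norm (p - q)"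
    using C1_on_lipschitz_cball[OF F b(2)] by metis
  have "isCont y a" "isCont z a"
    using y[of a] z[of a] d by (auto intro: has_vector_derivative_continuous)
  then obtain d1 d2 where d12: "d1 > 0" "d2 > 0"
    "\<And>t. dist t a < d1 \<Longrightarrow> dist (y t) (y a) < b" "\<And>t. dist t a < d2 \<Longrightarrow> dist (z t) (z a) < b"
    unfolding continuous_at_eps_delta using b(1) by metis
  \<comment> \<open>The first bound makes \<open>e * L <= 1/2\<close>; halving the other keeps the
    closed interval strictly inside the open ones on which both curves stay in the ball.\<close>
  define e where "e = min (1 / (2 * L)) (min d (min d1 d2) / 2)"
  have e: "e > 0" "e < d" "e < d1" "e < d2" using d d12 L by (auto simp: e_def)
  have eL: "e * L \<le> 1/2"
  proof -
    have "e * L \<le> 1 / (2 * L) * L" using L by (intro mult_right_mono) (auto simp: e_def)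
    then show ?thesis using L by simp
  qed
  have "y t = z t" if "\<bar>t - a\<bar> < e" for t
  proof -
    have "norm (y t - z t) \<le> 2 * (norm (y a - z a) + e * 0)"
    proof (rule small_gronwall[where z = "\<lambda>t. y t - z t" and L = L and z' = "\<lambda>t. F (y t) - F (z t)"])
      fix s assume s: "s \<in> {a-e..a+e}"
      then show "((\<lambda>t. y t - z t) has_vector_derivative F (y s) - F (z s)) (at s within {a-e..a+e})"
        using has_vector_derivative_diff[of y "F (y s)" "at s" z "F (z s)"] y[of s] z[of s] e
        by (auto intro: has_vector_derivative_at_within)
      have "y s \<in> cball (y a) b" "z s \<in> cball (y a) b"
        using d12(3)[of s] d12(4)[of s] s e eq by (auto simp: dist_real_def dist_commute less_imp_le)
      then show "norm (F (y s) - F (z s)) \<le> L * norm (y s - z s) + 0"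
        using L(2) by simp
    qed (use e L eL that in auto)
    then show ?thesis using eq by simp
  qed
  with e(1) show ?thesis by blast
qed

section \<open>Local flows and their derivative in the initial value\<close>

lemma bounded_linear_onorm_le:
  assumes "bounded_linear f" "onorm f \<le> L"
  shows "norm (f u) \<le> L * norm u"
  using onorm[OF assms(1), of u] mult_right_mono[OF assms(2), of "norm u"] by simp

lemma bounded_linear_Basis_sum:
  fixes f :: "'a::euclidean_space \<Rightarrow> 'b::real_normed_vector"
  assumes "bounded_linear f"
  shows "f u = (\<Sum>i\<in>Basis. (u \<bullet> i) *\<^sub>R f i)"
proof -
  interpret bounded_linear f by fact
  have "f u = f (\<Sum>i\<in>Basis. (u \<bullet> i) *\<^sub>R i)" by (simp add: euclidean_representation)
  then show ?thesis by (simp add: sum scaleR)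
qed

text \<open>\<Psi> is constructed first, from the linearised equation, and only then shown to be the
  derivative: the remainder of the first order expansion satisfies a Gronwall inequality with a
  small inhomogeneity.\<close>

lemma local_flow:
  fixes F :: "'a::euclidean_space \<Rightarrow> 'a"
  assumes F: "C1_on U F F'" and x0: "x0 \<in> U"
  obtains \<delta> r \<Phi> \<Psi> where "0 < \<delta>" "0 < r" "ball x0 r \<subseteq> U"
    "\<And>x. x \<in> ball x0 r \<Longrightarrow> \<Phi> 0 x = x"
    "\<And>x t. x \<in> ball x0 r \<Longrightarrow> \<bar>t\<bar> < \<delta> \<Longrightarrow> \<Phi> t x \<in> U"
    "\<And>x t. x \<in> ball x0 r \<Longrightarrow> \<bar>t\<bar> < \<delta> \<Longrightarrow> ((\<lambda>s. \<Phi> s x) has_vector_derivative F (\<Phi> t x)) (at t)"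
    "\<And>x t. x \<in> ball x0 r \<Longrightarrow> \<bar>t\<bar> < \<delta> \<Longrightarrow> (\<Phi> t has_derivative \<Psi> t x) (at x)"
    "\<And>x u. x \<in> ball x0 r \<Longrightarrow> \<Psi> 0 x u = u"
    "\<And>x t u. x \<in> ball x0 r \<Longrightarrow> \<bar>t\<bar> < \<delta> \<Longrightarrow>
       ((\<lambda>s. \<Psi> s x u) has_vector_derivative F' (\<Phi> t x) (\<Psi> t x u)) (at t)"
proof -
  note C = C1_onD[OF F]
  obtain b where b: "b > 0" "cball x0 b \<subseteq> U"
    using x0 C(1) open_contains_cball by blast
  let ?K = "cball x0 b"
  obtain L where L: "L > 0" "\<And>x. x \<in> ?K \<Longrightarrow> onorm (F' x) \<le> L"
    "\<And>p q. p \<in> ?K \<Longrightarrow> q \<in> ?K \<Longrightarrow> norm (F p - F q) \<le> L * norm (p - q)"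
    using C1_on_lipschitz_cball[OF F b(2)] by metis
  have F'bl: "bounded_linear (F' x)" if "x \<in> ?K" for x using C(4) b that by auto
  have F'L: "norm (F' x u) \<le> L * norm u" if "x \<in> ?K" for x u
    by (rule bounded_linear_onorm_le[OF F'bl L(2)]) (use that in auto)
  have Kcont: "continuous_on ?K F" using continuous_on_subset[OF C(5) b(2)] .
  obtain M where M: "M > 0" "\<And>x. x \<in> ?K \<Longrightarrow> norm (F x) \<le> M"
    using compact_imp_bounded[OF compact_continuous_image[OF Kcont compact_cball]]
    unfolding bounded_pos by auto
  \<comment> \<open>The nearest-point retraction onto the ball is 1-Lipschitz, so
    \<open>F (P y)\<close> is Lipschitz on the whole space and Picard's theorem applies from any
    starting point.\<close>
  define P where "P = closest_point ?K"
  have P: "P x \<in> ?K" for x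
    unfolding P_def using b by (intro closest_point_in_set) auto
  have Pid: "P x = x" if "x \<in> ?K" for x
    unfolding P_def using that by (rule closest_point_self)
  have Plip: "dist (P x) (P y) \<le> dist x y" for x y
    unfolding P_def using b by (intro closest_point_lipschitz) auto
  have Pcont: "continuous_on S P" for S
    unfolding P_def using b by (intro continuous_on_closest_point) auto
  \<comment> \<open>The first bound serves Picard and Gronwall. By the second, a curve of speed at
    most \<open>M\<close> moves at most \<open>b / 3\<close>; starting within
    \<open>r = b / 3\<close> of \<open>x0\<close> it stays in the ball, where \<open>P\<close> is
    the identity.\<close>
  define \<delta> where "\<delta> = min (1 / (2 * L)) (b / (3 * M))"
  have \<delta>: "\<delta> > 0" "\<delta> * M \<le> b / 3" "\<delta> * L \<le> 1/2"
  proof -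
    show "\<delta> > 0" using L M b by (auto simp: \<delta>_def)
    have "\<delta> * M \<le> b / (3 * M) * M" using M by (intro mult_right_mono) (auto simp: \<delta>_def)
    then show "\<delta> * M \<le> b / 3" using M by simp
    have "\<delta> * L \<le> 1 / (2 * L) * L" using L by (intro mult_right_mono) (auto simp: \<delta>_def)
    then show "\<delta> * L \<le> 1/2" using L by simp
  qed
  let ?I = "{-\<delta>..\<delta>}"
  have "\<forall>x. \<exists>y. y 0 = x \<and> (\<forall>t\<in>?I. (y has_vector_derivative F (P (y t))) (at t within ?I))"
  proof
    fix x
    show "\<exists>y. y 0 = x \<and> (\<forall>t\<in>?I. (y has_vector_derivative F (P (y t))) (at t within ?I))"
    proof (rule picard[where F = "\<lambda>t y. F (P y)" and L = L])
      show "continuous_on ?I (\<lambda>t. F (P (f t)))" if "continuous_on ?I f" for f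
        by (rule continuous_on_compose2[OF Kcont continuous_on_compose2[OF Pcont that]]) (use P in auto)
      show "norm (F (P y) - F (P z)) \<le> L * norm (y - z)" for y z
        by (rule order_trans[OF L(3)[OF P P]]) (use Plip[of y z] L(1) in \<open>simp add: dist_norm\<close>)
    qed (use \<delta> L in auto)
  qed
  then obtain Y where Y: "\<And>x. Y x 0 = x"
    "\<And>x t. t \<in> ?I \<Longrightarrow> (Y x has_vector_derivative F (P (Y x t))) (at t within ?I)" by metis
  define r where "r = b / 3"
  have near: "norm (Y x t - x) \<le> b / 3" if "t \<in> ?I" for x t
  proof -
    have "norm (Y x t - Y x 0) \<le> M * \<bar>t - 0\<bar>"
      by (rule has_vector_derivative_bound[OF _ Y(2)]) (use that \<delta> M P in auto)
    also have "\<dots> \<le> M * \<delta>" using that M by (intro mult_left_mono) auto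
    also have "\<dots> \<le> b / 3" using \<delta> by (simp add: mult.commute)
    finally show ?thesis using Y(1) by simp
  qed
  have YK: "Y x t \<in> ?K" if "x \<in> ball x0 r" "t \<in> ?I" for x t
  proof -
    have "dist x0 (Y x t) \<le> dist x0 x + norm (Y x t - x)"
      by (metis dist_norm dist_triangle dist_commute)
    then show ?thesis using near[OF that(2), of x] that(1) b by (auto simp: r_def)
  qed
  have Y': "(Y x has_vector_derivative F (Y x t)) (at t within ?I)"
    if "x \<in> ball x0 r" "t \<in> ?I" for x t
    using Y(2)[OF that(2), of x] Pid[OF YK[OF that]] by simp
  have Yc: "continuous_on ?I (Y x)" for x
    using Y(2) by (meson continuous_on_eq_continuous_within has_vector_derivative_continuous)
  have Yin: "at t within ?I = at t" if "\<bar>t\<bar> < \<delta>" for t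
    using that by (intro at_within_interior) auto
  \<comment> \<open>Each initial vector \<open>u\<close> gets its own solution of the linearised
    equation; linearity in \<open>u\<close> is recovered afterwards.\<close>
  have "\<forall>x\<in>ball x0 r. \<forall>u. \<exists>w. w 0 = u \<and>
    (\<forall>t\<in>?I. (w has_vector_derivative F' (Y x t) (w t)) (at t within ?I))"
  proof (intro ballI allI)
    fix x u assume x: "x \<in> ball x0 r"
    show "\<exists>w. w 0 = u \<and> (\<forall>t\<in>?I. (w has_vector_derivative F' (Y x t) (w t)) (at t within ?I))"
    proof (rule picard[where F = "\<lambda>t. F' (Y x t)" and L = L])
      show "continuous_on ?I (\<lambda>t. F' (Y x t) (f t))" if f: "continuous_on ?I f" for f
      proof -
        have "continuous_on ?I (\<lambda>t. \<Sum>i\<in>Basis. (f t \<bullet> i) *\<^sub>R F' (Y x t) i)"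
          by (intro continuous_intros f continuous_on_compose2[OF C(3) Yc]) (use YK[OF x] b in auto)
        then show ?thesis
          by (rule continuous_on_eq) (use bounded_linear_Basis_sum[OF F'bl[OF YK[OF x]]] in simp)
      qed
      show "norm (F' (Y x t) y - F' (Y x t) z) \<le> L * norm (y - z)" if "t \<in> ?I" for t y z
        using F'L[OF YK[OF x that], of "y - z"]
          linear_diff[OF bounded_linear.linear[OF F'bl[OF YK[OF x that]]], of y z] by simp
    qed (use \<delta> L in auto)
  qed
  then obtain V where V: "\<And>x u. x \<in> ball x0 r \<Longrightarrow> V x u 0 = u"
    "\<And>x u t. x \<in> ball x0 r \<Longrightarrow> t \<in> ?I \<Longrightarrow>
      (V x u has_vector_derivative F' (Y x t) (V x u t)) (at t within ?I)" by metis
  have gronwall: "norm (z t) \<le> 2 * (norm (z 0) + \<delta> * \<epsilon>)"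
    if "\<And>t. t \<in> ?I \<Longrightarrow> (z has_vector_derivative z' t) (at t within ?I)"
      "\<And>t. t \<in> ?I \<Longrightarrow> norm (z' t) \<le> L * norm (z t) + \<epsilon>" "0 \<le> \<epsilon>" "t \<in> ?I" for z z' :: "real \<Rightarrow> 'a" and \<epsilon> t
    using small_gronwall[of 0 \<delta> z z' L \<epsilon> t] that \<delta> L by simp
  have Vlin: "linear (\<lambda>u. V x u t)" if x: "x \<in> ball x0 r" and t: "t \<in> ?I" for x t
  proof -
    note bl = F'bl[OF YK[OF x]]
    show ?thesis
    proof (rule linearI)
      fix u w
      \<comment> \<open>The defect of additivity solves the linearised equation with initial value
        0, hence vanishes by Gronwall; the defect of homogeneity is treated likewise.\<close>
      let ?z = "\<lambda>t. V x (u + w) t - (V x u t + V x w t)"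
      have "norm (?z t) \<le> 2 * (norm (?z 0) + \<delta> * 0)"
      proof (rule gronwall[where z = ?z and z' = "\<lambda>t. F' (Y x t) (?z t)"])
        fix s assume s': "s \<in> ?I"
        show "(?z has_vector_derivative F' (Y x s) (?z s)) (at s within ?I)"
          using has_vector_derivative_diff[OF V(2)[OF x s'] has_vector_derivative_add[OF V(2)[OF x s'] V(2)[OF x s']]]
          by (simp add: linear_diff[OF bounded_linear.linear[OF bl[OF s']]] linear_add[OF bounded_linear.linear[OF bl[OF s']]])
        show "norm (F' (Y x s) (?z s)) \<le> L * norm (?z s) + 0"
          using F'L[OF YK[OF x s']] by simp
      qed (use \<delta> L t in auto)
      then show "V x (u + w) t = V x u t + V x w t" by (simp add: V(1)[OF x])
    next
      fix k :: real and u
      let ?z = "\<lambda>t. V x (k *\<^sub>R u) t - k *\<^sub>R V x u t"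
      have "norm (?z t) \<le> 2 * (norm (?z 0) + \<delta> * 0)"
      proof (rule gronwall[where z = ?z and z' = "\<lambda>t. F' (Y x t) (?z t)"])
        fix s assume s': "s \<in> ?I"
        have "((\<lambda>t. k *\<^sub>R V x u t) has_vector_derivative k *\<^sub>R F' (Y x s) (V x u s)) (at s within ?I)"
          using V(2)[OF x s', of u] by (rule bounded_linear.has_vector_derivative[OF bounded_linear_scaleR_right])
        then show "(?z has_vector_derivative F' (Y x s) (?z s)) (at s within ?I)"
          using has_vector_derivative_diff[OF V(2)[OF x s', of "k *\<^sub>R u"]]
          by (simp add: linear_diff[OF bounded_linear.linear[OF bl[OF s']]] linear_scale[OF bounded_linear.linear[OF bl[OF s']]])
        show "norm (F' (Y x s) (?z s)) \<le> L * norm (?z s) + 0"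
          using F'L[OF YK[OF x s']] by simp
      qed (use \<delta> L t in auto)
      then show "V x (k *\<^sub>R u) t = k *\<^sub>R V x u t" by (simp add: V(1)[OF x])
    qed
  qed
  have Ydist: "norm (Y x' t - Y x t) \<le> 2 * norm (x' - x)"
    if x: "x \<in> ball x0 r" "x' \<in> ball x0 r" and t: "t \<in> ?I" for x x' t
  proof -
    have "norm (Y x' t - Y x t) \<le> 2 * (norm (Y x' 0 - Y x 0) + \<delta> * 0)"
    proof (rule gronwall[where z = "\<lambda>t. Y x' t - Y x t" and z' = "\<lambda>t. F (Y x' t) - F (Y x t)"])
      fix s assume s': "s \<in> ?I"
      show "((\<lambda>t. Y x' t - Y x t) has_vector_derivative F (Y x' s) - F (Y x s)) (at s within ?I)"
        by (intro has_vector_derivative_diff Y' x s')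
      show "norm (F (Y x' s) - F (Y x s)) \<le> L * norm (Y x' s - Y x s) + 0"
        using L(3)[OF YK[OF x(2) s'] YK[OF x(1) s']] by simp
    qed (use \<delta> L t in auto)
    then show ?thesis by (simp add: Y(1))
  qed
  have deriv: "((\<lambda>x. Y x t) has_derivative (\<lambda>u. V x u t)) (at x)"
    if x: "x \<in> ball x0 r" and t: "t \<in> ?I" for x t
    unfolding has_derivative_at_alt
  proof (intro conjI allI impI)
    show "bounded_linear (\<lambda>u. V x u t)"
      using Vlin[OF x t] by (simp add: linear_conv_bounded_linear)
    fix \<epsilon> :: real assume "0 < \<epsilon>"
    \<comment> \<open>Gronwall contributes the factor \<open>2 * \<delta>\<close> and
      \<open>Ydist\<close> a factor 2, which together turn \<epsilon>' into \<epsilon>.\<close>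
    define \<epsilon>' where "\<epsilon>' = \<epsilon> / (4 * \<delta>)"
    have \<epsilon>': "\<epsilon>' > 0" using \<open>0 < \<epsilon>\<close> \<delta> by (simp add: \<epsilon>'_def)
    obtain \<eta> where \<eta>: "\<eta> > 0"
      "\<And>p q. p \<in> ?K \<Longrightarrow> q \<in> ?K \<Longrightarrow> dist p q < \<eta> \<Longrightarrow> onorm (F' p - F' q) \<le> \<epsilon>'"
      using C1_on_uniform[OF F b(2) compact_cball \<epsilon>'] by blast
    obtain \<rho> where \<rho>: "\<rho> > 0" "ball x \<rho> \<subseteq> ball x0 r"
      using x open_contains_ball open_ball by blast
    \<comment> \<open>Solutions that start within \<open>\<eta> / 2\<close> of each other stay
      within \<eta>, because \<open>Ydist\<close> at most doubles distances.\<close>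
    define d where "d = min \<rho> (\<eta> / 2)"
    have d: "d > 0" using \<rho> \<eta> by (simp add: d_def)
    have "norm (Y x' t - Y x t - V x (x' - x) t) \<le> \<epsilon> * norm (x' - x)" if "norm (x' - x) < d" for x'
    proof -
      have x': "x' \<in> ball x0 r"
        using \<rho> that by (auto simp: d_def dist_norm norm_minus_commute subset_iff)
      let ?z = "\<lambda>t. Y x' t - Y x t - V x (x' - x) t"
      have "norm (?z t) \<le> 2 * (norm (?z 0) + \<delta> * (\<epsilon>' * (2 * norm (x' - x))))"
      proof (rule gronwall[where z = ?z and z' = "\<lambda>t. F (Y x' t) - F (Y x t) - F' (Y x t) (V x (x' - x) t)"])
        fix s assume s': "s \<in> ?I"
        show "(?z has_vector_derivative F (Y x' s) - F (Y x s) - F' (Y x s) (V x (x' - x) s)) (at s within ?I)"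
          by (intro has_vector_derivative_diff Y' x x' s' V(2))
        \<comment> \<open>A convex set containing the segment from \<open>Y x s\<close> to
          \<open>Y x' s\<close>, on which \<open>F'\<close> differs from \<open>F' (Y x s)\<close>
          by at most \<epsilon>'; this bounds the linearisation error of \<open>F\<close>.\<close>
        let ?S = "?K \<inter> ball (Y x s) \<eta>"
        have dY: "norm (Y x' s - Y x s) \<le> 2 * norm (x' - x)" by (rule Ydist[OF x x' s'])
        then have close: "dist (Y x s) (Y x' s) < \<eta>"
          using that by (auto simp: dist_norm norm_minus_commute d_def)
        have inS: "Y x s \<in> ?S" "Y x' s \<in> ?S"
          using YK[OF x s'] YK[OF x' s'] close \<eta>(1) by auto
        have "norm (F (Y x' s) - F (Y x s) - F' (Y x s) (Y x' s - Y x s)) \<le> norm (Y x' s - Y x s) * \<epsilon>'"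
        proof (rule differentiable_bound_linearization[where S = ?S and f' = F' and ?x0.0 = "Y x s"])
          show "Y x s + a *\<^sub>R (Y x' s - Y x s) \<in> ?S" if "a \<in> {0..1}" for a
            using convexD_alt[of ?S "Y x s" "Y x' s" a] inS that
            by (simp add: convex_Int algebra_simps)
          show "(F has_derivative F' p) (at p within ?S)" if "p \<in> ?S" for p
            by (rule has_derivative_at_withinI, rule C(2)) (use that b in auto)
          show "onorm (F' p - F' (Y x s)) \<le> \<epsilon>'" if "p \<in> ?S" for p
            using \<eta>(2)[of p "Y x s"] that inS by (auto simp: dist_commute)
        qed (use inS in auto)
        also have "\<dots> \<le> \<epsilon>' * (2 * norm (x' - x))"
          using mult_left_mono[OF dY, of \<epsilon>'] \<epsilon>' by (simp add: mult.commute)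
        finally have 1: "norm (F (Y x' s) - F (Y x s) - F' (Y x s) (Y x' s - Y x s)) \<le> \<epsilon>' * (2 * norm (x' - x))" .
        have 2: "norm (F' (Y x s) (?z s)) \<le> L * norm (?z s)"
          by (rule F'L[OF YK[OF x s']])
        have eq: "F (Y x' s) - F (Y x s) - F' (Y x s) (V x (x' - x) s)
            = (F (Y x' s) - F (Y x s) - F' (Y x s) (Y x' s - Y x s)) + F' (Y x s) (?z s)"
          by (simp add: linear_diff[OF bounded_linear.linear[OF F'bl[OF YK[OF x s']]]])
        show "norm (F (Y x' s) - F (Y x s) - F' (Y x s) (V x (x' - x) s))
            \<le> L * norm (?z s) + \<epsilon>' * (2 * norm (x' - x))"
          unfolding eq using norm_triangle_mono[OF 1 2] by linarith
      qed (use \<delta> L t \<epsilon>' in auto)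
      also have "\<dots> = \<epsilon> * norm (x' - x)"
        using \<delta> by (simp add: Y(1) V(1)[OF x] \<epsilon>'_def)
      finally show ?thesis .
    qed
    with d show "\<exists>d>0. \<forall>y. norm (y - x) < d \<longrightarrow>
      norm (Y y t - Y x t - V x (y - x) t) \<le> \<epsilon> * norm (y - x)" by blast
  qed
  show ?thesis
  proof (rule that[of \<delta> r "\<lambda>t x. Y x t" "\<lambda>t x u. V x u t"])
    show "0 < \<delta>" "0 < r" using \<delta> b by (auto simp: r_def)
    show "ball x0 r \<subseteq> U" using b by (auto simp: r_def subset_iff)
    fix x assume x: "x \<in> ball x0 r"
    show "Y x 0 = x" "\<And>u. V x u 0 = u" by (rule Y(1) V(1)[OF x])+
    fix t assume t: "\<bar>t\<bar> < \<delta>"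
    then have t': "t \<in> ?I" by auto
    show "Y x t \<in> U" using YK[OF x t'] b by auto
    show "(Y x has_vector_derivative F (Y x t)) (at t)" using Y'[OF x t'] Yin[OF t] by simp
    show "((\<lambda>x. Y x t) has_derivative (\<lambda>u. V x u t)) (at x)" by (rule deriv[OF x t'])
    show "(V x u has_vector_derivative F' (Y x t) (V x u t)) (at t)" for u
      using V(2)[OF x t', of u] Yin[OF t] by simp
  qed
qed

text \<open>The left-hand side of the equation is symmetric in \<open>u\<close> and \<open>w\<close>; this is where the symmetry of
  the second derivative comes from.\<close>

lemma second_difference:
  fixes f :: "'a::real_normed_vector \<Rightarrow> real"
  assumes f: "\<And>x. x \<in> S \<Longrightarrow> (f has_derivative f' x) (at x)"
    and f': "\<And>x. x \<in> S \<Longrightarrow> ((\<lambda>x. f' x u) has_derivative f'' x) (at x)"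
    and s: "0 < s" and S: "\<And>a b. \<lbrakk>0 \<le> a; a \<le> s; 0 \<le> b; b \<le> s\<rbrakk> \<Longrightarrow> x + a *\<^sub>R u + b *\<^sub>R w \<in> S"
  shows "\<exists>a b. 0 \<le> a \<and> a \<le> s \<and> 0 \<le> b \<and> b \<le> s \<and>
    f (x + s *\<^sub>R u + s *\<^sub>R w) - f (x + s *\<^sub>R u) - f (x + s *\<^sub>R w) + f x = s * s * f'' (x + a *\<^sub>R u + b *\<^sub>R w) w"
proof -
  \<comment> \<open>Freezing the step in direction \<open>w\<close> leaves one real variable; the
    mean value theorem in direction \<open>u\<close>, then in direction \<open>w\<close>, produces
    the two intermediate parameters.\<close>
  let ?g = "\<lambda>a. f (x + a *\<^sub>R u + s *\<^sub>R w) - f (x + a *\<^sub>R u)"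
  have lin: "linear (f' p)" "linear (f'' p)" if "p \<in> S" for p
    using f[OF that] f'[OF that] has_derivative_linear by blast+
  have g: "(?g has_derivative (\<lambda>h. h * (f' (x + a *\<^sub>R u + s *\<^sub>R w) u - f' (x + a *\<^sub>R u) u))) (at a)"
    if "0 \<le> a" "a \<le> s" for a
  proof -
    have p: "x + a *\<^sub>R u + s *\<^sub>R w \<in> S" "x + a *\<^sub>R u \<in> S" using S[of a s] S[of a 0] that s by auto
    have "((\<lambda>a. f (x + a *\<^sub>R u + s *\<^sub>R w)) has_derivative (\<lambda>h. f' (x + a *\<^sub>R u + s *\<^sub>R w) (h *\<^sub>R u))) (at a)"
      "((\<lambda>a. f (x + a *\<^sub>R u)) has_derivative (\<lambda>h. f' (x + a *\<^sub>R u) (h *\<^sub>R u))) (at a)"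
      by (rule has_derivative_compose[where f' = "\<lambda>h. h *\<^sub>R u" and g = f]; auto intro!: derivative_eq_intros f p)+
    from has_derivative_diff[OF this] show ?thesis
      by (simp add: lin p linear_scale right_diff_distrib)
  qed
  have "\<exists>a\<in>{0<..<s}. ?g s - ?g 0 = (s - 0) * (f' (x + a *\<^sub>R u + s *\<^sub>R w) u - f' (x + a *\<^sub>R u) u)"
    by (rule mvt_simple[OF s]) (rule has_derivative_at_withinI, rule g)
  then obtain a where a: "0 < a" "a < s" "?g s - ?g 0 = s * (f' (x + a *\<^sub>R u + s *\<^sub>R w) u - f' (x + a *\<^sub>R u) u)"
    by auto
  have h: "((\<lambda>b. f' (x + a *\<^sub>R u + b *\<^sub>R w) u) has_derivative (\<lambda>h. h * f'' (x + a *\<^sub>R u + b *\<^sub>R w) w)) (at b)"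
    if "0 \<le> b" "b \<le> s" for b
  proof -
    have p: "x + a *\<^sub>R u + b *\<^sub>R w \<in> S" using S[of a b] that a by auto
    have "((\<lambda>b. f' (x + a *\<^sub>R u + b *\<^sub>R w) u) has_derivative (\<lambda>h. f'' (x + a *\<^sub>R u + b *\<^sub>R w) (h *\<^sub>R w))) (at b)"
      by (rule has_derivative_compose[where f' = "\<lambda>h. h *\<^sub>R w" and g = "\<lambda>x. f' x u"]; auto intro!: derivative_eq_intros f' p)
    then show ?thesis by (simp add: lin p linear_scale)
  qed
  have "\<exists>b\<in>{0<..<s}. f' (x + a *\<^sub>R u + s *\<^sub>R w) u - f' (x + a *\<^sub>R u + 0 *\<^sub>R w) u
      = (s - 0) * f'' (x + a *\<^sub>R u + b *\<^sub>R w) w"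
    by (rule mvt_simple[OF s]) (rule has_derivative_at_withinI, rule h)
  then obtain b where b: "0 < b" "b < s"
    "f' (x + a *\<^sub>R u + s *\<^sub>R w) u - f' (x + a *\<^sub>R u + 0 *\<^sub>R w) u = s * f'' (x + a *\<^sub>R u + b *\<^sub>R w) w"
    by auto
  show ?thesis using a b
    by (intro exI[of _ a] exI[of _ b]) (simp add: algebra_simps)
qed

text \<open>Dividing the second difference by \<open>s * s\<close> gives a value of
  \<open>f'' u\<close> and a value of \<open>f'' w\<close> at two points near \<open>x\<close>. By
  continuity each is closer to its value at \<open>x\<close> than half of the supposed gap.\<close>

lemma second_derivative_symmetric:
  fixes f :: "'a::real_normed_vector \<Rightarrow> real"
  assumes f: "\<And>x. x \<in> S \<Longrightarrow> (f has_derivative f' x) (at x)"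
    and C: "\<And>u. C1_on S (\<lambda>x. f' x u) (f'' u)" and x: "x \<in> S"
  shows "f'' u x w = f'' w x u"
proof (rule ccontr)
  assume ne: "f'' u x w \<noteq> f'' w x u"
  have S: "open S" using C1_onD(1)[OF C] .
  have "isCont (\<lambda>x. f'' u x w) x" "isCont (\<lambda>x. f'' w x u) x"
    using C1_onD(3)[OF C] S x continuous_on_eq_continuous_at by blast+
  define \<epsilon> where "\<epsilon> = \<bar>f'' u x w - f'' w x u\<bar> / 2"
  have \<epsilon>: "\<epsilon> > 0" using ne by (simp add: \<epsilon>_def)
  obtain d1 where d1: "d1 > 0" "\<And>y. dist y x < d1 \<Longrightarrow> \<bar>f'' u y w - f'' u x w\<bar> < \<epsilon>"
    using \<open>isCont (\<lambda>x. f'' u x w) x\<close> \<epsilon> unfolding continuous_at_eps_delta dist_real_def by metis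
  obtain d2 where d2: "d2 > 0" "\<And>y. dist y x < d2 \<Longrightarrow> \<bar>f'' w y u - f'' w x u\<bar> < \<epsilon>"
    using \<open>isCont (\<lambda>x. f'' w x u) x\<close> \<epsilon> unfolding continuous_at_eps_delta dist_real_def by metis
  obtain d3 where d3: "d3 > 0" "ball x d3 \<subseteq> S" using S x open_contains_ball by blast
  define d where "d = min d1 (min d2 d3)"
  \<comment> \<open>Chosen so that the parallelogram of the steps in directions \<open>u\<close> and
    \<open>w\<close> lies within \<open>d / 2\<close> of \<open>x\<close>; the summand 1 covers the
    case of two zero vectors.\<close>
  define s where "s = d / (2 * (norm u + norm w + 1))"
  have d: "d > 0" using d1 d2 d3 by (simp add: d_def)
  have n: "norm u + norm w + 1 > 0" by (smt (verit) norm_ge_zero)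
  have s: "s > 0" unfolding s_def using d n by simp
  have near: "dist (x + a *\<^sub>R u + b *\<^sub>R w) x < d" if "0 \<le> a" "a \<le> s" "0 \<le> b" "b \<le> s" for a b
  proof -
    have "dist (x + a *\<^sub>R u + b *\<^sub>R w) x = norm (a *\<^sub>R u + b *\<^sub>R w)" by (simp add: dist_norm)
    also have "\<dots> \<le> a * norm u + b * norm w" using norm_triangle_ineq[of "a *\<^sub>R u" "b *\<^sub>R w"] that by simp
    also have "\<dots> \<le> s * norm u + s * norm w" using that by (intro add_mono mult_right_mono) auto
    also have "\<dots> \<le> s * (norm u + norm w + 1)" using s by (simp add: algebra_simps)
    also have "\<dots> = d / 2" using n by (simp add: s_def field_simps)
    also have "\<dots> < d" using d by simp
    finally show ?thesis .
  qed
  have inS: "x + a *\<^sub>R u + b *\<^sub>R w \<in> S" "x + a *\<^sub>R w + b *\<^sub>R u \<in> S"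
    if "0 \<le> a" "a \<le> s" "0 \<le> b" "b \<le> s" for a b
  proof -
    have eq: "x + a *\<^sub>R w + b *\<^sub>R u = x + b *\<^sub>R u + a *\<^sub>R w" by (simp add: algebra_simps)
    have S': "p \<in> S" if "dist p x < d" for p
      using that d3(2) by (auto simp: d_def dist_commute subset_iff)
    show "x + a *\<^sub>R u + b *\<^sub>R w \<in> S" by (rule S'[OF near]) (use that in auto)
    show "x + a *\<^sub>R w + b *\<^sub>R u \<in> S" unfolding eq by (rule S'[OF near]) (use that in auto)
  qed
  obtain a b where ab: "0 \<le> a" "a \<le> s" "0 \<le> b" "b \<le> s"
    "f (x + s *\<^sub>R u + s *\<^sub>R w) - f (x + s *\<^sub>R u) - f (x + s *\<^sub>R w) + f x = s * s * f'' u (x + a *\<^sub>R u + b *\<^sub>R w) w"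
    using second_difference[of S f f' u "f'' u" s x w] f C1_onD(2)[OF C] s inS(1) by blast
  obtain a' b' where ab': "0 \<le> a'" "a' \<le> s" "0 \<le> b'" "b' \<le> s"
    "f (x + s *\<^sub>R w + s *\<^sub>R u) - f (x + s *\<^sub>R w) - f (x + s *\<^sub>R u) + f x = s * s * f'' w (x + a' *\<^sub>R w + b' *\<^sub>R u) u"
    using second_difference[of S f f' w "f'' w" s x u] f C1_onD(2)[OF C] s inS(2) by blast
  have e: "x + s *\<^sub>R w + s *\<^sub>R u = x + s *\<^sub>R u + s *\<^sub>R w" "x + a' *\<^sub>R w + b' *\<^sub>R u = x + b' *\<^sub>R u + a' *\<^sub>R w"
    by (simp_all add: algebra_simps)
  then have "s * s * f'' u (x + a *\<^sub>R u + b *\<^sub>R w) w = s * s * f'' w (x + b' *\<^sub>R u + a' *\<^sub>R w) u"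
    using ab(5) ab'(5)[unfolded e] by linarith
  then have "f'' u (x + a *\<^sub>R u + b *\<^sub>R w) w = f'' w (x + b' *\<^sub>R u + a' *\<^sub>R w) u" using s by simp
  moreover have "\<bar>f'' u (x + a *\<^sub>R u + b *\<^sub>R w) w - f'' u x w\<bar> < \<epsilon>"
    by (rule d1(2)) (use near[OF ab(1-4)] in \<open>simp add: d_def\<close>)
  moreover have "\<bar>f'' w (x + b' *\<^sub>R u + a' *\<^sub>R w) u - f'' w x u\<bar> < \<epsilon>"
    by (rule d2(2)) (use near[OF ab'(3,4,1,2)] in \<open>simp add: d_def\<close>)
  ultimately show False unfolding \<epsilon>_def by (simp add: abs_if split: if_splits)
qed

section \<open>Continuously differentiable functions and Hamiltonian vector fields in coordinates\<close>

lemma C1_on_const: "open S \<Longrightarrow> C1_on S (\<lambda>_. c) (\<lambda>_ _. 0)"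
  by (simp add: C1_on_def)

lemma C1_on_transform:
  assumes "C1_on S f f'" "\<And>x. x \<in> S \<Longrightarrow> g x = f x"
  shows "C1_on S g f'"
proof -
  have "(g has_derivative f' x) (at x)" if "x \<in> S" for x
    by (rule has_derivative_transform_within_open[OF C1_onD(2)[OF assms(1) that] C1_onD(1)[OF assms(1)] that])
      (use assms(2) in simp)
  then show ?thesis using assms(1) by (simp add: C1_on_def)
qed

lemma C1_on_add:
  assumes "C1_on S f f'" "C1_on S g g'"
  shows "C1_on S (\<lambda>x. f x + g x) (\<lambda>x h. f' x h + g' x h)"
  using assms unfolding C1_on_def by (auto intro: has_derivative_add continuous_on_add)

lemma C1_on_mult:
  fixes f g :: "'a::real_normed_vector \<Rightarrow> real"
  assumes "C1_on S f f'" "C1_on S g g'"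
  shows "C1_on S (\<lambda>x. f x * g x) (\<lambda>x h. f x * g' x h + f' x h * g x)"
  using C1_onD[OF assms(1)] C1_onD[OF assms(2)]
  by (auto simp: C1_on_def intro!: has_derivative_mult continuous_intros)

lemma C1_on_divide:
  fixes f g :: "'a::real_normed_vector \<Rightarrow> real"
  assumes "C1_on S f f'" "C1_on S g g'" "\<And>x. x \<in> S \<Longrightarrow> g x \<noteq> 0"
  shows "C1_on S (\<lambda>x. f x / g x)
    (\<lambda>x h. - f x * (inverse (g x) * g' x h * inverse (g x)) + f' x h / g x)"
  unfolding C1_on_def
proof (intro conjI ballI allI)
  note C = C1_onD[OF assms(1)] and D = C1_onD[OF assms(2)]
  show "open S" by (rule C(1))
  show "((\<lambda>x. f x / g x) has_derivative
      (\<lambda>h. - f x * (inverse (g x) * g' x h * inverse (g x)) + f' x h / g x)) (at x)" if "x \<in> S" for x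
    by (rule has_derivative_divide[OF C(2)[OF that] D(2)[OF that] assms(3)[OF that]])
  show "continuous_on S (\<lambda>x. - f x * (inverse (g x) * g' x u * inverse (g x)) + f' x u / g x)" for u
    by (intro continuous_intros C(3,5) D(3,5)) (use assms(3) in auto)
qed

lemma C1_on_sum:
  assumes "open S" "\<And>i. i \<in> I \<Longrightarrow> \<exists>f'. C1_on S (f i) f'"
  shows "\<exists>f'. C1_on S (\<lambda>x. \<Sum>i\<in>I. f i x) f'"
  using assms(2)
proof (induction I rule: infinite_finite_induct)
  case (insert i I)
  then obtain f' g' where "C1_on S (f i) f'" "C1_on S (\<lambda>x. \<Sum>i\<in>I. f i x) g'" by blast
  from C1_on_add[OF this] show ?case using insert by auto
qed (use C1_on_const[OF assms(1)] in auto)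

lemma C1_on_prod:
  fixes f :: "'i \<Rightarrow> 'a::real_normed_vector \<Rightarrow> real"
  assumes "open S" "\<And>i. i \<in> I \<Longrightarrow> \<exists>f'. C1_on S (f i) f'"
  shows "\<exists>f'. C1_on S (\<lambda>x. \<Prod>i\<in>I. f i x) f'"
  using assms(2)
proof (induction I rule: infinite_finite_induct)
  case (insert i I)
  then obtain f' g' where "C1_on S (f i) f'" "C1_on S (\<lambda>x. \<Prod>i\<in>I. f i x) g'" by blast
  from C1_on_mult[OF this] show ?case using insert by auto
qed (use C1_on_const[OF assms(1)] in auto)

lemma C1_on_det:
  fixes M :: "'a::real_normed_vector \<Rightarrow> real^'n^'n"
  assumes "open S" "\<And>i j. \<exists>f'. C1_on S (\<lambda>x. M x $ i $ j) f'"
  shows "\<exists>f'. C1_on S (\<lambda>x. det (M x)) f'"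
  unfolding det_def
proof (rule C1_on_sum[OF assms(1)])
  fix p :: "'n \<Rightarrow> 'n"
  obtain g' where "C1_on S (\<lambda>x. \<Prod>i\<in>UNIV. M x $ i $ p i) g'"
    using C1_on_prod[OF assms(1), of UNIV "\<lambda>i x. M x $ i $ p i"] assms(2) by blast
  from C1_on_mult[OF C1_on_const[OF assms(1)] this]
  show "\<exists>f'. C1_on S (\<lambda>x. of_int (sign p) * (\<Prod>i\<in>UNIV. M x $ i $ p i)) f'" by blast
qed

lemma C1_on_vec:
  fixes f :: "'a::real_normed_vector \<Rightarrow> real^'n"
  assumes "open S" "\<And>i. \<exists>f'. C1_on S (\<lambda>x. f x $ i) f'"
  shows "\<exists>f'. C1_on S f f'"
proof -
  obtain g where g: "\<And>i. C1_on S (\<lambda>x. f x $ i) (g i)" using assms(2) by metis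
  have "C1_on S f (\<lambda>x h. \<chi> i. g i x h)"
    unfolding C1_on_def
  proof (intro conjI ballI allI)
    show "(f has_derivative (\<lambda>h. \<chi> i. g i x h)) (at x)" if "x \<in> S" for x
      using C1_onD(2)[OF g that]
      by (subst has_derivative_componentwise_within) (auto simp: Basis_vec_def inner_axis)
    show "continuous_on S (\<lambda>x. \<chi> i. g i x u)" for u
      by (intro continuous_on_vec_lambda C1_onD(3)[OF g])
  qed (rule assms(1))
  then show ?thesis by blast
qed

lemma Ck_on_imp_C1_on:
  assumes "open S" "Ck_on (Suc 0) S f"
  shows "C1_on S f (\<lambda>x. frechet_derivative f (at x))"
  using assms by (auto simp: C1_on_def frechet_derivative_works)

lemma smooth_on_imp_C1_on:
  "open S \<Longrightarrow> smooth_on S f \<Longrightarrow> C1_on S f (\<lambda>x. frechet_derivative f (at x))"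
  unfolding smooth_on_def by (blast intro: Ck_on_imp_C1_on)

lemma smooth_on_derivative: "smooth_on S f \<Longrightarrow> smooth_on S (\<lambda>x. frechet_derivative f (at x) u)"
  unfolding smooth_on_def by (metis Ck_on.simps(2))

lemma smooth_on_differentiable: "smooth_on S f \<Longrightarrow> x \<in> S \<Longrightarrow> f differentiable (at x)"
  unfolding smooth_on_def by (metis Ck_on.simps(2))

section \<open>Bilinear forms with continuously differentiable coefficients\<close>

lemma bilinear_Basis_sum:
  fixes W :: "'a::euclidean_space \<Rightarrow> 'a \<Rightarrow> real"
  assumes "bilinear W"
  shows "W u w = (\<Sum>i\<in>Basis. \<Sum>j\<in>Basis. (u \<bullet> i) * (w \<bullet> j) * W i j)"
proof -
  have "W u w = (\<Sum>(i, j)\<in>Basis \<times> Basis. W ((u \<bullet> i) *\<^sub>R i) ((w \<bullet> j) *\<^sub>R j))"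
    using bilinear_sum[OF assms, of "\<lambda>i. (u \<bullet> i) *\<^sub>R i" Basis "\<lambda>j. (w \<bullet> j) *\<^sub>R j" Basis]
    by (simp add: euclidean_representation)
  also have "\<dots> = (\<Sum>i\<in>Basis. \<Sum>j\<in>Basis. (u \<bullet> i) * (w \<bullet> j) * W i j)"
    by (simp add: sum.cartesian_product[symmetric] bilinear_lmul[OF assms] bilinear_rmul[OF assms] mult_ac)
  finally show ?thesis .
qed

lemma alternating_antisym:
  fixes W :: "'a::real_vector \<Rightarrow> 'a \<Rightarrow> real"
  assumes "bilinear W" "\<And>u. W u u = 0"
  shows "W u w = - W w u"
  using assms(2)[of "u + w"] assms(2)[of u] assms(2)[of w]
  by (simp add: bilinear_ladd[OF assms(1)] bilinear_radd[OF assms(1)])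

text \<open>\<open>W' u w x h\<close> is the derivative of \<open>W x u w\<close> with respect to \<open>x\<close> in the direction \<open>h\<close>.\<close>

locale C1_form =
  fixes S :: "'a::euclidean_space set" and W :: "'a \<Rightarrow> 'a \<Rightarrow> 'a \<Rightarrow> real"
    and W' :: "'a \<Rightarrow> 'a \<Rightarrow> 'a \<Rightarrow> 'a \<Rightarrow> real"
  assumes open_S: "open S" and bil: "x \<in> S \<Longrightarrow> bilinear (W x)" and alt: "x \<in> S \<Longrightarrow> W x u u = 0"
    and W': "C1_on S (\<lambda>x. W x u w) (W' u w)"
begin

lemma W_antisym: "x \<in> S \<Longrightarrow> W x u w = - W x w u"
  using alternating_antisym[OF bil alt] .

lemma W'_unique:
  assumes "x \<in> S" "(g has_derivative g') (at x)" "\<And>y. y \<in> S \<Longrightarrow> g y = W y u w"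
  shows "W' u w x h = g' h"
proof -
  have "((\<lambda>y. W y u w) has_derivative g') (at x)"
    by (rule has_derivative_transform_within_open[OF assms(2) open_S assms(1)]) (use assms(3) in simp)
  from has_derivative_unique[OF C1_onD(2)[OF W' assms(1)] this] show ?thesis by (rule fun_cong)
qed

lemma W'_antisym:
  assumes "x \<in> S"
  shows "W' u w x h = - W' w u x h"
  by (rule W'_unique[OF assms has_derivative_minus[OF C1_onD(2)[OF W' assms]]])
    (rule W_antisym[symmetric])

lemma W'_Basis_sum:
  assumes "x \<in> S"
  shows "W' u w x h = (\<Sum>i\<in>Basis. \<Sum>j\<in>Basis. (u \<bullet> i) * (w \<bullet> j) * W' i j x h)"
proof (rule W'_unique[OF assms])
  show "((\<lambda>y. \<Sum>i\<in>Basis. \<Sum>j\<in>Basis. (u \<bullet> i) * (w \<bullet> j) * W y i j) has_derivative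
      (\<lambda>h. \<Sum>i\<in>Basis. \<Sum>j\<in>Basis. (u \<bullet> i) * (w \<bullet> j) * W' i j x h)) (at x)"
    by (intro has_derivative_sum has_derivative_mult_right C1_onD(2)[OF W' assms])
qed (rule bilinear_Basis_sum[OF bil, symmetric])

text \<open>Differentiability is given only for constant arguments, so the form is expanded in basis
  coefficients and the ordinary product rule applied. The parameter space \<open>'b\<close> is
  general because the rule serves both along curves and, with \<open>y\<close> the identity, on the
  chart itself.\<close>

lemma has_derivative_W:
  fixes y U V :: "'b::real_normed_vector \<Rightarrow> 'a"
  assumes y: "(y has_derivative y') (at t)" and U: "(U has_derivative U') (at t)"
    and V: "(V has_derivative V') (at t)" and yS: "y t \<in> S"
  shows "((\<lambda>t. W (y t) (U t) (V t)) has_derivative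
    (\<lambda>h. W' (U t) (V t) (y t) (y' h) + W (y t) (U' h) (V t) + W (y t) (U t) (V' h))) (at t)"
proof -
  let ?g = "\<lambda>t. \<Sum>i\<in>Basis. \<Sum>j\<in>Basis. (U t \<bullet> i) * (V t \<bullet> j) * W (y t) i j"
  have W'c: "((\<lambda>t. W (y t) i j) has_derivative (\<lambda>h. W' i j (y t) (y' h))) (at t)" for i j
    by (rule has_derivative_compose[OF y C1_onD(2)[OF W' yS]])
  have "(?g has_derivative (\<lambda>h. \<Sum>i\<in>Basis. \<Sum>j\<in>Basis. (U t \<bullet> i) * (V t \<bullet> j) * W' i j (y t) (y' h) +
      ((U t \<bullet> i) * (V' h \<bullet> j) + (U' h \<bullet> i) * (V t \<bullet> j)) * W (y t) i j)) (at t)"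
    by (intro has_derivative_sum has_derivative_mult W'c has_derivative_inner_left U V)
  moreover have "(\<lambda>h. \<Sum>i\<in>Basis. \<Sum>j\<in>Basis. (U t \<bullet> i) * (V t \<bullet> j) * W' i j (y t) (y' h) +
      ((U t \<bullet> i) * (V' h \<bullet> j) + (U' h \<bullet> i) * (V t \<bullet> j)) * W (y t) i j)
      = (\<lambda>h. W' (U t) (V t) (y t) (y' h) + W (y t) (U' h) (V t) + W (y t) (U t) (V' h))"
    unfolding W'_Basis_sum[OF yS, of "U t" "V t"] bilinear_Basis_sum[OF bil[OF yS], of "U t"]
      bilinear_Basis_sum[OF bil[OF yS], of "U' _" "V t"]
    by (simp add: sum.distrib[symmetric] algebra_simps)
  ultimately have g: "(?g has_derivative
      (\<lambda>h. W' (U t) (V t) (y t) (y' h) + W (y t) (U' h) (V t) + W (y t) (U t) (V' h))) (at t)" by simp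
  \<comment> \<open>The expansion of \<open>W\<close> is valid only inside the open set
    \<open>S\<close>, which \<open>y\<close> does not leave near \<open>t\<close>.\<close>
  have "eventually (\<lambda>s. y s \<in> S) (at t)"
    using has_derivative_continuous[OF y] open_S yS unfolding isCont_def
    by (rule topological_tendstoD)
  then have "eventually (\<lambda>s. ?g s = W (y s) (U s) (V s)) (at t)"
    by eventually_elim (simp add: bilinear_Basis_sum[OF bil, symmetric])
  with g show ?thesis
    by (rule has_derivative_transform_eventually) (simp_all add: bilinear_Basis_sum[OF bil[OF yS], symmetric])
qed

end

text \<open>A Hamiltonian system in coordinates, with Hamiltonian \<open>f\<close>;
  \<open>closed\<close> is the vanishing exterior derivative evaluated on constant fields. The space
  is \<open>real^'n\<close> so that determinants are available.\<close>

locale hamiltonian_chart = C1_form S W W'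
  for S :: "(real^'n) set" and W :: "real^'n \<Rightarrow> real^'n \<Rightarrow> real^'n \<Rightarrow> real" and W' +
  fixes f :: "real^'n \<Rightarrow> real" and f' :: "real^'n \<Rightarrow> real^'n \<Rightarrow> real"
    and f'' :: "real^'n \<Rightarrow> real^'n \<Rightarrow> real^'n \<Rightarrow> real" and X :: "real^'n \<Rightarrow> real^'n"
  assumes nondeg: "x \<in> S \<Longrightarrow> u \<noteq> 0 \<Longrightarrow> \<exists>w. W x u w \<noteq> 0"
    and closed: "x \<in> S \<Longrightarrow> W' u2 u3 x u1 + W' u3 u1 x u2 + W' u1 u2 x u3 = 0"
    and f': "x \<in> S \<Longrightarrow> (f has_derivative f' x) (at x)"
    and f'': "C1_on S (\<lambda>x. f' x u) (f'' u)"
    and ham: "x \<in> S \<Longrightarrow> W x u (X x) = f' x u"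
begin

text \<open>\<open>X\<close> is given only implicitly, by a linear system. Cramer's rule exhibits
  its components as quotients of determinants in the coefficients of the form and the first
  derivatives of \<open>f\<close>, all of which are continuously differentiable.\<close>

lemma X_C1: "\<exists>X'. C1_on S X X'"
proof -
  define M where "M x = (\<chi> i j. W x (axis i 1) (axis j 1))" for x
  have WM: "(M x *v w) $ i = W x (axis i 1) w" if "x \<in> S" for x w i
  proof -
    have "linear (W x (axis i 1))" using bil[OF that] by (simp add: bilinear_def)
    then have "W x (axis i 1) (\<Sum>j\<in>UNIV. (w $ j) *s axis j 1) = (\<Sum>j\<in>UNIV. (w $ j) * W x (axis i 1) (axis j 1))"
      by (simp add: linear_sum linear_scale scalar_mult_eq_scaleR)
    then show ?thesis by (simp add: basis_expansion M_def matrix_vector_mult_def mult.commute)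
  qed
  have det: "det (M x) \<noteq> 0" if x: "x \<in> S" for x
  proof -
    have "w = 0" if "M x *v w = 0" for w
    proof (rule ccontr)
      assume "w \<noteq> 0"
      then obtain u where u: "W x w u \<noteq> 0" using nondeg[OF x] by blast
      have "W x (axis i 1) w = 0" for i using WM[OF x, of w i] that by simp
      moreover have "linear (\<lambda>u. W x u w)" using bil[OF x] by (simp add: bilinear_def)
      then have "W x (\<Sum>i\<in>UNIV. (u $ i) *s axis i 1) w = (\<Sum>i\<in>UNIV. (u $ i) * W x (axis i 1) w)"
        by (simp add: linear_sum[of "\<lambda>u. W x u w"] linear_scale[of "\<lambda>u. W x u w"] scalar_mult_eq_scaleR)
      ultimately have "W x u w = 0" by (simp add: basis_expansion)
      then show False using u W_antisym[OF x, of w u] by simp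
    qed
    then show ?thesis
      by (metis invertible_det_nz invertible_left_inverse matrix_left_invertible_ker)
  qed
  have MC1: "\<exists>g'. C1_on S (\<lambda>x. M x $ i $ j) g'" for i j
    using W'[of "axis i 1" "axis j 1"] by (auto simp: M_def)
  have "\<exists>g'. C1_on S (\<lambda>x. X x $ k) g'" for k
  proof -
    \<comment> \<open>The Gram matrix with its column \<open>k\<close> replaced by the right-hand
      side, as in Cramer's rule.\<close>
    define N where "N x = (\<chi> i j. if j = k then f' x (axis i 1) else M x $ i $ j)" for x
    have Xk: "X x $ k = det (N x) / det (M x)" if "x \<in> S" for x
    proof -
      have "M x *v X x = (\<chi> i. f' x (axis i 1))"
        by (simp add: vec_eq_iff WM[OF that] ham[OF that])
      then show ?thesis using cramer[OF det[OF that], of "X x" "\<chi> i. f' x (axis i 1)"]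
        by (simp add: N_def cong: if_cong)
    qed
    obtain g' where g': "C1_on S (\<lambda>x. det (M x)) g'" using C1_on_det[OF open_S MC1] by blast
    have "\<exists>h'. C1_on S (\<lambda>x. N x $ i $ j) h'" for i j
      using f''[of "axis i 1"] MC1[of i j] by (cases "j = k") (auto simp: N_def)
    then obtain h' where h': "C1_on S (\<lambda>x. det (N x)) h'" using C1_on_det[OF open_S] by blast
    show ?thesis using C1_on_transform[OF C1_on_divide[OF h' g' det] Xk] by blast
  qed
  then show ?thesis by (rule C1_on_vec[OF open_S])
qed

text \<open>The Lie derivative of the form along a Hamiltonian field vanishes: the derivative of the
  pairing is the exterior derivative evaluated on \<open>U\<close>, \<open>V\<close> and
  \<open>X\<close>, plus a difference of second derivatives of \<open>f\<close> that is zero by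
  symmetry.\<close>

lemma form_preserved:
  assumes X': "C1_on S X X'" and a: "0 < a"
    and y: "\<And>t. \<bar>t\<bar> < a \<Longrightarrow> y t \<in> S \<and> (y has_vector_derivative X (y t)) (at t)"
    and U: "\<And>t. \<bar>t\<bar> < a \<Longrightarrow> (U has_vector_derivative X' (y t) (U t)) (at t)"
    and V: "\<And>t. \<bar>t\<bar> < a \<Longrightarrow> (V has_vector_derivative X' (y t) (V t)) (at t)"
    and t: "\<bar>t\<bar> < a"
  shows "W (y t) (U t) (V t) = W (y 0) (U 0) (V 0)"
proof -
  \<comment> \<open>Obtained by differentiating both sides of \<open>ham\<close> in the direction
    \<open>h\<close>; it expresses the derivative of \<open>X\<close> through the form.\<close>
  have ham': "W x u (X' x h) = f'' u x h - W' u (X x) x h" if x: "x \<in> S" for x u h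
  proof -
    have 1: "((\<lambda>x. W x u (X x)) has_derivative
        (\<lambda>h. W' u (X x) x h + W x 0 (X x) + W x u (X' x h))) (at x)"
      by (rule has_derivative_W[where y = "\<lambda>x. x" and U = "\<lambda>_. u" and V = X])
        (use x C1_onD(2)[OF X' x] in simp_all)
    have 2: "((\<lambda>x. W x u (X x)) has_derivative f'' u x) (at x)"
      by (rule has_derivative_transform_within_open[OF C1_onD(2)[OF f'' x] open_S x]) (simp add: ham)
    show ?thesis
      using fun_cong[OF has_derivative_unique[OF 1 2], of h] bilinear_lzero[OF bil[OF x]] by simp
  qed
  have "((\<lambda>t. W (y t) (U t) (V t)) has_derivative (\<lambda>h. 0)) (at s)" if s: "\<bar>s\<bar> < a" for s
  proof -
    let ?x = "y s" let ?u = "U s" let ?v = "V s"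
    have x: "?x \<in> S" using y[OF s] by simp
    have lin: "linear (W' ?u ?v ?x)" "linear (\<lambda>u. W ?x u ?v)" "linear (W ?x ?u)"
      using C1_onD(4)[OF W' x] bil[OF x] by (auto simp: bilinear_def bounded_linear.linear)
    have "((\<lambda>t. W (y t) (U t) (V t)) has_derivative
      (\<lambda>h. W' ?u ?v ?x (h *\<^sub>R X ?x) + W ?x (h *\<^sub>R X' ?x ?u) ?v + W ?x ?u (h *\<^sub>R X' ?x ?v))) (at s)"
      by (rule has_derivative_W)
        (use y[OF s] U[OF s] V[OF s] in \<open>auto simp: has_vector_derivative_def\<close>)
    \<comment> \<open>Both terms with \<open>X'\<close> are rewritten by \<open>ham'\<close>; the
      second derivatives cancel and the rest is \<open>closed\<close> for \<open>?u\<close>,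
      \<open>?v\<close>, \<open>X ?x\<close>.\<close>
    moreover have "W' ?u ?v ?x (X ?x) + W ?x (X' ?x ?u) ?v + W ?x ?u (X' ?x ?v) = 0"
    proof -
      have "W ?x (X' ?x ?u) ?v = - f'' ?v ?x ?u + W' ?v (X ?x) ?x ?u"
        using W_antisym[OF x, of "X' ?x ?u" ?v] ham'[OF x, of ?v ?u] by simp
      moreover have "W ?x ?u (X' ?x ?v) = f'' ?u ?x ?v - W' ?u (X ?x) ?x ?v" by (rule ham'[OF x])
      moreover have "f'' ?u ?x ?v = f'' ?v ?x ?u" by (rule second_derivative_symmetric[OF f' f'' x])
      ultimately show ?thesis
        using closed[OF x, of ?u ?v "X ?x"] W'_antisym[OF x, of "X ?x" ?u ?v] by simp
    qed
    then have "h * (W' ?u ?v ?x (X ?x) + W ?x (X' ?x ?u) ?v + W ?x ?u (X' ?x ?v)) = 0" for h by simp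
    ultimately show ?thesis
      by (simp add: linear_scale[OF lin(1)] linear_scale[OF lin(2)] linear_scale[OF lin(3)] distrib_left)
  qed
  note has_derivative_at_withinI[OF this]
  then have "\<exists>c. \<forall>s\<in>{-a<..<a}. W (y s) (U s) (V s) = c"
    by (intro has_derivative_zero_constant) auto
  then show ?thesis using a t by (auto simp: abs_less_iff)
qed

end

section \<open>Derivatives in charts\<close>

lemma is_chartD:
  fixes c :: "('m::t2_space, 'e::euclidean_space) chart"
  assumes "is_chart c"
  shows "open (cdom c)" "open (cimage c)"
    "p \<in> cdom c \<Longrightarrow> cinv c (coord c p) = p" "p \<in> cdom c \<Longrightarrow> coord c p \<in> cimage c"
    "x \<in> cimage c \<Longrightarrow> coord c (cinv c x) = x" "x \<in> cimage c \<Longrightarrow> cinv c x \<in> cdom c"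
    "p \<in> cdom c \<Longrightarrow> isCont (coord c) p" "x \<in> cimage c \<Longrightarrow> isCont (cinv c) x"
proof -
  show o: "open (cdom c)" "open (cimage c)" using assms by (auto simp: is_chart_def)
  have h: "homeomorphism (cdom c) (cimage c) (coord c) (cinv c)" using assms by (auto simp: is_chart_def)
  show "p \<in> cdom c \<Longrightarrow> cinv c (coord c p) = p" by (rule homeomorphism_apply1[OF h])
  show "p \<in> cdom c \<Longrightarrow> coord c p \<in> cimage c" by simp
  show "x \<in> cimage c \<Longrightarrow> coord c (cinv c x) = x" by (rule homeomorphism_apply2[OF h])
  show "x \<in> cimage c \<Longrightarrow> cinv c x \<in> cdom c" by (rule inv_into_into)
  show "p \<in> cdom c \<Longrightarrow> isCont (coord c) p" "x \<in> cimage c \<Longrightarrow> isCont (cinv c) x"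
    using homeomorphism_cont1[OF h] homeomorphism_cont2[OF h] o continuous_on_eq_continuous_at by blast+
qed

text \<open>Curves and real functions are covered by taking \<open>real_chart\<close> on one side.\<close>

definition mderiv :: "('m::t2_space, 'e::euclidean_space) chart \<Rightarrow>
    ('n::topological_space, 'f::euclidean_space) chart \<Rightarrow> ('m \<Rightarrow> 'n) \<Rightarrow> 'm \<Rightarrow> ('e \<Rightarrow> 'f) \<Rightarrow> bool" where
  "mderiv c d f p D \<longleftrightarrow> is_chart c \<and> is_chart d \<and> p \<in> cdom c \<and> f p \<in> cdom d \<and> isCont f p \<and>
     ((coord d \<circ> f \<circ> cinv c) has_derivative D) (at (coord c p))"

definition real_chart :: "(real, real) chart" where
  "real_chart = (UNIV, id)"

lemma is_chart_real_chart: "is_chart real_chart"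
  unfolding is_chart_def real_chart_def by (auto simp: homeomorphism_def id_def[symmetric])

lemma mderiv_linear: "mderiv c d f p D \<Longrightarrow> linear D"
  unfolding mderiv_def by (auto dest: has_derivative_linear)

lemma mderiv_unique: "mderiv c d f p D \<Longrightarrow> mderiv c d f p D' \<Longrightarrow> D = D'"
  unfolding mderiv_def by (auto dest: has_derivative_unique)

lemma mderiv_transform:
  assumes "mderiv c d f p D" "open W" "p \<in> W" "\<And>q. q \<in> W \<Longrightarrow> g q = f q"
  shows "mderiv c d g p D"
proof -
  have c: "is_chart c" "p \<in> cdom c" using assms(1) by (auto simp: mderiv_def)
  note C = is_chartD[OF c(1)]
  have ev: "eventually (\<lambda>q. f q = g q) (nhds p)"
    using assms(2-4) by (auto simp: eventually_nhds)
  have "isCont g p"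
    using assms(1) isCont_cong[OF ev] by (simp add: mderiv_def)
  moreover have "cinv c \<midarrow>coord c p\<rightarrow> p"
    using C(8)[OF C(4)[OF c(2)]] C(3)[OF c(2)] by (simp add: isCont_def)
  then have "eventually (\<lambda>x. cinv c x \<in> W) (at (coord c p))"
    by (rule topological_tendstoD) (use assms in auto)
  then have "eventually (\<lambda>x. (coord d \<circ> f \<circ> cinv c) x = (coord d \<circ> g \<circ> cinv c) x) (at (coord c p))"
    by eventually_elim (use assms(4) in simp)
  moreover have "((coord d \<circ> f \<circ> cinv c) has_derivative D) (at (coord c p))" using assms(1) by (simp add: mderiv_def)
  ultimately have "((coord d \<circ> g \<circ> cinv c) has_derivative D) (at (coord c p))"
    using assms(3,4) C(3)[OF c(2)] by (auto intro: has_derivative_transform_eventually)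
  with \<open>isCont g p\<close> show ?thesis
    using assms(1) assms(4)[OF assms(3)] by (simp add: mderiv_def)
qed

lemma mderiv_comp:
  assumes f: "mderiv c d f p D" and g: "mderiv d e g (f p) E"
  shows "mderiv c e (g \<circ> f) p (E \<circ> D)"
proof -
  have c: "is_chart c" "is_chart d" "p \<in> cdom c" "f p \<in> cdom d" "isCont f p"
    and f': "((coord d \<circ> f \<circ> cinv c) has_derivative D) (at (coord c p))"
    using f by (auto simp: mderiv_def)
  have e: "is_chart e" "g (f p) \<in> cdom e" "isCont g (f p)"
    and g': "((coord e \<circ> g \<circ> cinv d) has_derivative E) (at (coord d (f p)))"
    using g by (auto simp: mderiv_def)
  note C = is_chartD[OF c(1)] and CD = is_chartD[OF c(2)]
  have p: "cinv c (coord c p) = p" by (rule C(3)[OF c(3)])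
  have "((coord e \<circ> g \<circ> cinv d) \<circ> (coord d \<circ> f \<circ> cinv c) has_derivative E \<circ> D) (at (coord c p))"
    by (rule diff_chain_at[OF f']) (use g' p in simp)
  moreover have "isCont (f \<circ> cinv c) (coord c p)"
    using C(8)[OF C(4)[OF c(3)]] c(5) p by (intro continuous_at_compose) auto
  then have "(f \<circ> cinv c) \<midarrow>coord c p\<rightarrow> f p" using p by (simp add: isCont_def)
  then have "eventually (\<lambda>x. (f \<circ> cinv c) x \<in> cdom d) (at (coord c p))"
    by (rule topological_tendstoD) (use CD c in auto)
  then have "eventually (\<lambda>x. ((coord e \<circ> g \<circ> cinv d) \<circ> (coord d \<circ> f \<circ> cinv c)) x
      = (coord e \<circ> (g \<circ> f) \<circ> cinv c) x) (at (coord c p))"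
    by eventually_elim (simp add: CD(3))
  ultimately have "((coord e \<circ> (g \<circ> f) \<circ> cinv c) has_derivative E \<circ> D) (at (coord c p))"
    by (rule has_derivative_transform_eventually) (use c p in \<open>simp_all add: CD(3)\<close>)
  moreover have "isCont (g \<circ> f) p" by (rule continuous_at_compose[OF c(5) e(3)])
  ultimately show ?thesis using c e by (simp add: mderiv_def)
qed

lemma mderiv_id: "is_chart c \<Longrightarrow> p \<in> cdom c \<Longrightarrow> mderiv c c id p id"
proof -
  assume c: "is_chart c" "p \<in> cdom c"
  note C = is_chartD[OF c(1)]
  have "((coord c \<circ> id \<circ> cinv c) has_derivative id) (at (coord c p))"
    by (rule has_derivative_transform_within_open[where f = id, OF has_derivative_id C(2) C(4)[OF c(2)]])
      (simp add: C(5))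
  then show ?thesis using c by (simp add: mderiv_def isCont_def)
qed

lemma mderiv_curve:
  "mderiv real_chart c \<gamma> t D \<longleftrightarrow> is_chart c \<and> \<gamma> t \<in> cdom c \<and> isCont \<gamma> t \<and>
     ((\<lambda>s. coord c (\<gamma> s)) has_derivative D) (at t)"
  by (simp add: mderiv_def is_chart_real_chart) (simp add: real_chart_def o_def)

text \<open>For real values, continuity at \<open>p\<close> follows from differentiability of the
  chart expression, since \<open>f\<close> is locally that expression after \<open>coord c\<close>.
  For a general target it is a separate condition, because \<open>coord d\<close> carries no meaning
  outside \<open>cdom d\<close>.\<close>

lemma mderiv_function:
  "mderiv c real_chart f p D \<longleftrightarrow> is_chart c \<and> p \<in> cdom c \<and>
     ((f \<circ> cinv c) has_derivative D) (at (coord c p))"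
proof -
  have "isCont f p" if c: "is_chart c" "p \<in> cdom c" and "((f \<circ> cinv c) has_derivative D) (at (coord c p))"
  proof -
    note C = is_chartD[OF c(1)]
    have "isCont ((f \<circ> cinv c) \<circ> coord c) p"
      by (rule continuous_at_compose[OF C(7)[OF c(2)] has_derivative_continuous[OF that(3)]])
    moreover have "eventually (\<lambda>q. ((f \<circ> cinv c) \<circ> coord c) q = f q) (nhds p)"
      unfolding eventually_nhds using c C(1,3) by (auto intro!: exI[of _ "cdom c"])
    ultimately show ?thesis by (simp add: isCont_cong)
  qed
  then show ?thesis
    by (auto simp: mderiv_def real_chart_def is_chart_real_chart[unfolded real_chart_def])
qed

text \<open>Converts the components of a tangent vector at \<open>p\<close> with respect to
  \<open>c\<close> into those with respect to \<open>d\<close>.\<close>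

definition transition :: "('m::t2_space, 'e::euclidean_space) chart \<Rightarrow> ('m, 'e) chart \<Rightarrow> 'm \<Rightarrow> 'e \<Rightarrow> 'e" where
  "transition c d p = frechet_derivative (coord d \<circ> cinv c) (at (coord c p))"

section \<open>Differentials and velocities in preferred charts\<close>

locale manifold =
  fixes A :: "('m::{t2_space,second_countable_topology}, 'e::euclidean_space) chart set"
  assumes atlas: "smooth_atlas A"
begin

lemma is_chart: "c \<in> A \<Longrightarrow> is_chart c"
  using atlas by (simp add: smooth_atlas_def)

lemma chart_at: "chart_at A p \<in> A" "p \<in> cdom (chart_at A p)"
proof -
  have "p \<in> (\<Union>c\<in>A. cdom c)" using atlas by (simp add: smooth_atlas_def)
  then have "\<exists>c. c \<in> A \<and> p \<in> cdom c" by blast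
  then have "chart_at A p \<in> A \<and> p \<in> cdom (chart_at A p)"
    unfolding chart_at_def by (rule someI_ex)
  then show "chart_at A p \<in> A" "p \<in> cdom (chart_at A p)" by auto
qed

lemmas is_chart_at = is_chart[OF chart_at(1)]

lemma transition:
  assumes "c \<in> A" "d \<in> A" "p \<in> cdom c" "p \<in> cdom d"
  shows "mderiv c d id p (transition c d p)"
proof -
  have "smooth_on (coord c ` (cdom c \<inter> cdom d)) (coord d \<circ> cinv c)"
    using atlas assms by (simp add: smooth_atlas_def)
  then have "(coord d \<circ> cinv c) differentiable (at (coord c p))"
    by (rule smooth_on_differentiable) (use assms in auto)
  then show ?thesis
    using assms is_chart by (auto simp: mderiv_def transition_def frechet_derivative_works)
qed

lemma transition_inverse:
  assumes "c \<in> A" "d \<in> A" "p \<in> cdom c" "p \<in> cdom d"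
  shows "transition d c p (transition c d p u) = u"
proof -
  have "mderiv c c (id \<circ> id) p (transition d c p \<circ> transition c d p)"
    by (rule mderiv_comp[OF transition[OF assms]]) (use transition assms in simp)
  then have "transition d c p \<circ> transition c d p = id"
    using mderiv_id[OF is_chart[OF assms(1)] assms(3)] by (simp add: mderiv_unique)
  then show ?thesis by (simp add: fun_eq_iff)
qed

lemma diff_map_eq:
  "mderiv (chart_at A p) (chart_at A (f p)) f p D \<Longrightarrow> diff_map A f p = D"
  unfolding diff_map_def mderiv_def by (auto intro: frechet_derivative_at[symmetric])

lemma diff_function_eq:
  "mderiv (chart_at A p) real_chart f p D \<Longrightarrow> diff_function A f p = D"
  unfolding diff_function_def mderiv_function by (auto intro: frechet_derivative_at[symmetric])

lemma has_velocity_iff: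
  "has_velocity A \<gamma> t u \<longleftrightarrow> mderiv real_chart (chart_at A (\<gamma> t)) \<gamma> t (\<lambda>h. h *\<^sub>R u)"
  by (simp add: has_velocity_def mderiv_curve is_chart_at chart_at has_vector_derivative_def)

text \<open>\<open>has_velocity\<close> refers to the preferred chart at the current point, which
  may jump along the curve; a differential equation has to be read in one chart.\<close>

lemma has_velocity_chart:
  assumes "c \<in> A" "\<gamma> t \<in> cdom c"
  shows "has_velocity A \<gamma> t u \<longleftrightarrow> isCont \<gamma> t \<and>
    ((\<lambda>s. coord c (\<gamma> s)) has_vector_derivative transition (chart_at A (\<gamma> t)) c (\<gamma> t) u) (at t)"
    (is "?l \<longleftrightarrow> ?r")
proof -
  let ?d = "chart_at A (\<gamma> t)"
  let ?T = "transition ?d c (\<gamma> t)" and ?T' = "transition c ?d (\<gamma> t)"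
  have T: "mderiv ?d c id (\<gamma> t) ?T" "mderiv c ?d id (\<gamma> t) ?T'"
    by (rule transition; use assms chart_at in auto)+
  have lin: "linear ?T" "linear ?T'" using T mderiv_linear by blast+
  have r: "?r \<longleftrightarrow> mderiv real_chart c \<gamma> t (\<lambda>h. h *\<^sub>R ?T u)"
    using assms is_chart by (auto simp: mderiv_curve has_vector_derivative_def)
  show ?thesis
  proof
    assume ?l
    then have "mderiv real_chart c (id \<circ> \<gamma>) t (?T \<circ> (\<lambda>h. h *\<^sub>R u))"
      unfolding has_velocity_iff by (rule mderiv_comp) (rule T)
    then show ?r unfolding r by (simp add: o_def linear_scale[OF lin(1)])
  next
    assume ?r
    then have "mderiv real_chart ?d (id \<circ> \<gamma>) t (?T' \<circ> (\<lambda>h. h *\<^sub>R ?T u))"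
      unfolding r by (rule mderiv_comp) (rule T)
    moreover have "?T' (?T u) = u" by (rule transition_inverse) (use assms chart_at in auto)
    ultimately show ?l unfolding has_velocity_iff by (simp add: o_def linear_scale[OF lin(2)])
  qed
qed

lemma has_velocity_comp:
  assumes "has_velocity A \<gamma> t u" "mderiv (chart_at A (\<gamma> t)) (chart_at A (f (\<gamma> t))) f (\<gamma> t) D"
  shows "has_velocity A (f \<circ> \<gamma>) t (D u)"
proof -
  have "mderiv real_chart (chart_at A (f (\<gamma> t))) (f \<circ> \<gamma>) t (D \<circ> (\<lambda>h. h *\<^sub>R u))"
    using assms by (auto simp: has_velocity_iff intro: mderiv_comp)
  then show ?thesis
    using linear_scale[OF mderiv_linear[OF assms(2)]] by (simp add: has_velocity_iff o_def)
qed

lemma has_velocity_unique: "has_velocity A \<gamma> t u \<Longrightarrow> has_velocity A \<gamma> t w \<Longrightarrow> u = w"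
  unfolding has_velocity_def by (blast intro: vector_derivative_unique_at)

lemma has_velocity_shift:
  "has_velocity A \<gamma> (t + s) u \<Longrightarrow> has_velocity A (\<lambda>r. \<gamma> (r + s)) t u"
proof -
  assume *: "has_velocity A \<gamma> (t + s) u"
  then have "isCont (\<lambda>r. \<gamma> (r + s)) t"
    unfolding has_velocity_def by (intro isCont_o2[where f = "\<lambda>r. r + s" and g = \<gamma>]) auto
  moreover have "((\<lambda>r. r + s) has_vector_derivative 1) (at t)"
    by (auto intro!: derivative_eq_intros)
  then have "((\<lambda>r. coord (chart_at A (\<gamma> (t + s))) (\<gamma> r)) \<circ> (\<lambda>r. r + s) has_vector_derivative 1 *\<^sub>R u) (at t)"
    using * unfolding has_velocity_def by (intro vector_diff_chain_at) auto
  ultimately show ?thesis by (simp add: has_velocity_def o_def)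
qed

lemma has_velocity_reflect:
  "has_velocity A \<gamma> (- t) u \<Longrightarrow> has_velocity A (\<lambda>r. \<gamma> (- r)) t (- u)"
proof -
  assume *: "has_velocity A \<gamma> (- t) u"
  then have "isCont (\<lambda>r. \<gamma> (- r)) t"
    unfolding has_velocity_def by (intro isCont_o2[where f = "\<lambda>r. - r" and g = \<gamma>]) auto
  moreover have "((\<lambda>r. - r) has_vector_derivative (- 1)) (at t)"
    by (auto intro!: derivative_eq_intros)
  then have "((\<lambda>r. coord (chart_at A (\<gamma> (- t))) (\<gamma> r)) \<circ> (\<lambda>r. - r) has_vector_derivative (- 1) *\<^sub>R u) (at t)"
    using * unfolding has_velocity_def by (intro vector_diff_chain_at) auto
  ultimately show ?thesis by (simp add: has_velocity_def o_def)
qed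

lemma has_velocity_transform:
  assumes "has_velocity A \<gamma> t u" "open I" "t \<in> I" "\<And>s. s \<in> I \<Longrightarrow> \<eta> s = \<gamma> s"
  shows "has_velocity A \<eta> t u"
  using mderiv_transform[of real_chart _ \<gamma> t _ I \<eta>] assms by (simp add: has_velocity_iff)

lemma has_velocity_const: "has_velocity A (\<lambda>_. p) t 0"
  by (simp add: has_velocity_def)

lemma smooth_map_mderiv:
  assumes "smooth_map A f" "c \<in> A" "d \<in> A" "p \<in> cdom c" "f p \<in> cdom d"
  shows "\<exists>D. mderiv c d f p D"
proof -
  have "smooth_on (coord c ` (cdom c \<inter> f -` cdom d)) (coord d \<circ> f \<circ> cinv c)" "isCont f p"
    using assms by (auto simp: smooth_map_def continuous_on_eq_continuous_at)
  moreover from this(1) have "(coord d \<circ> f \<circ> cinv c) differentiable (at (coord c p))"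
    by (rule smooth_on_differentiable) (use assms in auto)
  ultimately show ?thesis
    using assms is_chart by (auto simp: mderiv_def differentiable_def)
qed

lemma smooth_map_diff_map:
  assumes "smooth_map A f"
  shows "mderiv (chart_at A p) (chart_at A (f p)) f p (diff_map A f p)"
  using smooth_map_mderiv[OF assms chart_at(1) chart_at(1) chart_at(2) chart_at(2), of p] diff_map_eq
  by metis

end

section \<open>Integral curves of Hamiltonian vector fields\<close>

lemma isCont_eventually:
  "isCont f t \<Longrightarrow> open U \<Longrightarrow> f t \<in> U \<Longrightarrow> eventually (\<lambda>s. f s \<in> U) (nhds t)"
  unfolding isCont_def tendsto_at_iff_tendsto_nhds by (rule topological_tendstoD)

locale hamiltonian_system = manifold A
  for A :: "('m::{t2_space,second_countable_topology}, real^'n) chart set" +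
  fixes \<omega> :: "'m \<Rightarrow> real^'n \<Rightarrow> real^'n \<Rightarrow> real" and H :: "'m \<Rightarrow> real"
  assumes symplectic: "symplectic_manifold A \<omega>" and smooth_H: "smooth_function A H"
begin

abbreviation X :: "'m \<Rightarrow> real^'n" where "X \<equiv> hamiltonian_vf A \<omega> H"

lemma two_form: "two_form A \<omega>"
  using symplectic by (simp add: symplectic_manifold_def closed_two_form_def)

lemma \<omega>_bilinear: "bilinear (\<omega> p)" and \<omega>_alt: "\<omega> p u u = 0"
  using two_form by (auto simp: two_form_def)

lemma \<omega>_antisym: "\<omega> p u w = - \<omega> p w u"
  by (rule alternating_antisym[OF \<omega>_bilinear \<omega>_alt])

lemma \<omega>_nondegenerate: "u \<noteq> 0 \<Longrightarrow> \<exists>w. \<omega> p u w \<noteq> 0"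
  using symplectic by (simp add: symplectic_manifold_def)

lemma \<omega>_linear: "linear (\<omega> p u)" "linear (\<lambda>u. \<omega> p u w)"
  using \<omega>_bilinear by (auto simp: bilinear_def)

lemma \<omega>_eqI: "(\<And>u. \<omega> p u x = \<omega> p u y) \<Longrightarrow> x = y"
proof (rule ccontr)
  assume *: "\<And>u. \<omega> p u x = \<omega> p u y" and "x \<noteq> y"
  then obtain w where "\<omega> p (x - y) w \<noteq> 0" using \<omega>_nondegenerate[of "x - y"] by auto
  moreover have "\<omega> p (x - y) w = \<omega> p w y - \<omega> p w x"
    using linear_diff[OF \<omega>_linear(2)[of p w], of x y] \<omega>_antisym[of p x w] \<omega>_antisym[of p y w] by simp
  ultimately show False using * by simp
qed

lemma H_mderiv:
  assumes "c \<in> A" "p \<in> cdom c"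
  shows "mderiv c real_chart H p (frechet_derivative (H \<circ> cinv c) (at (coord c p)))"
proof -
  have "smooth_on (cimage c) (H \<circ> cinv c)" using smooth_H assms by (simp add: smooth_function_def)
  then have "(H \<circ> cinv c) differentiable (at (coord c p))"
    by (rule smooth_on_differentiable) (use assms in auto)
  then show ?thesis using assms is_chart by (simp add: mderiv_function frechet_derivative_works)
qed

lemma dH: "mderiv (chart_at A p) real_chart H p (diff_function A H p)"
  using H_mderiv[OF chart_at] diff_function_eq by metis

lemma X: "diff_function A H p u = \<omega> p u (X p)"
proof -
  \<comment> \<open>The form as a linear map of the model space, written in the basis. Nondegeneracy
    makes it injective, hence onto, which gives existence and uniqueness for the definite
    description in \<open>hamiltonian_vf\<close>.\<close>
  define J where "J y = (\<Sum>b\<in>Basis. \<omega> p b y *\<^sub>R b)" for y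
  have inner: "J y \<bullet> b = \<omega> p b y" if "b \<in> Basis" for y b
    using that by (simp add: J_def inner_sum_left inner_Basis if_distrib sum.delta cong: if_cong)
  have J: "linear J"
    unfolding J_def
    by (intro linear_compose_sum ballI linearI)
      (simp_all add: linear_add[OF \<omega>_linear(1)] linear_scale[OF \<omega>_linear(1)] scaleR_add_left)
  have ext: "\<omega> p u y = g u" if "linear g" "\<And>b. b \<in> Basis \<Longrightarrow> \<omega> p b y = g b" for g u y
    by (rule linear_eq_on[of "\<lambda>u. \<omega> p u y" g _ Basis]) (use that \<omega>_linear in \<open>auto simp: span_Basis\<close>)
  have "inj J"
  proof (rule injI)
    fix x y assume "J x = J y"
    then have "\<omega> p b x = \<omega> p b y" if "b \<in> Basis" for b using inner[OF that] by metis
    then show "x = y" by (rule \<omega>_eqI[OF ext[OF \<omega>_linear(2)]])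
  qed
  then have "surj J" using linear_injective_imp_surjective[OF J] by simp
  then obtain x where x: "J x = (\<Sum>b\<in>Basis. diff_function A H p b *\<^sub>R b)" by (metis surjD)
  have xb: "\<omega> p b x = diff_function A H p b" if "b \<in> Basis" for b
    unfolding inner[OF that, symmetric] x
    using that by (simp add: inner_sum_left inner_Basis if_distrib sum.delta cong: if_cong)
  have "\<forall>u. diff_function A H p u = \<omega> p u x"
    by (intro allI, rule ext[OF mderiv_linear[OF dH] xb, symmetric])
  moreover have "y = x" if "\<forall>u. diff_function A H p u = \<omega> p u y" for y
    using calculation that by (intro \<omega>_eqI[of p]) simp
  ultimately have "\<forall>u. diff_function A H p u = \<omega> p u (X p)"
    unfolding hamiltonian_vf_def by (rule theI[of "\<lambda>x. \<forall>u. diff_function A H p u = \<omega> p u x"])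
  then show ?thesis by blast
qed

text \<open>\<open>X\<close> lists its components in a preferred chart that varies with the point;
  the transition turns them into components in the single chart \<open>c\<close>.\<close>

definition X_in :: "('m, real^'n) chart \<Rightarrow> real^'n \<Rightarrow> real^'n" where
  "X_in c x = transition (chart_at A (cinv c x)) c (cinv c x) (X (cinv c x))"

lemma form_in_chart_eq:
  assumes "c \<in> A" "p \<in> cdom c"
  shows "form_in_chart A \<omega> c (coord c p) u w =
    \<omega> p (transition c (chart_at A p) p u) (transition c (chart_at A p) p w)"
  using is_chartD(3)[OF is_chart[OF assms(1)] assms(2)]
  by (simp add: form_in_chart_def transition_def Let_def)

text \<open>In a chart the form at \<open>p\<close> is the pullback of \<open>\<omega> p\<close> by
  an invertible transition map, so its algebraic properties carry over.\<close>

lemma hamiltonian_chart: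
  assumes c: "c \<in> A"
  shows "hamiltonian_chart (cimage c) (form_in_chart A \<omega> c)
    (\<lambda>u w x. frechet_derivative (\<lambda>x. form_in_chart A \<omega> c x u w) (at x))
    (H \<circ> cinv c) (\<lambda>x. frechet_derivative (H \<circ> cinv c) (at x))
    (\<lambda>u x. frechet_derivative (\<lambda>x. frechet_derivative (H \<circ> cinv c) (at x) u) (at x)) (X_in c)"
proof
  note C = is_chartD[OF is_chart[OF c]]
  show "open (cimage c)" by (rule C(2))
  have "smooth_on (cimage c) (\<lambda>x. form_in_chart A \<omega> c x u w)" for u w
    using two_form c by (simp add: two_form_def)
  then show "C1_on (cimage c) (\<lambda>x. form_in_chart A \<omega> c x u w)
      (\<lambda>x. frechet_derivative (\<lambda>x. form_in_chart A \<omega> c x u w) (at x))" for u w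
    by (rule smooth_on_imp_C1_on[OF C(2)])
  have H: "smooth_on (cimage c) (H \<circ> cinv c)" using smooth_H c by (simp add: smooth_function_def)
  show "C1_on (cimage c) (\<lambda>x. frechet_derivative (H \<circ> cinv c) (at x) u)
      (\<lambda>x. frechet_derivative (\<lambda>x. frechet_derivative (H \<circ> cinv c) (at x) u) (at x))" for u
    by (rule smooth_on_imp_C1_on[OF C(2) smooth_on_derivative[OF H]])
  fix x assume x: "x \<in> cimage c"
  then obtain p where p: "p \<in> cdom c" "x = coord c p" by blast
  let ?T = "transition c (chart_at A p) p" and ?T' = "transition (chart_at A p) c p"
  have W: "form_in_chart A \<omega> c x u w = \<omega> p (?T u) (?T w)" for u w
    unfolding p(2) by (rule form_in_chart_eq[OF c p(1)])
  have T: "mderiv c (chart_at A p) id p ?T"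
    by (rule transition) (use c p chart_at in auto)
  then have lin: "linear ?T" by (rule mderiv_linear)
  have TT': "?T (?T' u) = u" "?T' (?T u) = u" for u
    by (rule transition_inverse; use c p chart_at in auto)+
  have "linear (\<lambda>w. \<omega> p (?T u) (?T w))" "linear (\<lambda>u. \<omega> p (?T u) (?T w))" for u w
    using linear_compose[OF lin \<omega>_linear(1)] linear_compose[OF lin \<omega>_linear(2)] by (simp_all add: o_def)
  then show "bilinear (form_in_chart A \<omega> c x)" by (simp add: bilinear_def W)
  show "form_in_chart A \<omega> c x u u = 0" for u by (simp add: W \<omega>_alt)
  show "\<exists>w. form_in_chart A \<omega> c x u w \<noteq> 0" if "u \<noteq> 0" for u
  proof -
    have "?T u \<noteq> 0" using that TT'(2)[of u] TT'(2)[of 0] linear_0[OF lin] by metis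
    then show ?thesis using \<omega>_nondegenerate[of "?T u" p] TT'(1) W by metis
  qed
  show "frechet_derivative (\<lambda>x. form_in_chart A \<omega> c x u2 u3) (at x) u1 +
      frechet_derivative (\<lambda>x. form_in_chart A \<omega> c x u3 u1) (at x) u2 +
      frechet_derivative (\<lambda>x. form_in_chart A \<omega> c x u1 u2) (at x) u3 = 0" for u1 u2 u3
    using symplectic c x by (auto simp: symplectic_manifold_def closed_two_form_def)
  show "(H \<circ> cinv c has_derivative frechet_derivative (H \<circ> cinv c) (at x)) (at x)"
    using H_mderiv[OF c p(1)] by (simp add: mderiv_function p(2))
  show "form_in_chart A \<omega> c x u (X_in c x) = frechet_derivative (H \<circ> cinv c) (at x) u" for u
  proof -
    have "mderiv c real_chart (H \<circ> id) p (diff_function A H p \<circ> ?T)"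
      by (rule mderiv_comp[OF T]) (simp add: dH)
    then have "diff_function A H p \<circ> ?T = frechet_derivative (H \<circ> cinv c) (at x)"
      using H_mderiv[OF c p(1)] by (simp add: p(2) mderiv_unique)
    moreover have "X_in c x = ?T' (X p)" by (simp add: X_in_def p(2) C(3)[OF p(1)])
    ultimately show ?thesis by (simp add: W TT' X[symmetric] fun_eq_iff)
  qed
qed

lemma X_in_C1: "c \<in> A \<Longrightarrow> \<exists>X'. C1_on (cimage c) (X_in c) X'"
  using hamiltonian_chart.X_C1[OF hamiltonian_chart] .

lemma has_velocity_X:
  assumes "c \<in> A" "\<gamma> t \<in> cdom c"
  shows "has_velocity A \<gamma> t (X (\<gamma> t)) \<longleftrightarrow>
    isCont \<gamma> t \<and> ((\<lambda>s. coord c (\<gamma> s)) has_vector_derivative X_in c (coord c (\<gamma> t))) (at t)"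
  using has_velocity_chart[of c \<gamma> t "X (\<gamma> t)", OF assms] is_chartD(3)[OF is_chart[OF assms(1)] assms(2)]
  by (simp add: X_in_def)

section \<open>Uniqueness and concatenation of integral curves\<close>

lemma integral_curve_locally_unique:
  assumes "open J" "integral_curve A X J \<gamma>" "integral_curve A X J \<eta>" "t \<in> J" "\<gamma> t = \<eta> t"
  shows "\<exists>e>0. \<forall>s. \<bar>s - t\<bar> < e \<longrightarrow> \<gamma> s = \<eta> s"
proof -
  define c where "c = chart_at A (\<gamma> t)"
  have c: "c \<in> A" "\<gamma> t \<in> cdom c" by (auto simp: c_def chart_at)
  note C = is_chartD[OF is_chart[OF c(1)]]
  have "isCont \<gamma> t" "isCont \<eta> t"
    using assms by (auto simp: integral_curve_def has_velocity_def)
  then have "eventually (\<lambda>s. \<gamma> s \<in> cdom c) (nhds t)" "eventually (\<lambda>s. \<eta> s \<in> cdom c) (nhds t)"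
    using c(2) C(1) assms(5)
    by (auto intro: isCont_eventually)
  moreover have "eventually (\<lambda>s. s \<in> J) (nhds t)" using assms by (simp add: eventually_nhds_in_open)
  ultimately have "eventually (\<lambda>s. s \<in> J \<and> \<gamma> s \<in> cdom c \<and> \<eta> s \<in> cdom c) (nhds t)"
    by eventually_elim auto
  then obtain d where d: "d > 0" "\<And>s. \<bar>s - t\<bar> < d \<Longrightarrow> s \<in> J \<and> \<gamma> s \<in> cdom c \<and> \<eta> s \<in> cdom c"
    by (auto simp: eventually_nhds_metric dist_real_def)
  obtain X' where X': "C1_on (cimage c) (X_in c) X'" using X_in_C1[OF c(1)] by blast
  have "\<exists>e>0. \<forall>s. \<bar>s - t\<bar> < e \<longrightarrow> coord c (\<gamma> s) = coord c (\<eta> s)"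
  proof (rule ode_local_unique[OF X' d(1)])
    show "coord c (\<gamma> s) \<in> cimage c \<and>
      ((\<lambda>s. coord c (\<gamma> s)) has_vector_derivative X_in c (coord c (\<gamma> s))) (at s)" if "\<bar>s - t\<bar> < d" for s
      using d(2)[OF that] assms(2) has_velocity_X[OF c(1), of \<gamma> s] by (auto simp: integral_curve_def)
    show "coord c (\<eta> s) \<in> cimage c \<and>
      ((\<lambda>s. coord c (\<eta> s)) has_vector_derivative X_in c (coord c (\<eta> s))) (at s)" if "\<bar>s - t\<bar> < d" for s
      using d(2)[OF that] assms(3) has_velocity_X[OF c(1), of \<eta> s] by (auto simp: integral_curve_def)
  qed (use assms in simp)
  then obtain e where e: "e > 0" "\<And>s. \<bar>s - t\<bar> < e \<Longrightarrow> coord c (\<gamma> s) = coord c (\<eta> s)" by blast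
  have "\<gamma> s = \<eta> s" if "\<bar>s - t\<bar> < min d e" for s
    using e(2)[of s] d(2)[of s] that C(3) by (metis min_less_iff_conj)
  with d(1) e(1) show ?thesis by (intro exI[of _ "min d e"]) auto
qed

text \<open>Agreement is an open condition by local uniqueness, disagreement by the Hausdorff
  property and continuity; a connected \<open>J\<close> cannot meet both.\<close>

lemma integral_curve_unique:
  assumes J: "open J" "connected J" and \<gamma>: "integral_curve A X J \<gamma>" and \<eta>: "integral_curve A X J \<eta>"
    and t: "t \<in> J" "\<gamma> t = \<eta> t" and s: "s \<in> J"
  shows "\<gamma> s = \<eta> s"
proof (rule ccontr)
  assume ne: "\<gamma> s \<noteq> \<eta> s"
  let ?E = "{r \<in> J. \<gamma> r = \<eta> r}" and ?N = "{r \<in> J. \<gamma> r \<noteq> \<eta> r}"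
  have "open ?E"
    unfolding open_dist
  proof
    fix r assume r: "r \<in> ?E"
    obtain e1 where e1: "e1 > 0" "\<And>q. \<bar>q - r\<bar> < e1 \<Longrightarrow> \<gamma> q = \<eta> q"
      using integral_curve_locally_unique[OF J(1) \<gamma> \<eta>] r by blast
    obtain e2 where "e2 > 0" "\<And>q. dist q r < e2 \<Longrightarrow> q \<in> J"
      using J(1) r unfolding open_dist by blast
    with e1 show "\<exists>e>0. \<forall>q. dist q r < e \<longrightarrow> q \<in> ?E"
      by (intro exI[of _ "min e1 e2"]) (auto simp: dist_real_def)
  qed
  moreover have "open ?N"
  proof (subst open_subopen, intro ballI)
    fix r assume r: "r \<in> ?N"
    obtain U V where UV: "open U" "open V" "\<gamma> r \<in> U" "\<eta> r \<in> V" "U \<inter> V = {}"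
      using hausdorff[of "\<gamma> r" "\<eta> r"] r by blast
    have "isCont \<gamma> r" "isCont \<eta> r" using r \<gamma> \<eta> by (auto simp: integral_curve_def has_velocity_def)
    then have "eventually (\<lambda>q. \<gamma> q \<in> U) (nhds r)" "eventually (\<lambda>q. \<eta> q \<in> V) (nhds r)"
      using UV by (auto intro: isCont_eventually)
    moreover have "eventually (\<lambda>q. q \<in> J) (nhds r)" using r J by (simp add: eventually_nhds_in_open)
    ultimately have "eventually (\<lambda>q. q \<in> ?N) (nhds r)"
      by eventually_elim (use UV in auto)
    then show "\<exists>T. open T \<and> r \<in> T \<and> T \<subseteq> ?N" by (auto simp: eventually_nhds subset_iff)
  qed
  ultimately show False
    using connectedD[OF J(2), of ?E ?N] t s ne by blast
qed

text \<open>The relation inside the definite description of \<open>flow\<close>. It also records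
  that the integral curve exists, which an equation for \<open>flow\<close> cannot express.\<close>

definition flows :: "real \<Rightarrow> 'm \<Rightarrow> 'm \<Rightarrow> bool" where
  "flows t p q \<longleftrightarrow> (\<exists>\<gamma> a b. {0, t} \<subseteq> {a<..<b} \<and> integral_curve A X {a<..<b} \<gamma> \<and> \<gamma> 0 = p \<and> \<gamma> t = q)"

lemma integral_curve_subset: "integral_curve A X J \<gamma> \<Longrightarrow> I \<subseteq> J \<Longrightarrow> integral_curve A X I \<gamma>"
  by (auto simp: integral_curve_def)

lemma integral_curve_shift:
  "integral_curve A X J \<gamma> \<Longrightarrow> (\<And>t. t \<in> I \<Longrightarrow> t + s \<in> J) \<Longrightarrow> integral_curve A X I (\<lambda>t. \<gamma> (t + s))"
  unfolding integral_curve_def by (blast intro: has_velocity_shift[of \<gamma>])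

lemma flows_unique:
  assumes "flows t p q" "flows t p r"
  shows "q = r"
proof -
  obtain \<gamma> a b where 1: "{0, t} \<subseteq> {a<..<b}" "integral_curve A X {a<..<b} \<gamma>" "\<gamma> 0 = p" "\<gamma> t = q"
    using assms(1) flows_def by blast
  obtain \<eta> a' b' where 2: "{0, t} \<subseteq> {a'<..<b'}" "integral_curve A X {a'<..<b'} \<eta>" "\<eta> 0 = p" "\<eta> t = r"
    using assms(2) flows_def by blast
  have "\<gamma> t = \<eta> t"
    by (rule integral_curve_unique[where J = "{max a a'<..<min b b'}" and t = 0])
      (use 1 2 in \<open>auto intro: integral_curve_subset\<close>)
  with 1 2 show ?thesis by simp
qed

lemma flows_flow: "flows t p q \<Longrightarrow> flow A X t p = q"
  unfolding flow_def flows_def[symmetric] by (rule the_equality) (auto dest: flows_unique)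

text \<open>The first curve and the shifted second one both pass through \<open>q\<close> at time
  \<open>t\<close>, hence agree on the overlap of their intervals and can be glued. The times may
  have any signs, so the glued curve lives on the hull of both intervals.\<close>

lemma flows_add:
  assumes "flows t p q" "flows s q r"
  shows "flows (t + s) p r"
proof -
  obtain \<gamma> a b where 1: "{0, t} \<subseteq> {a<..<b}" "integral_curve A X {a<..<b} \<gamma>" "\<gamma> 0 = p" "\<gamma> t = q"
    using assms(1) flows_def by blast
  obtain \<eta> a' b' where 2: "{0, s} \<subseteq> {a'<..<b'}" "integral_curve A X {a'<..<b'} \<eta>" "\<eta> 0 = q" "\<eta> s = r"
    using assms(2) flows_def by blast
  let ?I = "{a<..<b}" and ?I' = "{a'+t<..<b'+t}"
  let ?\<eta> = "\<lambda>u. \<eta> (u - t)"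
  define \<zeta> where "\<zeta> u = (if u \<in> ?I then \<gamma> u else ?\<eta> u)" for u
  have \<eta>: "integral_curve A X ?I' ?\<eta>"
    using integral_curve_shift[OF 2(2), of ?I' "- t"] by simp
  have eq: "\<gamma> u = ?\<eta> u" if "u \<in> ?I" "u \<in> ?I'" for u
    by (rule integral_curve_unique[where J = "{max a (a'+t)<..<min b (b'+t)}" and t = t and \<eta> = ?\<eta>])
      (use 1 2 that \<eta> in \<open>auto intro: integral_curve_subset\<close>)
  have \<zeta>1: "\<zeta> u = \<gamma> u" if "u \<in> ?I" for u using that by (simp add: \<zeta>_def)
  have \<zeta>2: "\<zeta> u = ?\<eta> u" if "u \<in> ?I'" for u using that eq[of u] by (simp add: \<zeta>_def)
  have "has_velocity A \<zeta> u (X (\<zeta> u))" if "u \<in> ?I \<or> u \<in> ?I'" for u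
    using that
  proof
    assume u: "u \<in> ?I"
    show ?thesis
      by (rule has_velocity_transform[where \<gamma> = \<gamma> and I = ?I]) (use u 1 \<zeta>1 in \<open>auto simp: integral_curve_def\<close>)
  next
    assume u: "u \<in> ?I'"
    show ?thesis
      by (rule has_velocity_transform[where \<gamma> = ?\<eta> and I = ?I'])
        (use u \<eta> \<zeta>2[OF u] \<zeta>2 in \<open>auto simp: integral_curve_def\<close>)
  qed
  moreover have "u \<in> ?I \<or> u \<in> ?I'" if "u \<in> {min a (a'+t)<..<max b (b'+t)}" for u
    using that 1(1) 2(1) by (auto simp: min_def max_def split: if_splits)
  ultimately have "integral_curve A X {min a (a'+t)<..<max b (b'+t)} \<zeta>"
    by (simp add: integral_curve_def)
  moreover have "\<zeta> 0 = p" "\<zeta> (t + s) = r" using \<zeta>1[of 0] \<zeta>2[of "t + s"] 1 2 by auto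
  moreover have "{0, t + s} \<subseteq> {min a (a'+t)<..<max b (b'+t)}" using 1 2 by auto
  ultimately show ?thesis unfolding flows_def by blast
qed

end

section \<open>The linearised flow along an orbit\<close>

locale hamiltonian_orbit = hamiltonian_system A \<omega> H
  for A :: "('m::{t2_space,second_countable_topology}, real^'n) chart set" and \<omega> H +
  fixes v :: "real \<Rightarrow> 'm"
  assumes orbit: "integral_curve A X UNIV v"
begin

lemma v_isCont: "isCont v s"
  using orbit by (simp add: integral_curve_def has_velocity_def)

lemma flows_orbit: "flows t (v s) (v (s + t))"
proof -
  have "integral_curve A X {- \<bar>t\<bar> - 1<..<\<bar>t\<bar> + 1} (\<lambda>r. v (r + s))"
    by (rule integral_curve_shift[OF orbit]) simp
  then show ?thesis
    unfolding flows_def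
    by (intro exI[of _ "\<lambda>r. v (r + s)"] exI[of _ "- \<bar>t\<bar> - 1"] exI[of _ "\<bar>t\<bar> + 1"])
      (auto simp: add.commute)
qed

lemma flow_orbit: "flow A X t (v s) = v (s + t)"
  by (rule flows_flow[OF flows_orbit])

text \<open>Bundles what is propagated along the orbit. Existence in a whole neighbourhood is
  included because a differential of \<open>flow\<close> is meaningful only if the flow is defined
  around the point.\<close>

definition regular_flow :: "real \<Rightarrow> real \<Rightarrow> bool" where
  "regular_flow s t \<longleftrightarrow> eventually (\<lambda>p. \<exists>q. flows t p q) (nhds (v s)) \<and>
     (\<exists>D. mderiv (chart_at A (v s)) (chart_at A (v (s + t))) (flow A X t) (v s) D \<and>
       (\<forall>u w. \<omega> (v (s + t)) (D u) (D w) = \<omega> (v s) u w))"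

text \<open>Continuity of the time \<open>t\<close> map brings nearby points into the neighbourhood
  on which time \<open>h\<close> is available, where the curves concatenate.\<close>

lemma flow_add_eventually:
  assumes "regular_flow s t" "regular_flow (s + t) h"
  shows "eventually (\<lambda>p. (\<exists>q. flows (t + h) p q) \<and> flow A X (t + h) p = flow A X h (flow A X t p)) (nhds (v s))"
proof -
  have "isCont (flow A X t) (v s)" using assms(1) by (auto simp: regular_flow_def mderiv_def)
  then have "filterlim (flow A X t) (nhds (v (s + t))) (nhds (v s))"
    using flow_orbit[of t s] unfolding isCont_def tendsto_at_iff_tendsto_nhds by simp
  moreover have "eventually (\<lambda>p. \<exists>q. flows h p q) (nhds (v (s + t)))"
    using assms(2) by (simp add: regular_flow_def)
  ultimately have "eventually (\<lambda>p. \<exists>q. flows h (flow A X t p) q) (nhds (v s))"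
    by (rule eventually_compose_filterlim[rotated])
  moreover have "eventually (\<lambda>p. \<exists>q. flows t p q) (nhds (v s))"
    using assms(1) by (simp add: regular_flow_def)
  ultimately show ?thesis
  proof eventually_elim
    case (elim p)
    then obtain q r where q: "flows t p q" and r: "flows h (flow A X t p) r" by blast
    have f: "flow A X t p = q" by (rule flows_flow[OF q])
    have "flows (t + h) p r" using flows_add[OF q] r f by simp
    then show ?case using flows_flow[OF r] flows_flow by blast
  qed
qed

lemma regular_flow_add:
  assumes "regular_flow s t" "regular_flow (s + t) h"
  shows "regular_flow s (t + h)"
proof -
  obtain W where W: "open W" "v s \<in> W"
    "\<And>p. p \<in> W \<Longrightarrow> (\<exists>q. flows (t + h) p q) \<and> flow A X (t + h) p = flow A X h (flow A X t p)"
    using flow_add_eventually[OF assms] unfolding eventually_nhds by blast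
  obtain D where D: "mderiv (chart_at A (v s)) (chart_at A (v (s + t))) (flow A X t) (v s) D"
    "\<And>u w. \<omega> (v (s + t)) (D u) (D w) = \<omega> (v s) u w"
    using assms(1) by (auto simp: regular_flow_def)
  obtain E where E: "mderiv (chart_at A (v (s + t))) (chart_at A (v (s + t + h))) (flow A X h) (v (s + t)) E"
    "\<And>u w. \<omega> (v (s + t + h)) (E u) (E w) = \<omega> (v (s + t)) u w"
    using assms(2) by (auto simp: regular_flow_def)
  have "mderiv (chart_at A (v s)) (chart_at A (v (s + t + h))) (flow A X h \<circ> flow A X t) (v s) (E \<circ> D)"
    by (rule mderiv_comp[OF D(1)]) (simp add: flow_orbit E)
  then have "mderiv (chart_at A (v s)) (chart_at A (v (s + t + h))) (flow A X (t + h)) (v s) (E \<circ> D)"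
    by (rule mderiv_transform[OF _ W(1,2)]) (use W(3) in simp)
  moreover have "\<omega> (v (s + t + h)) ((E \<circ> D) u) ((E \<circ> D) w) = \<omega> (v s) u w" for u w
    using D(2) E(2) by simp
  moreover have "eventually (\<lambda>p. \<exists>q. flows (t + h) p q) (nhds (v s))"
    using W by (auto simp: eventually_nhds)
  ultimately show ?thesis by (auto simp: regular_flow_def add.assoc)
qed

text \<open>One flow box around \<open>v s0\<close> serves all orbit points near it, so a single
  \<epsilon> bounds both the time and the shift of the base point. This uniformity is what makes the
  set of reachable times closed.\<close>

lemma regular_flow_locally:
  "\<exists>\<epsilon>>0. \<forall>s h. \<bar>s - s0\<bar> < \<epsilon> \<longrightarrow> \<bar>h\<bar> < \<epsilon> \<longrightarrow> regular_flow s h"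
proof -
  define c where "c = chart_at A (v s0)"
  have c: "c \<in> A" "v s0 \<in> cdom c" by (auto simp: c_def chart_at)
  note C = is_chartD[OF is_chart[OF c(1)]]
  obtain X' where X': "C1_on (cimage c) (X_in c) X'" using X_in_C1[OF c(1)] by blast
  define x0 where "x0 = coord c (v s0)"
  have x0: "x0 \<in> cimage c" unfolding x0_def by (rule C(4)[OF c(2)])
  obtain \<delta> r \<Phi> \<Psi> where \<delta>: "0 < \<delta>" and r: "0 < r" "ball x0 r \<subseteq> cimage c"
    and \<Phi>0: "\<And>x. x \<in> ball x0 r \<Longrightarrow> \<Phi> 0 x = x"
    and \<Phi>: "\<And>x t. x \<in> ball x0 r \<Longrightarrow> \<bar>t\<bar> < \<delta> \<Longrightarrow> \<Phi> t x \<in> cimage c"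
    and \<Phi>': "\<And>x t. x \<in> ball x0 r \<Longrightarrow> \<bar>t\<bar> < \<delta> \<Longrightarrow>
       ((\<lambda>s. \<Phi> s x) has_vector_derivative X_in c (\<Phi> t x)) (at t)"
    and \<Psi>: "\<And>x t. x \<in> ball x0 r \<Longrightarrow> \<bar>t\<bar> < \<delta> \<Longrightarrow> (\<Phi> t has_derivative \<Psi> t x) (at x)"
    and \<Psi>0: "\<And>x u. x \<in> ball x0 r \<Longrightarrow> \<Psi> 0 x u = u"
    and \<Psi>': "\<And>x t u. x \<in> ball x0 r \<Longrightarrow> \<bar>t\<bar> < \<delta> \<Longrightarrow>
       ((\<lambda>s. \<Psi> s x u) has_vector_derivative X' (\<Phi> t x) (\<Psi> t x u)) (at t)"
    by (rule local_flow[OF X' x0]) blast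
  define W where "W = cdom c \<inter> coord c -` ball x0 r"
  have Wo: "open W"
    unfolding W_def using C(1,7)
    by (intro continuous_open_preimage continuous_at_imp_continuous_on) auto
  have W: "p \<in> cdom c" "coord c p \<in> ball x0 r" if "p \<in> W" for p using that by (auto simp: W_def)
  define g where "g t p = cinv c (\<Phi> t (coord c p))" for t p
  have g: "g t p \<in> cdom c" "coord c (g t p) = \<Phi> t (coord c p)" if "p \<in> W" "\<bar>t\<bar> < \<delta>" for p t
    using C(5,6)[OF \<Phi>[OF W(2)[OF that(1)] that(2)]] by (auto simp: g_def)
  have g_curve: "has_velocity A (\<lambda>t. g t p) t (X (g t p))" if p: "p \<in> W" and t: "\<bar>t\<bar> < \<delta>" for p t
  proof -
    have "isCont (\<lambda>t. \<Phi> t (coord c p)) t"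
      using \<Phi>'[OF W(2)[OF p] t] by (rule has_vector_derivative_continuous)
    then have "isCont (\<lambda>t. g t p) t"
      unfolding g_def
      by (rule isCont_o2[where f = "\<lambda>t. \<Phi> t (coord c p)"]) (rule C(8)[OF \<Phi>[OF W(2)[OF p] t]])
    moreover have "((\<lambda>s. coord c (g s p)) has_vector_derivative X_in c (\<Phi> t (coord c p))) (at t)"
      by (rule has_vector_derivative_transform_within_open[OF \<Phi>'[OF W(2)[OF p] t], of "{-\<delta><..<\<delta>}"])
        (use t g[OF p] in auto)
    ultimately show ?thesis
      using has_velocity_X[OF c(1), of "\<lambda>t. g t p" t] g[OF p t] by simp
  qed
  have flows: "flows h p (g h p)" if p: "p \<in> W" and h: "\<bar>h\<bar> < \<delta>" for p h
    unfolding flows_def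
  proof (intro exI conjI)
    show "{0, h} \<subseteq> {-\<delta><..<\<delta>}" using h \<delta> by auto
    show "integral_curve A X {-\<delta><..<\<delta>} (\<lambda>t. g t p)"
      unfolding integral_curve_def using g_curve[OF p] by auto
    show "g 0 p = p" using \<Phi>0[OF W(2)[OF p]] C(3)[OF W(1)[OF p]] by (simp add: g_def)
  qed simp
  have reg: "regular_flow s h" if s: "v s \<in> W" and h: "\<bar>h\<bar> < \<delta>" for s h
  proof -
    define x where "x = coord c (v s)"
    have x: "x \<in> ball x0 r" "x \<in> cimage c" using W(2)[OF s] r by (auto simp: x_def)
    have gv: "g h (v s) = v (s + h)"
      by (rule flows_unique[OF flows[OF s h] flows_orbit])
    have "isCont (coord c) (v s)" by (rule C(7)[OF W(1)[OF s]])
    moreover have "isCont (\<Phi> h) (coord c (v s))"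
      using \<Psi>[OF x(1) h] unfolding x_def by (rule has_derivative_continuous)
    ultimately have "isCont (\<lambda>p. \<Phi> h (coord c p)) (v s)" by (rule isCont_o2)
    then have "isCont (g h) (v s)"
      unfolding g_def
      by (rule isCont_o2[where f = "\<lambda>p. \<Phi> h (coord c p)"]) (rule C(8)[OF \<Phi>[OF W(2)[OF s] h]])
    moreover have "((coord c \<circ> g h \<circ> cinv c) has_derivative \<Psi> h x) (at x)"
    proof (rule has_derivative_transform_within_open[OF \<Psi>[OF x(1) h] open_ball x(1)])
      fix y assume "y \<in> ball x0 r"
      then have "y \<in> cimage c" "\<Phi> h y \<in> cimage c" using r \<Phi> h by auto
      then show "\<Phi> h y = (coord c \<circ> g h \<circ> cinv c) y" by (simp add: g_def C(5))
    qed
    ultimately have "mderiv c c (g h) (v s) (\<Psi> h x)"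
      using W(1)[OF s] g(1)[OF s h] is_chart[OF c(1)] by (simp add: mderiv_def x_def)
    then have f: "mderiv c c (flow A X h) (v s) (\<Psi> h x)"
      by (rule mderiv_transform[OF _ Wo s]) (rule flows_flow[OF flows[OF _ h]])
    \<comment> \<open>The box is computed in \<open>c\<close>, whereas differentials are read in the
      preferred charts at \<open>v s\<close> and \<open>v (s + h)\<close>; transitions on both sides
      mediate.\<close>
    let ?T = "transition (chart_at A (v s)) c (v s)" and ?T' = "transition c (chart_at A (v (s + h))) (v (s + h))"
    have vc: "v s \<in> cdom c" "v (s + h) \<in> cdom c" using W(1)[OF s] g(1)[OF s h] gv by auto
    have "mderiv (chart_at A (v s)) c (flow A X h \<circ> id) (v s) (\<Psi> h x \<circ> ?T)"
      by (rule mderiv_comp[OF transition]) (use f vc c chart_at in auto)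
    then have "mderiv (chart_at A (v s)) (chart_at A (v (s + h))) (id \<circ> (flow A X h \<circ> id)) (v s) (?T' \<circ> (\<Psi> h x \<circ> ?T))"
      by (rule mderiv_comp) (use flow_orbit[of h s] transition[OF c(1) chart_at(1) vc(2) chart_at(2)] in simp)
    then have "mderiv (chart_at A (v s)) (chart_at A (v (s + h))) (flow A X h) (v s) (?T' \<circ> (\<Psi> h x \<circ> ?T))"
      by simp
    moreover have "\<omega> (v (s + h)) (?T' (\<Psi> h x (?T u))) (?T' (\<Psi> h x (?T w))) = \<omega> (v s) u w" for u w
    proof -
      have "\<omega> (v (s + h)) (?T' (\<Psi> h x (?T u))) (?T' (\<Psi> h x (?T w)))
          = form_in_chart A \<omega> c (\<Phi> h x) (\<Psi> h x (?T u)) (\<Psi> h x (?T w))"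
        using form_in_chart_eq[OF c(1) vc(2)] g(2)[OF s h] gv by (simp add: x_def)
      also have "\<dots> = form_in_chart A \<omega> c (\<Phi> 0 x) (\<Psi> 0 x (?T u)) (\<Psi> 0 x (?T w))"
        by (rule hamiltonian_chart.form_preserved[OF hamiltonian_chart[OF c(1)] X' \<delta>,
              where y = "\<lambda>t. \<Phi> t x" and U = "\<lambda>t. \<Psi> t x (?T u)" and V = "\<lambda>t. \<Psi> t x (?T w)"])
          (use \<Phi>[OF x(1)] \<Phi>'[OF x(1)] \<Psi>'[OF x(1)] h in auto)
      also have "\<dots> = \<omega> (v s) (transition c (chart_at A (v s)) (v s) (?T u)) (transition c (chart_at A (v s)) (v s) (?T w))"
        using form_in_chart_eq[OF c(1) vc(1)] \<Phi>0[OF x(1)] \<Psi>0[OF x(1)] by (simp add: x_def)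
      also have "\<dots> = \<omega> (v s) u w"
        using transition_inverse[OF chart_at(1) c(1) chart_at(2) vc(1)] by simp
      finally show ?thesis .
    qed
    moreover have "eventually (\<lambda>p. \<exists>q. flows h p q) (nhds (v s))"
      unfolding eventually_nhds using Wo s flows[OF _ h] by blast
    ultimately show ?thesis unfolding regular_flow_def by (auto simp: o_def)
  qed
  have "v s0 \<in> W" using c r by (simp add: W_def x0_def)
  then have "eventually (\<lambda>s. v s \<in> W) (nhds s0)" by (rule isCont_eventually[OF v_isCont Wo])
  then obtain d where d: "d > 0" "\<And>s. \<bar>s - s0\<bar> < d \<Longrightarrow> v s \<in> W"
    by (auto simp: eventually_nhds_metric dist_real_def)
  show ?thesis by (rule exI[of _ "min d \<delta>"]) (use d \<delta> reg in auto)
qed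

text \<open>The good times form an open and closed set containing 0. For closedness: if a time
  \<open>r\<close> near \<open>t\<close> were good, the short step \<open>t - r\<close> from base
  time \<open>s + r\<close> would make \<open>t\<close> good.\<close>

lemma regular_flow: "regular_flow s t"
proof -
  let ?S = "{t. regular_flow s t}"
  have "open ?S"
    unfolding open_dist
  proof
    fix t assume t: "t \<in> ?S"
    obtain \<epsilon> where \<epsilon>: "\<epsilon> > 0" "\<And>h. \<bar>h\<bar> < \<epsilon> \<Longrightarrow> regular_flow (s + t) h"
      using regular_flow_locally[of "s + t"] by force
    have "regular_flow s r" if "\<bar>r - t\<bar> < \<epsilon>" for r
      using regular_flow_add[of s t "r - t"] t \<epsilon>(2)[OF that] by simp
    then show "\<exists>e>0. \<forall>y. dist y t < e \<longrightarrow> y \<in> ?S" using \<epsilon>(1) by (auto simp: dist_real_def)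
  qed
  moreover have "closed ?S"
    unfolding closed_def open_dist
  proof
    fix t assume t: "t \<in> - ?S"
    obtain \<epsilon> where \<epsilon>: "\<epsilon> > 0" "\<And>r h. \<bar>r - (s + t)\<bar> < \<epsilon> \<Longrightarrow> \<bar>h\<bar> < \<epsilon> \<Longrightarrow> regular_flow r h"
      using regular_flow_locally[of "s + t"] by blast
    have "\<not> regular_flow s r" if "\<bar>r - t\<bar> < \<epsilon>" for r
      using regular_flow_add[of s r "t - r"] t \<epsilon>(2)[of "s + r" "t - r"] that by (auto simp: abs_minus_commute)
    then show "\<exists>e>0. \<forall>y. dist y t < e \<longrightarrow> y \<in> - ?S" using \<epsilon>(1) by (auto simp: dist_real_def)
  qed
  moreover have "0 \<in> ?S" using regular_flow_locally[of s] by force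
  ultimately have "?S = UNIV" using clopen[of ?S] by blast
  then show ?thesis by blast
qed

section \<open>The differential of the flow along the orbit\<close>

definition D :: "real \<Rightarrow> real \<Rightarrow> real^'n \<Rightarrow> real^'n" where
  "D s t = diff_map A (flow A X t) (v s)"

lemma D_mderiv: "mderiv (chart_at A (v s)) (chart_at A (v (s + t))) (flow A X t) (v s) (D s t)"
  and D_symplectic: "\<omega> (v (s + t)) (D s t u) (D s t w) = \<omega> (v s) u w"
proof -
  obtain E where E: "mderiv (chart_at A (v s)) (chart_at A (v (s + t))) (flow A X t) (v s) E"
    "\<And>u w. \<omega> (v (s + t)) (E u) (E w) = \<omega> (v s) u w"
    using regular_flow[of s t] by (auto simp: regular_flow_def)
  moreover have "D s t = E"
    unfolding D_def by (rule diff_map_eq) (simp add: flow_orbit E)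
  ultimately show "mderiv (chart_at A (v s)) (chart_at A (v (s + t))) (flow A X t) (v s) (D s t)"
    "\<omega> (v (s + t)) (D s t u) (D s t w) = \<omega> (v s) u w" by auto
qed

lemma D_linear: "linear (D s t)"
  by (rule mderiv_linear[OF D_mderiv])

lemma D_add: "D s (t + h) u = D (s + t) h (D s t u)"
proof -
  obtain W where W: "open W" "v s \<in> W"
    "\<And>p. p \<in> W \<Longrightarrow> flow A X (t + h) p = flow A X h (flow A X t p)"
    using flow_add_eventually[where s = s and t = t and h = h, OF regular_flow regular_flow] unfolding eventually_nhds by blast
  have "mderiv (chart_at A (v s)) (chart_at A (v (s + t + h))) (flow A X h \<circ> flow A X t) (v s) (D (s + t) h \<circ> D s t)"
    by (rule mderiv_comp[OF D_mderiv]) (simp add: flow_orbit D_mderiv)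
  then have "mderiv (chart_at A (v s)) (chart_at A (v (s + t + h))) (flow A X (t + h)) (v s) (D (s + t) h \<circ> D s t)"
    by (rule mderiv_transform[OF _ W(1,2)]) (simp add: W(3))
  then have "D s (t + h) = D (s + t) h \<circ> D s t"
    using D_mderiv[of s "t + h"] by (simp add: mderiv_unique add.assoc)
  then show ?thesis by simp
qed

text \<open>The group law makes \<open>D s 0\<close> idempotent and symplecticity makes it
  injective, so it is the identity.\<close>

lemma D_zero: "D s 0 u = u"
proof -
  have "D s 0 (D s 0 u) = D s 0 u" using D_add[of s 0 0 u] by simp
  moreover have "inj (D s 0)"
  proof (rule injI)
    fix x y assume "D s 0 x = D s 0 y"
    then show "x = y" using D_symplectic[of s 0] by (intro \<omega>_eqI[of "v s"]) (metis add_0_right)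
  qed
  ultimately show ?thesis by (simp add: inj_eq)
qed

text \<open>Differentiate \<open>flow A X t (v r) = v (r + t)\<close> with respect to
  \<open>r\<close> at \<open>s\<close>.\<close>

lemma D_X: "D s t (X (v s)) = X (v (s + t))"
proof -
  have "has_velocity A v s (X (v s))" "has_velocity A v (s + t) (X (v (s + t)))"
    using orbit by (auto simp: integral_curve_def)
  from has_velocity_comp[OF this(1), of "flow A X t" "D s t"] has_velocity_shift[OF this(2)]
  have "has_velocity A (\<lambda>r. v (r + t)) s (D s t (X (v s)))" "has_velocity A (\<lambda>r. v (r + t)) s (X (v (s + t)))"
    by (simp_all add: flow_orbit D_mderiv o_def)
  then show ?thesis by (rule has_velocity_unique)
qed

lemma H_orbit: "H (v s) = H (v t)"
proof -
  have "((H \<circ> v) has_derivative (\<lambda>h. 0)) (at s)" for s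
  proof -
    have "mderiv real_chart real_chart (H \<circ> v) s (diff_function A H (v s) \<circ> (\<lambda>h. h *\<^sub>R X (v s)))"
      using orbit by (intro mderiv_comp[OF _ dH]) (simp add: has_velocity_iff[symmetric] integral_curve_def)
    then show ?thesis
      by (simp add: mderiv_curve o_def X linear_scale[OF \<omega>_linear(2)] \<omega>_alt) (simp add: real_chart_def)
  qed
  then have "\<exists>c. \<forall>s\<in>UNIV. (H \<circ> v) s = c" by (intro has_derivative_zero_constant convex_UNIV)
  then show ?thesis by auto
qed

text \<open>Through a zero of \<open>X\<close> passes a constant integral curve, and uniqueness
  would force \<open>v\<close> to be that curve.\<close>

lemma X_orbit_nonzero: "\<not> v constant_on UNIV \<Longrightarrow> X (v s) \<noteq> 0"
proof
  assume "\<not> v constant_on UNIV" and 0: "X (v s) = 0"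
  moreover have "integral_curve A X UNIV (\<lambda>_. v s)"
    using 0 by (simp add: integral_curve_def has_velocity_const)
  then have "v t = v s" for t
    using integral_curve_unique[OF open_UNIV connected_UNIV orbit, of "\<lambda>_. v s" s t] by simp
  ultimately show False by (auto simp: constant_on_def)
qed

end

section \<open>Tangent spaces of level sets\<close>

text \<open>An implicit function argument in one real unknown: the point \<open>x0 + s u\<close> is
  corrected along the transversal \<open>w\<close>, where \<open>h\<close> is increasing. The
  correction is at most \<open>2 * \<bar>k s\<bar>\<close>, and \<open>k\<close> has derivative 0
  because \<open>h' x0 u = 0\<close>, so the velocity remains \<open>u\<close>.\<close>

lemma level_curve:
  fixes h :: "'a::euclidean_space \<Rightarrow> real"
  assumes h: "C1_on S h h'" and x0: "x0 \<in> S" and u: "h' x0 u = 0" and w: "h' x0 w = 1"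
  obtains y where "y 0 = x0" "\<And>s::real. y s \<in> S" "\<And>s. h (y s) = h x0" "(y has_vector_derivative u) (at 0)"
proof -
  note C = C1_onD[OF h]
  have "isCont (\<lambda>x. h' x w) x0"
    using C(1,3) x0 continuous_on_eq_continuous_at by blast
  then have "eventually (\<lambda>x. h' x w \<in> {1/2<..}) (nhds x0)"
    by (rule isCont_eventually) (use w in auto)
  moreover have "eventually (\<lambda>x. x \<in> S) (nhds x0)" using C(1) x0 by (rule eventually_nhds_in_open)
  ultimately have "eventually (\<lambda>x. x \<in> S \<and> h' x w > 1/2) (nhds x0)" by eventually_elim simp
  then obtain \<rho> where \<rho>: "\<rho> > 0" "\<And>x. dist x x0 < \<rho> \<Longrightarrow> x \<in> S \<and> h' x w > 1/2"
    unfolding eventually_nhds_metric by blast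
  \<comment> \<open>Steps below \<open>\<rho> / K\<close> in both directions displace by less than
    \<rho>; the summand 1 makes the inequality strict.\<close>
  define K where "K = norm u + norm w + 1"
  have K: "K > 0" unfolding K_def by (smt (verit) norm_ge_zero)
  have near: "dist (x0 + s *\<^sub>R u + r *\<^sub>R w) x0 < \<rho>" if "\<bar>s\<bar> < \<rho> / K" "\<bar>r\<bar> < \<rho> / K" for s r
  proof -
    have "dist (x0 + s *\<^sub>R u + r *\<^sub>R w) x0 = norm (s *\<^sub>R u + r *\<^sub>R w)" by (simp add: dist_norm)
    also have "\<dots> \<le> \<bar>s\<bar> * norm u + \<bar>r\<bar> * norm w" using norm_triangle_ineq[of "s *\<^sub>R u" "r *\<^sub>R w"] by simp
    also have "\<dots> \<le> \<rho> / K * norm u + \<rho> / K * norm w" using that by (intro add_mono mult_right_mono) auto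
    also have "\<dots> < \<rho> / K * K" unfolding K_def using \<rho> K by (simp add: K_def ring_distribs)
    finally show ?thesis using K by simp
  qed
  define k where "k s = h (x0 + s *\<^sub>R u) - h x0" for s
  have k: "(k has_derivative (\<lambda>_. 0)) (at 0)"
  proof -
    have "((\<lambda>s. h (x0 + s *\<^sub>R u)) has_derivative (\<lambda>s. h' x0 (s *\<^sub>R u))) (at 0)"
      by (rule has_derivative_compose[where g = h and f' = "\<lambda>s. s *\<^sub>R u"])
        (use C(2)[OF x0] in \<open>auto intro!: derivative_eq_intros\<close>)
    from has_derivative_diff[OF this has_derivative_const[of "h x0"]] show ?thesis
      using u by (simp add: k_def[abs_def] linear_scale[OF bounded_linear.linear[OF C(4)[OF x0]]])
  qed
  \<comment> \<open>A slope above 1/2 along \<open>w\<close> means that moving by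
    \<open>2 * \<bar>k s\<bar>\<close> in the right direction compensates the error
    \<open>k s\<close>, so the intermediate value theorem finds a solution.\<close>
  have solve: "\<exists>r. \<bar>r\<bar> \<le> 2 * \<bar>k s\<bar> \<and> h (x0 + s *\<^sub>R u + r *\<^sub>R w) = h x0"
    if s: "\<bar>s\<bar> < \<rho> / K" and ks: "2 * \<bar>k s\<bar> < \<rho> / K" for s
  proof -
    define F where "F r = h (x0 + s *\<^sub>R u + r *\<^sub>R w)" for r
    define m where "m = 2 * \<bar>k s\<bar>"
    have F: "(F has_real_derivative h' (x0 + s *\<^sub>R u + r *\<^sub>R w) w) (at r)" if "\<bar>r\<bar> \<le> m" for r
    proof -
      have p: "x0 + s *\<^sub>R u + r *\<^sub>R w \<in> S"
        using \<rho>(2)[OF near[OF s]] that ks by (auto simp: m_def)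
      have "(F has_derivative (\<lambda>a. h' (x0 + s *\<^sub>R u + r *\<^sub>R w) (a *\<^sub>R w))) (at r)"
        unfolding F_def
        by (rule has_derivative_compose[where g = h and f' = "\<lambda>a. a *\<^sub>R w"])
          (use C(2)[OF p] in \<open>auto intro!: derivative_eq_intros\<close>)
      then show ?thesis
        by (simp add: has_field_derivative_def linear_scale[OF bounded_linear.linear[OF C(4)[OF p]]] mult_commute_abs)
    qed
    have F2: "F 0 + (b - 0) / 2 \<le> F b" "F (- b) \<le> F 0 - (b - 0) / 2" if "0 \<le> b" "b \<le> m" for b
    proof -
      have incr: "F a + (a' - a) / 2 \<le> F a'" if "a \<le> a'" "- m \<le> a" "a' \<le> m" for a a'
      proof -
        have "F a - a / 2 \<le> F a' - a' / 2"
        proof (rule DERIV_nonneg_imp_nondecreasing[OF that(1), where f = "\<lambda>r. F r - r / 2"])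
          fix r assume r: "a \<le> r" "r \<le> a'"
          then have r': "\<bar>r\<bar> \<le> m" using that by auto
          have "h' (x0 + s *\<^sub>R u + r *\<^sub>R w) w > 1/2"
            using \<rho>(2)[OF near[OF s]] r' ks by (auto simp: m_def)
          moreover have "((\<lambda>r. F r - r / 2) has_real_derivative h' (x0 + s *\<^sub>R u + r *\<^sub>R w) w - 1 / 2) (at r)"
            by (intro DERIV_diff F[OF r'] DERIV_cdivide DERIV_ident)
          ultimately show "\<exists>y. ((\<lambda>r. F r - r / 2) has_real_derivative y) (at r) \<and> y \<ge> 0"
            by (intro exI conjI) auto
        qed
        then show ?thesis by (simp add: diff_divide_distrib)
      qed
      show "F 0 + (b - 0) / 2 \<le> F b" "F (- b) \<le> F 0 - (b - 0) / 2"
        using incr[of 0 b] incr[of "-b" 0] that by auto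
    qed
    have "F (- m) \<le> h x0" "h x0 \<le> F m"
      using F2[of m] by (auto simp: m_def F_def k_def abs_if split: if_splits)
    moreover have "isCont F r" if "-m \<le> r \<and> r \<le> m" for r
      by (rule DERIV_isCont[OF F]) (use that in auto)
    ultimately obtain r where "- m \<le> r" "r \<le> m" "F r = h x0"
      using IVT[of F "-m" "h x0" m] by (auto simp: m_def)
    then show ?thesis by (intro exI[of _ r]) (auto simp: m_def F_def)
  qed
  have "isCont k 0" using k by (rule has_derivative_continuous)
  then have "eventually (\<lambda>s. k s \<in> {- (\<rho> / (2 * K))<..<\<rho> / (2 * K)}) (nhds 0)"
    by (rule isCont_eventually) (use \<rho> K in \<open>auto simp: k_def\<close>)
  then obtain a0 where a0: "a0 > 0" "\<And>s. \<bar>s\<bar> < a0 \<Longrightarrow> k s \<in> {- (\<rho> / (2 * K))<..<\<rho> / (2 * K)}"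
    unfolding eventually_nhds_metric dist_real_def by auto
  define a where "a = min a0 (\<rho> / K)"
  have a: "a > 0" using a0 \<rho> K by (simp add: a_def)
  have ka: "2 * \<bar>k s\<bar> < \<rho> / K" if "\<bar>s\<bar> < a" for s
    using a0(2)[of s] that K by (auto simp: a_def abs_less_iff field_simps)
  have "\<forall>s. \<exists>r. \<bar>s\<bar> < a \<longrightarrow> \<bar>r\<bar> \<le> 2 * \<bar>k s\<bar> \<and> h (x0 + s *\<^sub>R u + r *\<^sub>R w) = h x0"
    using solve ka by (auto simp: a_def)
  then obtain r where r: "\<And>s. \<bar>s\<bar> < a \<Longrightarrow> \<bar>r s\<bar> \<le> 2 * \<bar>k s\<bar>"
    "\<And>s. \<bar>s\<bar> < a \<Longrightarrow> h (x0 + s *\<^sub>R u + r s *\<^sub>R w) = h x0" by metis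
  have r0: "r 0 = 0" using r(1)[of 0] a by (simp add: k_def)
  have r': "(r has_derivative (\<lambda>_. 0)) (at 0)"
    unfolding has_derivative_at_alt
  proof (intro conjI allI impI)
    fix \<epsilon> :: real assume "0 < \<epsilon>"
    then have "0 < \<epsilon> / 2" by simp
    then obtain d where d: "d > 0" "\<And>s. norm (s - 0) < d \<Longrightarrow> norm (k s - k 0 - 0) \<le> \<epsilon> / 2 * norm (s - 0)"
      using k unfolding has_derivative_at_alt by blast
    have "norm (r s - r 0 - 0) \<le> \<epsilon> * norm (s - 0)" if "norm (s - 0) < min a d" for s
      using d(2)[of s] r(1)[of s] that by (auto simp: r0 k_def)
    then show "\<exists>d>0. \<forall>s. norm (s - 0) < d \<longrightarrow> norm (r s - r 0 - 0) \<le> \<epsilon> * norm (s - 0)"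
      using a d(1) by (intro exI[of _ "min a d"]) auto
  qed simp
  \<comment> \<open>Defined for all real \<open>s\<close>, as \<open>tangent_space_of\<close>
    demands a curve whose entire range lies in the level set; away from 0 it rests at
    \<open>x0\<close>.\<close>
  define y where "y s = (if \<bar>s\<bar> < a then x0 + s *\<^sub>R u + r s *\<^sub>R w else x0)" for s
  show ?thesis
  proof
    show "y 0 = x0" by (simp add: y_def r0)
    show "h (y s) = h x0" for s using r(2) by (simp add: y_def)
    show "y s \<in> S" for s
    proof (cases "\<bar>s\<bar> < a")
      case True
      then have "dist (x0 + s *\<^sub>R u + r s *\<^sub>R w) x0 < \<rho>"
        using r(1)[OF True] ka[OF True] by (intro near) (auto simp: a_def)
      then show ?thesis using \<rho>(2) True by (simp add: y_def)
    qed (simp add: y_def x0)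
    have "((\<lambda>s. x0 + s *\<^sub>R u + r s *\<^sub>R w) has_derivative (\<lambda>s. 0 + s *\<^sub>R u + 0 *\<^sub>R w)) (at 0)"
      by (intro has_derivative_add has_derivative_const has_derivative_scaleR_left has_derivative_ident r')
    then have "(y has_derivative (\<lambda>s. 0 + s *\<^sub>R u + 0 *\<^sub>R w)) (at 0)"
      by (rule has_derivative_transform_within_open[where s = "{-a<..<a}"]) (use a in \<open>auto simp: y_def\<close>)
    then show "(y has_vector_derivative u) (at 0)" by (simp add: has_vector_derivative_def)
  qed
qed

context hamiltonian_system
begin

text \<open>One inclusion is the chain rule. For the other, \<open>X p \<noteq> 0\<close> and
  nondegeneracy supply the direction transversal to the level set that \<open>level_curve\<close>
  requires.\<close>

lemma tangent_space_level_set: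
  assumes "X p \<noteq> 0"
  shows "tangent_space_of A (H -` {H p}) p = {u. \<omega> p u (X p) = 0}"
proof (intro equalityI subsetI)
  fix u assume "u \<in> tangent_space_of A (H -` {H p}) p"
  then obtain \<gamma> where \<gamma>: "\<gamma> 0 = p" "range \<gamma> \<subseteq> H -` {H p}" "has_velocity A \<gamma> 0 u"
    by (auto simp: tangent_space_of_def)
  have "mderiv real_chart real_chart (H \<circ> \<gamma>) 0 (diff_function A H p \<circ> (\<lambda>h. h *\<^sub>R u))"
    using \<gamma>(1,3) dH by (intro mderiv_comp) (simp_all add: has_velocity_iff)
  moreover have "H \<circ> \<gamma> = (\<lambda>_. H p)" using \<gamma>(2) by (auto simp: fun_eq_iff image_subset_iff)
  ultimately have "((\<lambda>_. H p) has_derivative (diff_function A H p \<circ> (\<lambda>h. h *\<^sub>R u))) (at 0)"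
    by (simp add: mderiv_curve) (simp add: real_chart_def)
  from has_derivative_unique[OF this has_derivative_const] show "u \<in> {u. \<omega> p u (X p) = 0}"
    by (auto simp: X fun_eq_iff dest: spec[of _ 1])
next
  fix u assume "u \<in> {u. \<omega> p u (X p) = 0}"
  then have u: "diff_function A H p u = 0" by (simp add: X)
  define c where "c = chart_at A p"
  have c: "c \<in> A" "p \<in> cdom c" by (simp_all add: c_def chart_at)
  note C = is_chartD[OF is_chart[OF c(1)]]
  define h' where "h' x = frechet_derivative (H \<circ> cinv c) (at x)" for x
  have h: "C1_on (cimage c) (H \<circ> cinv c) h'"
    unfolding h'_def using smooth_H c by (intro smooth_on_imp_C1_on C(2)) (simp add: smooth_function_def)
  have h'_eq: "h' (coord c p) = diff_function A H p"
    unfolding h'_def by (simp add: diff_function_def c_def)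
  obtain w where "\<omega> p (X p) w \<noteq> 0" using \<omega>_nondegenerate assms by blast
  then have w: "diff_function A H p w \<noteq> 0" using \<omega>_antisym[of p w "X p"] by (simp add: X)
  define w' where "w' = (1 / diff_function A H p w) *\<^sub>R w"
  have w': "diff_function A H p w' = 1"
    using w by (simp add: w'_def linear_scale[OF mderiv_linear[OF dH]])
  obtain y where y: "y 0 = coord c p" "\<And>s::real. y s \<in> cimage c"
    "\<And>s. (H \<circ> cinv c) (y s) = (H \<circ> cinv c) (coord c p)" "(y has_vector_derivative u) (at 0)"
    using level_curve[OF h C(4)[OF c(2)]] u w' unfolding h'_eq by blast
  define \<gamma> where "\<gamma> s = cinv c (y s)" for s
  have "\<gamma> 0 = p" using C(3)[OF c(2)] by (simp add: \<gamma>_def y)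
  moreover have "range \<gamma> \<subseteq> H -` {H p}" using y(3) C(3)[OF c(2)] by (auto simp: \<gamma>_def)
  moreover have "has_velocity A \<gamma> 0 u"
  proof -
    have "isCont \<gamma> 0"
      unfolding \<gamma>_def using has_vector_derivative_continuous[OF y(4)]
      by (rule isCont_o2[where f = y]) (rule C(8)[OF y(2)])
    moreover have "(\<lambda>s. coord c (\<gamma> s)) = y" using C(5)[OF y(2)] by (simp add: \<gamma>_def)
    ultimately show ?thesis using y(4) \<open>\<gamma> 0 = p\<close> by (simp add: has_velocity_def c_def)
  qed
  ultimately show "u \<in> tangent_space_of A (H -` {H p}) p" by (auto simp: tangent_space_of_def)
qed

end

section \<open>Linear algebra of the reduced monodromy\<close>

lemma coset_eq_iff: "coset x u = coset x w \<longleftrightarrow> (\<exists>s. u = w + s *\<^sub>R x)"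
proof
  assume "coset x u = coset x w"
  moreover have "u \<in> coset x u" by (auto simp: coset_def intro: exI[of _ 0])
  ultimately show "\<exists>s. u = w + s *\<^sub>R x" by (auto simp: coset_def)
next
  assume "\<exists>s. u = w + s *\<^sub>R x"
  then obtain s where s: "u = w + s *\<^sub>R x" by blast
  have "w + s *\<^sub>R x + t *\<^sub>R x = w + (s + t) *\<^sub>R x" "w + t *\<^sub>R x = w + s *\<^sub>R x + (t - s) *\<^sub>R x" for t
    by (simp_all add: algebra_simps)
  then show "coset x u = coset x w" unfolding coset_def s by blast
qed

text \<open>The plane is the quotient by the line spanned by \<open>x\<close> of its \<open>W\<close>-orthogonal space.\<close>

locale reduced_plane =
  fixes W :: "'a::euclidean_space \<Rightarrow> 'a \<Rightarrow> real" and x :: 'a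
  assumes dim4: "DIM('a) = 4" and bil: "bilinear W" and alt: "W u u = 0"
    and nondeg: "u \<noteq> 0 \<Longrightarrow> \<exists>w. W u w \<noteq> 0" and x: "x \<noteq> 0"
begin

definition V :: "'a set" where "V = {u. W u x = 0}"

lemma antisym: "W u w = - W w u"
  by (rule alternating_antisym[OF bil alt])

lemmas W_simps = bilinear_ladd[OF bil] bilinear_radd[OF bil] bilinear_lmul[OF bil] bilinear_rmul[OF bil]
  bilinear_lsub[OF bil] bilinear_rsub[OF bil] bilinear_lneg[OF bil] bilinear_rneg[OF bil]
  bilinear_lzero[OF bil] bilinear_rzero[OF bil]

lemma V_W: "u \<in> V \<Longrightarrow> W u x = 0" "u \<in> V \<Longrightarrow> W x u = 0"
  using antisym[of x u] by (auto simp: V_def)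

lemma linear_W: "linear (W u)" "linear (\<lambda>u. W u w)"
  using bil by (auto simp: bilinear_def)

lemma V_closed: "u \<in> V \<Longrightarrow> w \<in> V \<Longrightarrow> u + w \<in> V" "u \<in> V \<Longrightarrow> w \<in> V \<Longrightarrow> u - w \<in> V"
  "u \<in> V \<Longrightarrow> k *\<^sub>R u \<in> V" "x \<in> V"
  by (auto simp: V_def W_simps alt)

text \<open>The remainder \<open>z\<close> after removing the two components is orthogonal to
  \<open>x\<close>, \<open>e1\<close> and \<open>e2\<close>. Were it not a multiple of
  \<open>x\<close>, these four vectors would form a basis of the 4-dimensional space and
  \<open>z\<close> would pair to zero with everything.\<close>

lemma symplectic_coordinates:
  assumes e: "e1 \<in> V" "e2 \<in> V" "W e1 e2 = 1" and u: "u \<in> V"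
  obtains s where "u = W u e2 *\<^sub>R e1 + W e1 u *\<^sub>R e2 + s *\<^sub>R x"
proof -
  define z where "z = u - (W u e2 *\<^sub>R e1 + W e1 u *\<^sub>R e2)"
  have z: "W z x = 0" "W z e1 = 0" "W z e2 = 0"
    using e u antisym[of e2 e1] antisym[of e1 u] by (simp_all add: z_def W_simps V_W alt)
  have "z \<in> span {x}"
  proof (rule ccontr)
    assume nz: "z \<notin> span {x}"
    have i2: "independent {z, x}" using nz x by (simp add: independent_insert span_superset)
    have "W y e2 = 0" if "y \<in> span {z, x}" for y
      by (rule linear_eq_0_on_span[OF linear_W(2) _ that]) (use z e V_W in auto)
    then have n1: "e1 \<notin> span {z, x}" using e by force
    then have i3: "independent {e1, z, x}" by (rule independent_insertI[OF _ i2])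
    have "W e1 y = 0" if "y \<in> span {e1, z, x}" for y
      by (rule linear_eq_0_on_span[OF linear_W(1) _ that]) (use z e V_W alt antisym[of e1 z] in auto)
    then have n2: "e2 \<notin> span {e1, z, x}" using e by force
    then have i4: "independent {e2, e1, z, x}" by (rule independent_insertI[OF _ i3])
    have "card {e2, e1, z, x} = 4"
    proof -
      have "z \<noteq> x" using nz span_superset[of "{x}"] by blast
      moreover have "e1 \<notin> {z, x}" "e2 \<notin> {e1, z, x}"
        using n1 n2 span_superset[of "{z, x}"] span_superset[of "{e1, z, x}"] by blast+
      ultimately show ?thesis by simp
    qed
    then have "dim {e2, e1, z, x} = DIM('a)" using dim_eq_card_independent[OF i4] dim4 by simp
    then have "span {e2, e1, z, x} = UNIV" by (simp add: dim_eq_full)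
    moreover have "W z y = 0" if "y \<in> span {e2, e1, z, x}" for y
      by (rule linear_eq_0_on_span[OF linear_W(1) _ that]) (use z alt in auto)
    ultimately have "z = 0" using nondeg by (metis UNIV_I)
    then show False using nz span_zero by blast
  qed
  then obtain s where "z = s *\<^sub>R x" by (auto simp: span_singleton)
  then show ?thesis using that[of s] by (simp add: z_def algebra_simps)
qed

lemma quotient_basis_symplectic:
  assumes e: "e1 \<in> V" "e2 \<in> V" "W e1 e2 = 1"
  shows "quotient_basis V x e1 e2"
  unfolding quotient_basis_def
proof (intro conjI e ballI)
  fix u assume u: "u \<in> V"
  obtain s where s: "u = W u e2 *\<^sub>R e1 + W e1 u *\<^sub>R e2 + s *\<^sub>R x"
    using symplectic_coordinates[OF e u] .
  show "\<exists>!(\<alpha>, \<beta>). coset x u = coset x (\<alpha> *\<^sub>R e1 + \<beta> *\<^sub>R e2)"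
  proof (rule ex1I[of _ "(W u e2, W e1 u)"])
    show "case (W u e2, W e1 u) of (\<alpha>, \<beta>) \<Rightarrow> coset x u = coset x (\<alpha> *\<^sub>R e1 + \<beta> *\<^sub>R e2)"
      using s by (auto simp: coset_eq_iff)
    fix ab :: "real \<times> real" assume "case ab of (\<alpha>, \<beta>) \<Rightarrow> coset x u = coset x (\<alpha> *\<^sub>R e1 + \<beta> *\<^sub>R e2)"
    then obtain \<alpha> \<beta> t where "ab = (\<alpha>, \<beta>)" "u = \<alpha> *\<^sub>R e1 + \<beta> *\<^sub>R e2 + t *\<^sub>R x"
      by (cases ab) (auto simp: coset_eq_iff)
    then show "ab = (W u e2, W e1 u)" using e V_W alt by (simp add: W_simps)
  qed
qed

text \<open>If \<open>V\<close> were isotropic, \<open>x\<close> and any \<open>w\<close> with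
  \<open>W x w \<noteq> 0\<close> would span the whole space, contradicting dimension 4.\<close>

lemma symplectic_pair_exists: "\<exists>e1\<in>V. \<exists>e2\<in>V. W e1 e2 \<noteq> 0"
proof (rule ccontr)
  assume "\<not> ?thesis"
  then have iso: "W u w = 0" if "u \<in> V" "w \<in> V" for u w using that by blast
  obtain w where w: "W x w \<noteq> 0" using nondeg[OF x] by blast
  have "y \<in> span {x, w}" for y
  proof -
    define u where "u = y - (W x y / W x w) *\<^sub>R w"
    have uV: "u \<in> V" using w antisym[of u x] by (simp add: V_def u_def W_simps)
    \<comment> \<open>Subtracting this multiple of \<open>x\<close> makes \<open>e\<close>
      orthogonal to \<open>w\<close> as well as to \<open>V\<close>, hence to everything.\<close>
    define e where "e = u - (W u w / W x w) *\<^sub>R x"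
    have eV: "e \<in> V" unfolding e_def by (intro V_closed uV)
    have ew: "W e w = 0" using w by (simp add: e_def W_simps)
    have "W e z = 0" for z
    proof -
      have "z - (W x z / W x w) *\<^sub>R w \<in> V"
        using w antisym[of "z - (W x z / W x w) *\<^sub>R w" x] by (simp add: V_def W_simps)
      from iso[OF eV this] show ?thesis using ew by (simp add: W_simps)
    qed
    then have "e = 0" using nondeg by blast
    then have "y = (W u w / W x w) *\<^sub>R x + (W x y / W x w) *\<^sub>R w" by (simp add: e_def u_def)
    then show ?thesis by (rule ssubst) (intro span_add span_scale span_base; simp)
  qed
  then have "dim (UNIV :: 'a set) \<le> card {x, w}" by (intro dim_le_card) auto
  also have "\<dots> \<le> 2" by (simp add: card_insert_if)
  finally show False using dim4 by (simp add: dim_UNIV)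
qed

text \<open>\<open>u + R u\<close> and \<open>u - R u\<close> are eigenvectors in \<open>V\<close>
  itself, not merely modulo \<open>x\<close>. For a pair with \<open>W e1 e2 \<noteq> 0\<close> the
  two mixed pairings differ by \<open>4 * W e1 e2\<close>, so one of them is nonzero and can be
  scaled to 1.\<close>

lemma adapted_basis_exists:
  assumes R: "linear R" "\<And>u. R (R u) = u" "\<And>u w. W (R u) (R w) = - W u w" "R x = - x"
  obtains f1 f2 where "f1 \<in> V" "f2 \<in> V" "R f1 = f1" "R f2 = - f2" "W f1 f2 = 1"
proof -
  note found = that
  have RV: "R u \<in> V" if "u \<in> V" for u
    using R(3)[of u x] that by (simp add: V_def R(4) W_simps)
  obtain e1 e2 where e: "e1 \<in> V" "e2 \<in> V" "W e1 e2 \<noteq> 0" using symplectic_pair_exists by blast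
  let ?p = "\<lambda>u. u + R u" and ?m = "\<lambda>u. u - R u"
  have p: "?p u \<in> V" "R (?p u) = ?p u" and m: "?m u \<in> V" "R (?m u) = - ?m u" if "u \<in> V" for u
    using that RV V_closed by (auto simp: linear_add[OF R(1)] linear_diff[OF R(1)] R(2))
  have main: thesis if "W (?p u) (?m w) \<noteq> 0" "u \<in> V" "w \<in> V" for u w
  proof (rule found)
    let ?k = "1 / W (?p u) (?m w)"
    show "?k *\<^sub>R ?p u \<in> V" "?m w \<in> V" by (intro V_closed(3) p m that)+
    show "R (?k *\<^sub>R ?p u) = ?k *\<^sub>R ?p u" by (simp only: linear_scale[OF R(1)] p(2)[OF that(2)])
    show "R (?m w) = - ?m w" by (rule m(2)[OF that(3)])
    show "W (?k *\<^sub>R ?p u) (?m w) = 1" using that(1) by (simp only: bilinear_lmul[OF bil]) simp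
  qed
  have "W (?p e1) (?m e2) - W (?p e2) (?m e1) = 4 * W e1 e2"
    using R(3)[of e1 e2] R(3)[of e2 e1] antisym[of e2 e1] antisym[of "R e2" e1] antisym[of e2 "R e1"] by (simp add: W_simps)
  then have "W (?p e1) (?m e2) \<noteq> 0 \<or> W (?p e2) (?m e1) \<noteq> 0" using e by auto
  then show ?thesis using main e by blast
qed

section \<open>Symplectic maps of the reduced plane\<close>

context
  fixes M :: "'a \<Rightarrow> 'a"
  assumes M: "linear M" "\<And>u w. W (M u) (M w) = W u w" "M x = x"
begin

lemma M_V: "u \<in> V \<Longrightarrow> M u \<in> V"
  using M(2)[of u x] by (simp add: V_def M(3))

lemma M_coset: "M ` coset x u = coset x (M u)"
  using image_coset[OF M(1), of x u] M(3) by simp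

lemma quotient_matrix_M:
  assumes f: "f1 \<in> V" "f2 \<in> V" "W f1 f2 = 1"
  shows "quotient_matrix (image M) x f1 f2 (W (M f1) f2) (W (M f2) f2) (W f1 (M f1)) (W f1 (M f2))"
  unfolding quotient_matrix_def M_coset coset_eq_iff
  using symplectic_coordinates[OF f M_V[OF f(1)]] symplectic_coordinates[OF f M_V[OF f(2)]] by metis

text \<open>\<open>W (M f1) f2 + W f1 (M f2)\<close> is alternating in \<open>f1\<close>,
  \<open>f2\<close>, hence a multiple of the area form of the plane, and the multiple is the trace.
  The definite description ranges over arbitrary quotient bases, so the sum is evaluated in a
  general \<open>e1\<close>, \<open>e2\<close>.\<close>

lemma quotient_trace_eq:
  assumes f: "f1 \<in> V" "f2 \<in> V" "W f1 f2 = 1"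
  shows "quotient_trace V x (image M) = W (M f1) f2 + W f1 (M f2)"
  unfolding quotient_trace_def
proof (rule the_equality)
  show "\<exists>e1 e2 a b c d. quotient_basis V x e1 e2 \<and> quotient_matrix (image M) x e1 e2 a b c d \<and>
      W (M f1) f2 + W f1 (M f2) = a + d"
    by (intro exI conjI) (rule quotient_basis_symplectic[OF f] quotient_matrix_M[OF f] refl)+
next
  fix r assume "\<exists>e1 e2 a b c d. quotient_basis V x e1 e2 \<and> quotient_matrix (image M) x e1 e2 a b c d \<and> r = a + d"
  then obtain e1 e2 a b c d where qb: "quotient_basis V x e1 e2"
    and qm: "quotient_matrix (image M) x e1 e2 a b c d" and r: "r = a + d" by blast
  have e: "e1 \<in> V" "e2 \<in> V" using qb by (simp_all add: quotient_basis_def)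
  obtain s1 s2 where s: "M e1 = a *\<^sub>R e1 + c *\<^sub>R e2 + s1 *\<^sub>R x" "M e2 = b *\<^sub>R e1 + d *\<^sub>R e2 + s2 *\<^sub>R x"
    using qm unfolding quotient_matrix_def M_coset coset_eq_iff by blast
  have coords: "\<exists>\<alpha> \<beta> t. u = \<alpha> *\<^sub>R e1 + \<beta> *\<^sub>R e2 + t *\<^sub>R x" if "u \<in> V" for u
  proof -
    have "\<exists>!(\<alpha>, \<beta>). coset x u = coset x (\<alpha> *\<^sub>R e1 + \<beta> *\<^sub>R e2)"
      using qb that by (simp add: quotient_basis_def)
    then show ?thesis by (auto simp: coset_eq_iff dest: ex1_implies_ex)
  qed
  obtain \<alpha>1 \<beta>1 t1 where f1: "f1 = \<alpha>1 *\<^sub>R e1 + \<beta>1 *\<^sub>R e2 + t1 *\<^sub>R x" using coords[OF f(1)] by blast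
  obtain \<alpha>2 \<beta>2 t2 where f2: "f2 = \<alpha>2 *\<^sub>R e1 + \<beta>2 *\<^sub>R e2 + t2 *\<^sub>R x" using coords[OF f(2)] by blast
  have W21: "W e2 e1 = - W e1 e2" by (rule antisym)
  have Mf: "M f1 = \<alpha>1 *\<^sub>R M e1 + \<beta>1 *\<^sub>R M e2 + t1 *\<^sub>R x" "M f2 = \<alpha>2 *\<^sub>R M e1 + \<beta>2 *\<^sub>R M e2 + t2 *\<^sub>R x"
    unfolding f1 f2 by (simp_all add: linear_add[OF M(1)] linear_scale[OF M(1)] M(3))
  have det: "(\<alpha>1 * \<beta>2 - \<beta>1 * \<alpha>2) * W e1 e2 = 1"
    using f(3) unfolding f1 f2 by (simp add: W_simps alt V_W e V_closed(4) W21 algebra_simps)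
  have "W (M f1) f2 + W f1 (M f2) = (a + d) * ((\<alpha>1 * \<beta>2 - \<beta>1 * \<alpha>2) * W e1 e2)"
    unfolding Mf unfolding f1 f2 s by (simp add: W_simps alt V_W e V_closed(4) W21) (simp add: algebra_simps)
  then show "r = W (M f1) f2 + W f1 (M f2)" using det r by simp
qed

text \<open>The second vector of any admissible basis lies in the -1 eigenline of the quotient, so
  it is \<open>k\<close> times \<open>f2\<close> modulo \<open>x\<close>, and
  \<open>b = W (M e2) e2\<close> changes only by the positive factor \<open>k * k\<close>.\<close>

lemma B_sign_eq:
  assumes f: "f1 \<in> V" "f2 \<in> V" "W f1 f2 = 1"
    and R: "linear R" "R x = - x" "R f1 = f1" "R f2 = - f2"
  shows "(THE s. \<exists>e1 e2 a b c d. quotient_basis V x e1 e2 \<and> W e1 e2 = 1 \<and>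
      quotient_matrix (image R) x e1 e2 1 0 0 (- 1) \<and>
      quotient_matrix (image M) x e1 e2 a b c d \<and> s = sgn b) = sgn (W (M f2) f2)"
proof (rule the_equality)
  have R_coset: "R ` coset x u = coset x (R u)" for u
    using image_coset[OF R(1), of x u] R(2) by (simp add: coset_minus)
  have "quotient_matrix (image R) x f1 f2 1 0 0 (- 1)"
    by (simp add: quotient_matrix_def R_coset R)
  then show "\<exists>e1 e2 a b c d. quotient_basis V x e1 e2 \<and> W e1 e2 = 1 \<and>
      quotient_matrix (image R) x e1 e2 1 0 0 (- 1) \<and>
      quotient_matrix (image M) x e1 e2 a b c d \<and> sgn (W (M f2) f2) = sgn b"
    using \<open>quotient_matrix (image R) x f1 f2 1 0 0 (- 1)\<close>
    by (intro exI conjI) (rule quotient_basis_symplectic[OF f] quotient_matrix_M[OF f] f(3) refl | assumption)+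
  fix s assume "\<exists>e1 e2 a b c d. quotient_basis V x e1 e2 \<and> W e1 e2 = 1 \<and>
      quotient_matrix (image R) x e1 e2 1 0 0 (- 1) \<and>
      quotient_matrix (image M) x e1 e2 a b c d \<and> s = sgn b"
  then obtain e1 e2 a b c d where qb: "quotient_basis V x e1 e2" and e12: "W e1 e2 = 1"
    and qR: "quotient_matrix (image R) x e1 e2 1 0 0 (- 1)"
    and qm: "quotient_matrix (image M) x e1 e2 a b c d" and s: "s = sgn b" by blast
  have e: "e1 \<in> V" "e2 \<in> V" "W e1 e2 = 1" using qb e12 by (simp_all add: quotient_basis_def)
  obtain t where t: "M e2 = b *\<^sub>R e1 + d *\<^sub>R e2 + t *\<^sub>R x"
    using qm unfolding quotient_matrix_def M_coset coset_eq_iff by blast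
  obtain t' where t': "R e2 = - e2 + t' *\<^sub>R x"
    using qR unfolding quotient_matrix_def R_coset coset_eq_iff by auto
  obtain t'' where e2: "e2 = W e2 f2 *\<^sub>R f1 + W f1 e2 *\<^sub>R f2 + t'' *\<^sub>R x"
    using symplectic_coordinates[OF f e(2)] .
  have "W (R e2) f2 = - W e2 f2" using t' f V_W by (simp add: W_simps)
  moreover have "W (R e2) f2 = W e2 f2"
    by (subst e2) (simp add: linear_add[OF R(1)] linear_scale[OF R(1)] R W_simps alt V_W f)
  ultimately have 0: "W e2 f2 = 0" by simp
  define k where "k = W f1 e2"
  have e2': "e2 = k *\<^sub>R f2 + t'' *\<^sub>R x" using e2 0 by (simp add: k_def)
  have "k \<noteq> 0" using e V_W by (auto simp: e2' W_simps)
  have "b = W (M e2) e2" unfolding t using e alt V_W by (simp add: W_simps)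
  also have "\<dots> = k * k * W (M f2) f2"
    unfolding e2' using M_V[OF f(2)] f
    by (simp add: linear_add[OF M(1)] linear_scale[OF M(1)] M(3) W_simps V_W alt)
  finally show "s = sgn (W (M f2) f2)" using s \<open>k \<noteq> 0\<close> by (simp add: sgn_mult)
qed

end

end

text \<open>A trace different from -2 excludes \<open>p * s = 0\<close>; a trace different from 2
  excludes \<open>p * s = 1\<close> and thereby \<open>q = 0\<close>. So the common factor
  \<open>2 * q\<close> drops out of the sign comparison.\<close>

lemma sign_arithmetic:
  fixes p q r s :: real
  assumes "p * s - q * r = 1" "2 * (p * s + q * r) \<noteq> 2" "2 * (p * s + q * r) \<noteq> - 2"
  shows "2 * (p * s + q * r) < - 2 \<longleftrightarrow> sgn (2 * q * s) \<noteq> sgn (2 * p * q)"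
proof -
  have qr: "q * r = p * s - 1" using assms(1) by simp
  have "p * s \<noteq> 1" "p * s \<noteq> 0" using assms(2,3) unfolding qr by auto
  then have "q \<noteq> 0" "p \<noteq> 0" "s \<noteq> 0" using qr by auto
  then have "sgn (2 * q * s) \<noteq> sgn (2 * p * q) \<longleftrightarrow> sgn s \<noteq> sgn p"
    by (simp add: sgn_mult sgn_eq_0_iff)
  also have "\<dots> \<longleftrightarrow> p * s < 0"
    using \<open>p \<noteq> 0\<close> \<open>s \<noteq> 0\<close> by (auto simp: sgn_if mult_less_0_iff)
  finally have "sgn (2 * q * s) \<noteq> sgn (2 * p * q) \<longleftrightarrow> p * s < 0" .
  then show ?thesis unfolding qr by auto
qed

text \<open>\<open>M0\<close> and \<open>M1\<close> below are the monodromies at the two symmetric points, \<open>N\<close> is the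
  differential of the flow for half a period.\<close>

locale half_period_map = P0: reduced_plane W0 x0 + P1: reduced_plane W1 x1
  for W0 W1 :: "'a::euclidean_space \<Rightarrow> 'a \<Rightarrow> real" and x0 x1 +
  fixes R0 R1 N N' :: "'a \<Rightarrow> 'a"
  assumes R0: "linear R0" "\<And>u. R0 (R0 u) = u" "\<And>u w. W0 (R0 u) (R0 w) = - W0 u w" "R0 x0 = - x0"
    and R1: "linear R1" "\<And>u. R1 (R1 u) = u" "\<And>u w. W1 (R1 u) (R1 w) = - W1 u w" "R1 x1 = - x1"
    and N: "linear N" "\<And>u w. W1 (N u) (N w) = W0 u w" "N x0 = x1"
    and N': "linear N'" "\<And>u. N' (N u) = u" "\<And>u. N (N' u) = u"
begin

definition M0 where "M0 u = R0 (N' (R1 (N u)))"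
definition M1 where "M1 u = N (R0 (N' (R1 u)))"

lemma N'_symplectic: "W0 (N' u) (N' w) = W1 u w"
  using N(2)[of "N' u" "N' w"] by (simp add: N'(3))

lemma N'_x: "N' x1 = x0"
  using N'(2)[of x0] N(3) by simp

lemma M0: "linear M0" "W0 (M0 u) (M0 w) = W0 u w" "M0 x0 = x0"
proof -
  have "linear (R0 \<circ> (N' \<circ> (R1 \<circ> N)))" by (intro linear_compose R0 R1 N N')
  then show "linear M0" by (simp add: M0_def[abs_def] o_def)
  show "W0 (M0 u) (M0 w) = W0 u w" by (simp add: M0_def R0(3) R1(3) N N'_symplectic)
  show "M0 x0 = x0" by (simp add: M0_def N(3) R1(4) linear_neg[OF N'(1)] N'_x linear_neg[OF R0(1)] R0(4))
qed

lemma M1: "linear M1" "W1 (M1 u) (M1 w) = W1 u w" "M1 x1 = x1"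
proof -
  have "linear (N \<circ> (R0 \<circ> (N' \<circ> R1)))" by (intro linear_compose R0 R1 N N')
  then show "linear M1" by (simp add: M1_def[abs_def] o_def)
  show "W1 (M1 u) (M1 w) = W1 u w" by (simp add: M1_def R0(3) R1(3) N N'_symplectic)
  show "M1 x1 = x1" by (simp add: M1_def N(3) R1(4) linear_neg[OF N'(1)] N'_x linear_neg[OF R0(1)] R0(4))
qed

text \<open>The definite description in \<open>B_sign\<close> as pure linear algebra, with plane,
  reflection and monodromy as parameters, so that one formula serves both symmetric points.\<close>

definition B :: "('a \<Rightarrow> 'a \<Rightarrow> real) \<Rightarrow> 'a set \<Rightarrow> 'a \<Rightarrow> ('a \<Rightarrow> 'a) \<Rightarrow> ('a \<Rightarrow> 'a) \<Rightarrow> real" where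
  "B W V x R M = (THE s. \<exists>e1 e2 a b c d. quotient_basis V x e1 e2 \<and> W e1 e2 = 1 \<and>
      quotient_matrix (image R) x e1 e2 1 0 0 (- 1) \<and>
      quotient_matrix (image M) x e1 e2 a b c d \<and> s = sgn b)"

lemma trace_B_sign:
  assumes "quotient_trace P0.V x0 (image M0) \<noteq> 2" "quotient_trace P0.V x0 (image M0) \<noteq> - 2"
  shows "quotient_trace P0.V x0 (image M0) < - 2 \<longleftrightarrow> B W0 P0.V x0 R0 M0 \<noteq> B W1 P1.V x1 R1 M1"
proof -
  obtain f1 f2 where f: "f1 \<in> P0.V" "f2 \<in> P0.V" "W0 f1 f2 = 1" and Rf: "R0 f1 = f1" "R0 f2 = - f2"
    using P0.adapted_basis_exists[OF R0] by metis
  obtain g1 g2 where g: "g1 \<in> P1.V" "g2 \<in> P1.V" "W1 g1 g2 = 1" and Rg: "R1 g1 = g1" "R1 g2 = - g2"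
    using P1.adapted_basis_exists[OF R1] by metis
  have NV: "N u \<in> P1.V" if "u \<in> P0.V" for u
    using N(2)[of u x0] that by (simp add: P0.V_def P1.V_def N(3))
  have N'V: "N' u \<in> P0.V" if "u \<in> P1.V" for u
    using N'_symplectic[of u x1] that by (simp add: P0.V_def P1.V_def N'_x)
  \<comment> \<open>The columns \<open>(p, r)\<close> and \<open>(q, s)\<close> are the coordinates
    of \<open>N f1\<close> and \<open>N f2\<close> modulo \<open>x1\<close>.\<close>
  define p r q s where "p = W1 (N f1) g2" "r = W1 g1 (N f1)" "q = W1 (N f2) g2" "s = W1 g1 (N f2)"
  note pqrs = this
  obtain k1 where k1: "N f1 = p *\<^sub>R g1 + r *\<^sub>R g2 + k1 *\<^sub>R x1"
    using P1.symplectic_coordinates[OF g NV[OF f(1)]] unfolding pqrs .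
  obtain k2 where k2: "N f2 = q *\<^sub>R g1 + s *\<^sub>R g2 + k2 *\<^sub>R x1"
    using P1.symplectic_coordinates[OF g NV[OF f(2)]] unfolding pqrs .
  \<comment> \<open>Only the second column of the inverse matrix is needed; for determinant 1 it is
    \<open>(- q, p)\<close>.\<close>
  obtain k3 where "N' g2 = W0 (N' g2) f2 *\<^sub>R f1 + W0 f1 (N' g2) *\<^sub>R f2 + k3 *\<^sub>R x0"
    using P0.symplectic_coordinates[OF f N'V[OF g(2)]] .
  moreover have "W0 (N' g2) f2 = - q" "W0 f1 (N' g2) = p"
    using N(2)[of "N' g2" f2] N(2)[of f1 "N' g2"] P1.antisym[of g2 "N f2"] by (simp_all add: N'(3) pqrs)
  ultimately have k3: "N' g2 = - q *\<^sub>R f1 + p *\<^sub>R f2 + k3 *\<^sub>R x0" by simp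
  have g21: "W1 g2 g1 = - 1" and f21: "W0 f2 f1 = - 1" using P1.antisym[of g2 g1] P0.antisym[of f2 f1] f g by simp_all
  note R1s = linear_add[OF R1(1)] linear_diff[OF R1(1)] linear_scale[OF R1(1)] Rg R1(4)
  note R0s = linear_add[OF R0(1)] linear_diff[OF R0(1)] linear_scale[OF R0(1)] Rf R0(4)
  note S1 = P1.W_simps P1.alt P1.V_W P1.V_closed(4) g g21
  note S0 = P0.W_simps P0.alt P0.V_W P0.V_closed(4) f f21
  \<comment> \<open>Adjoint rules: a reflection is minus its own adjoint, and the adjoint of
    \<open>N\<close> is its inverse. They move the factors of the monodromy across the form until
    only known coordinates remain.\<close>
  have RR: "W0 (R0 u) w = - W0 u (R0 w)" for u w using R0(3)[of u "R0 w"] by (simp add: R0(2))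
  have RR': "W0 u (R0 w) = - W0 (R0 u) w" for u w using R0(3)[of u "R0 w"] by (simp add: R0(2))
  have NN: "W0 (N' u) w = W1 u (N w)" for u w using N(2)[of "N' u" w] by (simp add: N'(3))
  have NN': "W0 w (N' u) = W1 (N w) u" for u w using N(2)[of w "N' u"] by (simp add: N'(3))
  have det: "p * s - q * r = 1"
    using N(2)[of f1 f2] unfolding k1 k2 by (simp add: S1 f(3) mult.commute)
  have b0: "W0 (M0 f2) f2 = 2 * q * s"
  proof -
    have "W0 (M0 f2) f2 = W1 (R1 (N f2)) (N f2)" by (simp add: M0_def RR Rf P0.W_simps NN)
    also have "\<dots> = 2 * q * s" unfolding k2 by (simp add: R1s S1)
    finally show ?thesis .
  qed
  have b1: "W1 (M1 g2) g2 = 2 * p * q"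
  proof -
    \<comment> \<open>Applying \<open>N'\<close> to both arguments pulls the pairing back to the
      plane at \<open>x0\<close>, where only \<open>N' g2\<close> enters.\<close>
    have "W1 (M1 g2) g2 = - W0 (R0 (N' g2)) (N' g2)"
      using N'_symplectic[of "M1 g2" g2] by (simp add: M1_def N'(2) Rg linear_neg[OF N'(1)] linear_neg[OF R0(1)] P0.W_simps)
    also have "\<dots> = 2 * p * q" unfolding k3 by (simp add: R0s S0)
    finally show ?thesis .
  qed
  have "W0 (M0 f1) f2 = W1 (R1 (N f1)) (N f2)" by (simp add: M0_def RR Rf P0.W_simps NN)
  also have "\<dots> = p * s + q * r" unfolding k1 k2 by (simp add: R1s S1)
  finally have a: "W0 (M0 f1) f2 = p * s + q * r" .
  have "W0 f1 (M0 f2) = - W1 (N f1) (R1 (N f2))" by (simp add: M0_def RR' Rf NN')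
  also have "\<dots> = p * s + q * r" unfolding k1 k2 by (simp add: R1s S1)
  finally have d: "W0 f1 (M0 f2) = p * s + q * r" .
  have tr: "quotient_trace P0.V x0 (image M0) = 2 * (p * s + q * r)"
    using P0.quotient_trace_eq[OF M0 f] a d by simp
  have B: "B W0 P0.V x0 R0 M0 = sgn (2 * q * s)" "B W1 P1.V x1 R1 M1 = sgn (2 * p * q)"
    unfolding B_def
    using P0.B_sign_eq[OF M0 f R0(1,4) Rf] P1.B_sign_eq[OF M1 g R1(1,4) Rg] b0 b1 by simp_all
  show ?thesis
    using sign_arithmetic[OF det] assms unfolding tr B by simp
qed

end

section \<open>Symmetric orbits\<close>

locale reversible_orbit = hamiltonian_orbit A \<omega> H v
  for A :: "('m::{t2_space,second_countable_topology}, real^'n) chart set" and \<omega> H v +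
  fixes \<rho> :: "'m \<Rightarrow> 'm"
  assumes antisymplectic: "antisymplectic_involution A \<omega> \<rho>" and H_\<rho>: "H \<circ> \<rho> = H"
    and v_symmetric: "\<rho> (v (- t)) = v t"
begin

lemma \<rho>_\<rho>: "\<rho> (\<rho> p) = p"
  using antisymplectic by (auto simp: antisymplectic_involution_def dest: fun_cong)

lemma d\<rho>: "mderiv (chart_at A p) (chart_at A (\<rho> p)) \<rho> p (diff_map A \<rho> p)"
  using antisymplectic
  by (intro smooth_map_diff_map) (simp add: antisymplectic_involution_def diffeomorphism_def)

lemma d\<rho>_antisymplectic: "\<omega> (\<rho> p) (diff_map A \<rho> p u) (diff_map A \<rho> p w) = - \<omega> p u w"
  using antisymplectic by (simp add: antisymplectic_involution_def)

lemma d\<rho>_d\<rho>: "diff_map A \<rho> (\<rho> p) (diff_map A \<rho> p u) = u"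
proof -
  have "mderiv (chart_at A p) (chart_at A p) (\<rho> \<circ> \<rho>) p (diff_map A \<rho> (\<rho> p) \<circ> diff_map A \<rho> p)"
    using d\<rho>[of "\<rho> p"] by (intro mderiv_comp[OF d\<rho>]) (simp add: \<rho>_\<rho>)
  moreover have "\<rho> \<circ> \<rho> = id" by (simp add: fun_eq_iff \<rho>_\<rho>)
  ultimately have "diff_map A \<rho> (\<rho> p) \<circ> diff_map A \<rho> p = id"
    using mderiv_id[OF is_chart_at chart_at(2), of p] by (simp add: mderiv_unique)
  then show ?thesis by (simp add: fun_eq_iff)
qed

text \<open>Pairing with vectors \<open>diff_map A \<rho> p u\<close>: the differential of
  \<open>H\<close> is preserved while the form changes sign, so the field must change sign.\<close>

lemma d\<rho>_X: "diff_map A \<rho> p (X p) = - X (\<rho> p)"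
proof (rule \<omega>_eqI[of "\<rho> p"])
  fix w
  define u where "u = diff_map A \<rho> (\<rho> p) w"
  have w: "w = diff_map A \<rho> p u" using d\<rho>_d\<rho>[of "\<rho> p" w] by (simp add: u_def \<rho>_\<rho>)
  have "mderiv (chart_at A p) real_chart (H \<circ> \<rho>) p (diff_function A H (\<rho> p) \<circ> diff_map A \<rho> p)"
    by (rule mderiv_comp[OF d\<rho> dH])
  then have "diff_function A H (\<rho> p) \<circ> diff_map A \<rho> p = diff_function A H p"
    using dH[of p] by (simp add: H_\<rho> mderiv_unique)
  then have "\<omega> (\<rho> p) w (X (\<rho> p)) = \<omega> p u (X p)"
    by (simp add: X[symmetric] w fun_eq_iff)
  then show "\<omega> (\<rho> p) w (diff_map A \<rho> p (X p)) = \<omega> (\<rho> p) w (- X (\<rho> p))"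
    unfolding linear_neg[OF \<omega>_linear(1)] by (simp add: w d\<rho>_antisymplectic)
qed

text \<open>Since \<rho> carries \<open>X\<close> to its negative,
  \<open>\<lambda>s. \<rho> (\<gamma> (- s))\<close> is again an integral curve; existence is
  transported together with the value.\<close>

lemma flows_reverse:
  assumes "flows t p q"
  shows "flows (- t) (\<rho> p) (\<rho> q)"
proof -
  obtain \<gamma> a b where 1: "{0, t} \<subseteq> {a<..<b}" "integral_curve A X {a<..<b} \<gamma>" "\<gamma> 0 = p" "\<gamma> t = q"
    using assms flows_def by blast
  have "has_velocity A (\<lambda>s. \<rho> (\<gamma> (- s))) s (X (\<rho> (\<gamma> (- s))))" if "s \<in> {-b<..<-a}" for s
  proof -
    have "has_velocity A \<gamma> (- s) (X (\<gamma> (- s)))" using 1(2) that by (simp add: integral_curve_def)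
    from has_velocity_comp[OF this d\<rho>]
    have "has_velocity A (\<lambda>r. \<rho> (\<gamma> r)) (- s) (- X (\<rho> (\<gamma> (- s))))" by (simp add: d\<rho>_X o_def)
    from has_velocity_reflect[OF this] show ?thesis by simp
  qed
  then have "integral_curve A X {-b<..<-a} (\<lambda>s. \<rho> (\<gamma> (- s)))" by (simp add: integral_curve_def)
  moreover have "{0, - t} \<subseteq> {-b<..<-a}" using 1(1) by auto
  ultimately show ?thesis
    unfolding flows_def using 1 by (intro exI[of _ "\<lambda>s. \<rho> (\<gamma> (- s))"] exI[of _ "- b"] exI[of _ "- a"]) simp
qed

lemma \<rho>_v: "\<rho> (v s) = v (- s)"
  using v_symmetric[of "- s"] by simp

text \<open>The derivative at \<open>v s\<close> of
  \<open>flow A X (- t) (\<rho> p) = \<rho> (flow A X t p)\<close>, an identity established for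
  \<open>p\<close> in a neighbourhood of \<open>v s\<close> on which the flow exists.\<close>

lemma D_reverse: "D (- s) (- t) (diff_map A \<rho> (v s) u) = diff_map A \<rho> (v (s + t)) (D s t u)"
proof -
  obtain W where W: "open W" "v s \<in> W" "\<And>p. p \<in> W \<Longrightarrow> \<exists>q. flows t p q"
    using regular_flow[of s t] by (auto simp: regular_flow_def eventually_nhds)
  have eq: "flow A X (- t) (\<rho> p) = \<rho> (flow A X t p)" if p: "p \<in> W" for p
  proof -
    obtain q where q: "flows t p q" using W(3)[OF p] by blast
    show ?thesis using flows_flow[OF q] flows_flow[OF flows_reverse[OF q]] by simp
  qed
  have "mderiv (chart_at A (v s)) (chart_at A (v (- s + - t))) (flow A X (- t) \<circ> \<rho>) (v s) (D (- s) (- t) \<circ> diff_map A \<rho> (v s))"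
    by (rule mderiv_comp[OF d\<rho>]) (use D_mderiv[of "- s" "- t"] in \<open>simp add: \<rho>_v\<close>)
  moreover have "mderiv (chart_at A (v s)) (chart_at A (v (- s + - t))) (\<rho> \<circ> flow A X t) (v s) (diff_map A \<rho> (v (s + t)) \<circ> D s t)"
    by (rule mderiv_comp[OF D_mderiv]) (use d\<rho>[of "v (s + t)"] in \<open>simp add: \<rho>_v flow_orbit\<close>)
  then have "mderiv (chart_at A (v s)) (chart_at A (v (- s + - t))) (flow A X (- t) \<circ> \<rho>) (v s) (diff_map A \<rho> (v (s + t)) \<circ> D s t)"
    by (rule mderiv_transform[OF _ W(1,2)]) (simp add: eq)
  ultimately have "D (- s) (- t) \<circ> diff_map A \<rho> (v s) = diff_map A \<rho> (v (s + t)) \<circ> D s t"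
    by (rule mderiv_unique)
  then show ?thesis by (simp add: fun_eq_iff)
qed

lemma energy_tangent_eq:
  assumes "X (v t) \<noteq> 0"
  shows "energy_tangent A H v t = {u. \<omega> (v t) u (X (v t)) = 0}"
  using tangent_space_level_set[OF assms] H_orbit[of 0 t] by (simp add: energy_tangent_def)

end

theorem theoremC:
  fixes A :: "('m::{t2_space,second_countable_topology}, real^4) chart set"
    and \<omega> :: "'m \<Rightarrow> real^4 \<Rightarrow> real^4 \<Rightarrow> real"
    and \<rho> :: "'m \<Rightarrow> 'm" and H :: "'m \<Rightarrow> real"
    and v :: "real \<Rightarrow> 'm" and \<tau> :: real
  assumes "symplectic_manifold A \<omega>"
    and "antisymplectic_involution A \<omega> \<rho>"
    and "smooth_function A H" and "H \<circ> \<rho> = H"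
    and "\<tau> > 0" and "\<And>t. v (t + \<tau>) = v t"
    and "integral_curve A (hamiltonian_vf A \<omega> H) UNIV v"
    and "\<not> v constant_on UNIV"
    and "\<And>t. \<rho> (v (- t)) = v t"
    and "monodromy_trace A \<omega> H v \<tau> \<noteq> 2" and "monodromy_trace A \<omega> H v \<tau> \<noteq> - 2"
  shows "negative_hyperbolic A \<omega> H v \<tau> \<longleftrightarrow>
    B_sign A \<omega> \<rho> H v \<tau> 0 \<noteq> B_sign A \<omega> \<rho> H v \<tau> (\<tau> / 2)"
proof -
  interpret reversible_orbit A \<omega> H v \<rho>
  proof
    show "smooth_atlas A" using assms(1) by (simp add: symplectic_manifold_def)
  qed (use assms in auto)
  let ?h = "\<tau> / 2"
  have X0: "X (v s) \<noteq> 0" for s by (rule X_orbit_nonzero[OF assms(8)])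
  have period: "v (s + \<tau>) = v s" for s by (rule assms(6))
  \<comment> \<open>Periodicity identifies the times \<open>- ?h\<close> and \<open>?h\<close>; this
    is what makes \<open>v ?h\<close> a fixed point of \<rho>.\<close>
  have v_h: "v (- ?h) = v ?h" using period[of "- ?h"] by (simp add: field_simps)
  have fixed: "\<rho> (v 0) = v 0" "\<rho> (v ?h) = v ?h" using \<rho>_v v_h by auto
  define R0 R1 where "R0 = diff_map A \<rho> (v 0)" and "R1 = diff_map A \<rho> (v ?h)"
  define N N' where "N = D 0 ?h" and "N' = D ?h (- ?h)"
  have V: "{u. \<omega> p u (X p) = 0} = reduced_plane.V (\<omega> p) (X p)" if "X p \<noteq> 0" for p
    using that \<omega>_bilinear \<omega>_alt \<omega>_nondegenerate by (subst reduced_plane.V_def) (auto simp: reduced_plane_def)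
  have "reduced_plane (\<omega> (v s)) (X (v s))" for s
    using X0 \<omega>_bilinear \<omega>_alt \<omega>_nondegenerate by (simp add: reduced_plane_def)
  moreover have N'N: "N' (N u) = u" and NN': "N (N' u) = u" for u
    using D_add[of 0 ?h "- ?h" u] D_add[of ?h "- ?h" ?h u] by (simp_all add: N_def N'_def D_zero)
  ultimately interpret half_period_map "\<omega> (v 0)" "\<omega> (v ?h)" "X (v 0)" "X (v ?h)" R0 R1 N N'
  proof (intro half_period_map.intro half_period_map_axioms.intro)
    show "linear R0" "linear R1" unfolding R0_def R1_def using mderiv_linear[OF d\<rho>] by auto
    show "R0 (R0 u) = u" "R1 (R1 u) = u" for u
      unfolding R0_def R1_def using d\<rho>_d\<rho>[of "v 0" u] d\<rho>_d\<rho>[of "v ?h" u] by (simp_all add: fixed)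
    show "\<omega> (v 0) (R0 u) (R0 w) = - \<omega> (v 0) u w" "\<omega> (v ?h) (R1 u) (R1 w) = - \<omega> (v ?h) u w" for u w
      unfolding R0_def R1_def using d\<rho>_antisymplectic[of "v 0" u w] d\<rho>_antisymplectic[of "v ?h" u w]
      by (simp_all add: fixed)
    show "R0 (X (v 0)) = - X (v 0)" "R1 (X (v ?h)) = - X (v ?h)"
      unfolding R0_def R1_def by (simp_all add: d\<rho>_X fixed)
    show "linear N" "linear N'" unfolding N_def N'_def by (rule D_linear)+
    show "\<omega> (v ?h) (N u) (N w) = \<omega> (v 0) u w" for u w
      unfolding N_def using D_symplectic[of 0 ?h u w] by simp
    show "N (X (v 0)) = X (v ?h)" unfolding N_def using D_X[of 0 ?h] by simp
  qed auto
  \<comment> \<open>Half a period backwards from \<open>v 0\<close> is the reflection of half a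
    period forwards.\<close>
  have backward: "D 0 (- ?h) u = R1 (N (R0 u))" for u
    using D_reverse[of 0 ?h "R0 u"] R0(2)[of u] by (simp add: R0_def R1_def N_def)
  \<comment> \<open>\<open>D\<close> depends on its base time only through the orbit point, so the
    second half may be taken to start at \<open>v (- ?h)\<close>, where it inverts the backward
    half.\<close>
  have second_half: "D ?h ?h w = R0 (N' (R1 w))" for w
  proof -
    have "D (- ?h) ?h (D 0 (- ?h) u) = u" for u using D_add[of 0 "- ?h" ?h u] by (simp add: D_zero)
    from this[of "R0 (N' (R1 w))"] have "D (- ?h) ?h w = R0 (N' (R1 w))"
      by (simp add: backward R0(2) R1(2) NN')
    then show ?thesis by (simp add: D_def v_h)
  qed
  have M0_eq: "D 0 \<tau> = M0"
    using D_add[of 0 ?h ?h] by (simp add: fun_eq_iff M0_def second_half N_def[symmetric])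
  have M1_eq: "D ?h \<tau> = M1"
  proof
    fix u
    \<comment> \<open>Half a period after \<open>v ?h\<close> the orbit is back at
      \<open>v 0\<close>, so the remaining half is again \<open>N\<close>.\<close>
    have "D (?h + ?h) = D 0" using period[of 0] by (simp add: D_def fun_eq_iff)
    then show "D ?h \<tau> u = M1 u" using D_add[of ?h ?h ?h u] by (simp add: M1_def second_half N_def[symmetric])
  qed
  have E: "energy_tangent A H v s = reduced_plane.V (\<omega> (v s)) (X (v s))" for s
    using energy_tangent_eq[OF X0] V[OF X0] by simp
  have M: "reduced_monodromy A \<omega> H v \<tau> s = image (D s \<tau>)" for s
    by (simp add: reduced_monodromy_def D_def)
  have tr: "monodromy_trace A \<omega> H v \<tau> = quotient_trace P0.V (X (v 0)) (image M0)"
    by (simp add: monodromy_trace_def E M M0_eq)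
  have B: "B_sign A \<omega> \<rho> H v \<tau> 0 = B (\<omega> (v 0)) P0.V (X (v 0)) R0 M0"
    "B_sign A \<omega> \<rho> H v \<tau> ?h = B (\<omega> (v ?h)) P1.V (X (v ?h)) R1 M1"
    by (simp_all add: B_sign_def B_def Let_def E M M0_eq M1_eq R0_def R1_def)
  show ?thesis
    using trace_B_sign assms(10,11) unfolding negative_hyperbolic_def tr B by simp
qed

end
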